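(* Let $d\ge1$, $\Omega=[0,1]^d$, $2\le p<\infty$, $L>0$. For any $s\in[0,1)$ there exists a histogram estimator $\hat f$ (for each sample size $n$, a probability density on $\Omega$, computed from $n$ i.i.d. observations with density $f$, that is constant on each cell of a finite partition of $\Omega$ into cubes) and a constant $C$ not depending on $n$ such that for all $n\ge2$ $$\sup_{f\in\mathcal C^{s}(L)}\mathbb E\,W_p(f,\hat f)\le C\cdot\begin{cases} n^{-\frac{1+s/p}{d+s}} & d-s> 2p,\\ n^{-\frac{1}{2p}}\log n & d-s=2p,\\ n^{-\frac1{2p}} & d-s<2p.\end{cases}$$
   Context: $W_p(f,g)$ denotes the $p$-Wasserstein distance between the probability measures $\mu,\nu$ on $\Omega$ with densities $f,g$: $W_p^p(\mu,\nu)=\inf_\pi\int\|x-y\|^p\,d\pi(x,y)$ over couplings $\pi$ of $\mu$ and $\nu$, with $\|\cdot\|$ the Euclidean norm. $\mathbb E$ is expectation over $X_1,\dots,X_n$ i.i.d. with density $f$. $\mathcal C^s(L)$ is the Hölder class of probability densities $f$ on $\Omega$ with $\sup_x|f(x)|+\sup_{x\ne y}\frac{|f(x)-f(y)|}{\|x-y\|^s}\le L$ (for $s=0$: bounded densities). *)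

theory Defs
  imports "HOL-Probability.Probability"
begin

abbreviation unit_cube :: "(real ^ 'd) set"
  where "unit_cube \<equiv> cbox 0 1"

abbreviation cube_measure :: "(real ^ 'd) measure"
  where "cube_measure \<equiv> restrict_space lborel unit_cube"

text \<open>Functions on the unit cube are total functions of which only the values on the cube matter.\<close>

definition prob_density_on_cube :: "(real ^ 'd \<Rightarrow> real) \<Rightarrow> bool"
  where "prob_density_on_cube f \<longleftrightarrow>
    f \<in> borel_measurable cube_measure \<and> (\<forall>x\<in>unit_cube. 0 \<le> f x) \<and>
    (\<integral>\<^sup>+x. ennreal (f x) \<partial>cube_measure) = 1"

definition density_measure :: "(real ^ 'd \<Rightarrow> real) \<Rightarrow> (real ^ 'd) measure"
  where "density_measure f = density cube_measure (\<lambda>x. ennreal (f x))"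

text \<open>The suprema are taken in the extended nonnegative reals, so an infinite supremum is never
  below \<open>L\<close>. For \<open>s = 0\<close> the class consists of the densities bounded by \<open>L\<close>: the seminorm,
  which would then be the oscillation of \<open>f\<close>, is dropped.\<close>

definition holder_class :: "real \<Rightarrow> real \<Rightarrow> (real ^ 'd \<Rightarrow> real) set"
  where "holder_class s L = {f. prob_density_on_cube f \<and>
    (SUP x\<in>unit_cube. ennreal \<bar>f x\<bar>) +
    (if s = 0 then 0
     else SUP (x, y)\<in>{(x, y). x \<in> unit_cube \<and> y \<in> unit_cube \<and> x \<noteq> y}.
            ennreal (\<bar>f x - f y\<bar> / norm (x - y) powr s))
    \<le> ennreal L}"

definition couplings :: "'a measure \<Rightarrow> 'b measure \<Rightarrow> ('a \<times> 'b) measure set"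
  where "couplings M N = {\<pi>. sets \<pi> = sets (M \<Otimes>\<^sub>M N) \<and> distr \<pi> M fst = M \<and> distr \<pi> N snd = N}"

definition transport_cost ::
    "real \<Rightarrow> 'a::real_normed_vector measure \<Rightarrow> 'a measure \<Rightarrow> ennreal"
  where "transport_cost p M N =
    (INF \<pi>\<in>couplings M N. \<integral>\<^sup>+z. ennreal (norm (fst z - snd z) powr p) \<partial>\<pi>)"

definition wasserstein ::
    "real \<Rightarrow> 'a::real_normed_vector measure \<Rightarrow> 'a measure \<Rightarrow> ennreal"
  where "wasserstein p M N =
    (if transport_cost p M N = \<top> then \<top>
     else ennreal (enn2real (transport_cost p M N) powr (1 / p)))"

text \<open>A cube with side length \<open>h > 0\<close> may contain or omit each of its faces, so that the unit cube
  can be partitioned into genuinely disjoint cubes.\<close>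

definition is_cube :: "(real ^ 'd) set \<Rightarrow> bool"
  where "is_cube Q \<longleftrightarrow> (\<exists>a h I. 0 < h \<and>
    (\<forall>i. {a $ i<..<a $ i + h} \<subseteq> I i \<and> I i \<subseteq> {a $ i..a $ i + h}) \<and>
    Q = {x. \<forall>i. x $ i \<in> I i})"

text \<open>A sample of size \<open>n\<close> is a function on \<open>{..<n}\<close> with values in the unit cube. The partition
  does not depend on the sample. Joint measurability makes the estimator a function of the data in
  the measure-theoretic sense.\<close>

definition histogram_estimator ::
    "nat \<Rightarrow> ((nat \<Rightarrow> real ^ 'd) \<Rightarrow> real ^ 'd \<Rightarrow> real) \<Rightarrow> bool"
  where "histogram_estimator n g \<longleftrightarrow>
    (\<lambda>(X, x). g X x) \<in> borel_measurable ((\<Pi>\<^sub>M i\<in>{..<n}. cube_measure) \<Otimes>\<^sub>M cube_measure) \<and>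
    (\<forall>X \<in> {..<n} \<rightarrow>\<^sub>E unit_cube. prob_density_on_cube (g X)) \<and>
    (\<exists>P. finite P \<and> partition_on unit_cube P \<and> (\<forall>Q\<in>P. is_cube Q) \<and>
         (\<forall>X \<in> {..<n} \<rightarrow>\<^sub>E unit_cube. \<forall>Q\<in>P. g X constant_on Q))"

definition sample_measure :: "nat \<Rightarrow> (real ^ 'd \<Rightarrow> real) \<Rightarrow> (nat \<Rightarrow> real ^ 'd) measure"
  where "sample_measure n f = (\<Pi>\<^sub>M i\<in>{..<n}. density_measure f)"

definition rate :: "real \<Rightarrow> real \<Rightarrow> real \<Rightarrow> nat \<Rightarrow> real"
  where "rate d s p n =
    (if d - s > 2 * p then real n powr (- ((1 + s / p) / (d + s)))
     else if d - s = 2 * p then real n powr (- (1 / (2 * p))) * ln (real n)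
     else real n powr (- (1 / (2 * p))))"

end

theory Submission
  imports Defs
begin

text \<open>
  Let \<open>D\<^sub>j\<close> be the dyadic cells of side \<open>2\<^sup>-\<^sup>j\<close> and \<open>\<mu>\<^sub>n\<close> the empirical measure. The estimator is the histogram
  on \<open>D\<^sub>J\<close> with \<open>2\<^sup>J \<approx> n powr (1 / (d + s))\<close>. One travels from \<open>f\<close> to it through the densities \<open>g\<^sub>j\<close> equal to
  \<open>(\<mu>\<^sub>n Q / f Q) * f\<close> on each \<open>Q \<in> D\<^sub>j\<close>, so that \<open>g\<^sub>0 = f\<close>, and from \<open>g\<^sub>J\<close> to the histogram.

  The step from \<open>g\<^sub>j\<close> to \<open>g\<^sub>j\<^sub>+\<^sub>1\<close> moves mass inside each \<open>Q \<in> D\<^sub>j\<close> only. Let \<open>Z\<close> be the deviation of \<open>\<mu>\<^sub>n\<close> from \<open>f\<close>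
  on \<open>Q\<close> and its children. If \<open>f \<lesssim> 2\<^sup>-\<^sup>j\<^sup>s\<close> on \<open>Q\<close>, then moving only the excess mass costs \<open>2\<^sup>-\<^sup>j\<^sup>p Z\<close>, and
  \<open>f Q \<lesssim> 2 powr - j (d + s)\<close> makes \<open>Z\<close> small. Otherwise \<open>f\<close> is nearly constant on \<open>Q\<close>, and moving all the mass of \<open>Q\<close>
  by a distance of order \<open>2\<^sup>-\<^sup>j Z / f Q\<close> costs only \<open>2\<^sup>-\<^sup>j\<^sup>p Z\<^sup>2 / f Q\<close>, because \<open>p \<ge> 2\<close>. As \<open>Z\<^sup>2\<close> has expectation of
  order \<open>f Q / n\<close>, both cases sum up to \<open>2\<^sup>-\<^sup>j\<^sup>p 2 powr (j (d - s) / 2) n powr (-1/2)\<close> over \<open>D\<^sub>j\<close>; the triangle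
  inequality for \<open>W\<^sub>p\<close> then gives a geometric series, whose three regimes are those of the rate.
\<close>

section \<open>Transport plans given by kernels\<close>

text \<open>Reweighting \<open>f\<close> itself, instead of passing through coarser histograms,
  leaves the shape of \<open>f\<close> inside a cell untouched along the chain. The roughness of
  \<open>f\<close> is therefore paid for only once, in the step to the histogram, where it costs
  2^(-J(p+s)). The resolution balances this bias against the sampling error of the finest level: the
  two agree when 2^(J(d+s)) is of order n. The same choice restricts the chain to levels on which
  1/n, the order of Z^2 / f Q, is at most 2^(-j(d+s)/2) n^(-1/2), the order of the standard
  deviation of the frequency of a cell with small \<open>f\<close>; this is why cells of the second
  kind cost no more than those of the first. The obstacle is that \<open>f\<close> may vanish.
  Moving all mass a little requires a lower bound on the density, and no global one exists. The
  oscillation of \<open>f\<close> on the cell is the right threshold: twice above it, the values of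
  \<open>f\<close> on the cell are comparable to each other; below it, the cell carries so little
  mass that transport across the whole cell is affordable.\<close>

abbreviation pcost :: "real \<Rightarrow> 'a::real_normed_vector \<Rightarrow> 'a \<Rightarrow> ennreal"
  where "pcost p x y \<equiv> ennreal (norm (x - y) powr p)"

text \<open>Kernels, unlike couplings, can be composed without disintegrating measures.\<close>

definition transportable :: "real \<Rightarrow> 'a::euclidean_space measure \<Rightarrow> 'a measure \<Rightarrow> ennreal \<Rightarrow> bool"
  where "transportable p M N c \<longleftrightarrow>
    (\<exists>\<kappa>\<in>borel \<rightarrow>\<^sub>M prob_algebra borel. M \<bind> \<kappa> = N \<and>
      (\<integral>\<^sup>+x. \<integral>\<^sup>+y. pcost p x y \<partial>\<kappa> x \<partial>M) \<le> c)"

lemma transportable_mono: "transportable p M N c \<Longrightarrow> c \<le> c' \<Longrightarrow> transportable p M N c'"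
  unfolding transportable_def by (meson order_trans)

text \<open>The restriction to \<open>A\<close> sits in the density, so that all measures and
  kernels live on the whole space and can be composed freely.\<close>

abbreviation dens :: "('a::euclidean_space \<Rightarrow> real) \<Rightarrow> 'a set \<Rightarrow> 'a measure"
  where "dens u A \<equiv> density lborel (\<lambda>x. ennreal (u x) * indicator A x)"

lemma transportable_map:
  fixes M :: "'a::euclidean_space measure"
  assumes M[measurable_cong]: "sets M = sets borel" and T[measurable]: "T \<in> borel \<rightarrow>\<^sub>M borel"
    and N: "distr M borel T = N" and c: "(\<integral>\<^sup>+x. ennreal (norm (x - T x) powr p) \<partial>M) \<le> c"
  shows "transportable p M N c"
  unfolding transportable_def
proof (intro bexI conjI)
  have sp: "space M \<noteq> {}" using sets_eq_imp_space_eq[OF M] by simp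
  show "M \<bind> (\<lambda>x. return borel (T x)) = N"
    unfolding N[symmetric] by (rule bind_return_distr'[OF sp]) measurable
  show "(\<integral>\<^sup>+x. \<integral>\<^sup>+y. pcost p x y \<partial>return borel (T x) \<partial>M) \<le> c"
    using c by (subst nn_integral_return) auto
qed measurable

lemma transportable_refl:
  assumes "sets M = sets borel"
  shows "transportable p M M 0"
  by (rule transportable_map[where T="\<lambda>x. x"]) (auto simp: assms intro: distr_id2)

text \<open>Jensen's inequality for the power function at the points \<open>a / \<alpha>\<close> and
  \<open>b / \<beta>\<close> with weights proportional to \<open>\<alpha>\<close> and
  \<open>\<beta>\<close>.\<close>

lemma powr_add_le:
  fixes a b :: real
  assumes "1 \<le> p" "0 \<le> a" "0 \<le> b" "0 < \<alpha>" "0 < \<beta>"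
  shows "(a + b) powr p \<le> (\<alpha> + \<beta>) powr (p - 1) * (a powr p / \<alpha> powr (p - 1) + b powr p / \<beta> powr (p - 1))"
proof -
  have K: "\<alpha> * (a / \<alpha>) powr p = a powr p / \<alpha> powr (p - 1)" if "0 \<le> a" "0 < \<alpha>" for a \<alpha> :: real
    using that by (simp add: powr_divide powr_diff field_simps)
  have conv: "((1 - t) * x + t * y) powr p \<le> (1 - t) * x powr p + t * y powr p"
    if "0 \<le> x" "0 \<le> y" "0 < t" "t < 1" for x y t :: real
  proof (cases "x = 0 \<or> y = 0")
    case False
    then show ?thesis
      using convex_onD[OF powr_convex[OF assms(1)], of t x y] that by simp
  next
    \<comment> \<open>Convexity was used at positive points. At an end point 0 the claim reduces to
      \<open>r powr p \<le> r\<close> for \<open>r\<close> between 0 and 1.\<close>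
    case True
    have "r powr p \<le> r" if "0 < r" "r < 1" for r :: real
      using powr_mono'[of 1 p r] that assms(1) by simp
    then have *: "r powr p * x \<le> r * x" if "0 < r" "r < 1" "0 \<le> x" for r x :: real
      using that by (intro mult_right_mono) auto
    from True that show ?thesis
      by (elim disjE) (auto simp: powr_mult intro!: *)
  qed
  define t where "t = \<beta> / (\<alpha> + \<beta>)"
  have t: "0 < t" "t < 1" "1 - t = \<alpha> / (\<alpha> + \<beta>)"
    using assms by (auto simp: t_def field_simps)
  have e: "(a + b) / (\<alpha> + \<beta>) = (1 - t) * (a / \<alpha>) + t * (b / \<beta>)"
    using assms unfolding t(3) by (simp add: t_def add_divide_distrib)
  have "(a + b) powr p = (\<alpha> + \<beta>) powr p * ((a + b) / (\<alpha> + \<beta>)) powr p"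
    using assms by (simp add: powr_divide)
  also have "\<dots> \<le> (\<alpha> + \<beta>) powr p * ((1 - t) * (a / \<alpha>) powr p + t * (b / \<beta>) powr p)"
    unfolding e using assms t by (intro mult_left_mono conv) auto
  also have "\<dots> = (\<alpha> + \<beta>) powr (p - 1) * (\<alpha> * (a / \<alpha>) powr p + \<beta> * (b / \<beta>) powr p)"
  proof -
    have "(\<alpha> + \<beta>) powr p = (\<alpha> + \<beta>) powr (p - 1) * (\<alpha> + \<beta>)"
      using assms by (simp add: powr_diff)
    moreover have "(\<alpha> + \<beta>) * ((1 - t) * X + t * Y) = \<alpha> * X + \<beta> * Y" for X Y
    proof -
      have "(\<alpha> + \<beta>) * (1 - t) = \<alpha>" "(\<alpha> + \<beta>) * t = \<beta>"
        using assms unfolding t(3) by (auto simp: t_def)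
      then show ?thesis by (simp add: distrib_left flip: mult.assoc)
    qed
    ultimately show ?thesis by (simp add: mult.assoc)
  qed
  finally show ?thesis using assms by (simp add: K)
qed

text \<open>For \<open>\<alpha>\<close> and \<open>\<beta>\<close> proportional to the \<open>p\<close>-th roots of the costs this is the triangle inequality of \<open>W\<^sub>p\<close>.
  Free weights allow to take those for the expected costs when the costs are random.\<close>

lemma transportable_trans:
  fixes M :: "'a::euclidean_space measure"
  assumes M[measurable_cong]: "sets M = sets borel" and "1 \<le> p" "0 < \<alpha>" "0 < \<beta>"
    and "transportable p M N c" "transportable p N R c'"
  shows "transportable p M R (ennreal ((\<alpha> + \<beta>) powr (p - 1)) *
    (c / ennreal (\<alpha> powr (p - 1)) + c' / ennreal (\<beta> powr (p - 1))))"
proof -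
  obtain \<kappa> where k: "\<kappa> \<in> borel \<rightarrow>\<^sub>M prob_algebra borel" and N: "M \<bind> \<kappa> = N"
    and c: "(\<integral>\<^sup>+x. \<integral>\<^sup>+y. pcost p x y \<partial>\<kappa> x \<partial>M) \<le> c"
    using assms unfolding transportable_def by blast
  obtain \<kappa>' where k': "\<kappa>' \<in> borel \<rightarrow>\<^sub>M prob_algebra borel" and R: "N \<bind> \<kappa>' = R"
    and c': "(\<integral>\<^sup>+x. \<integral>\<^sup>+y. pcost p x y \<partial>\<kappa>' x \<partial>N) \<le> c'"
    using assms unfolding transportable_def by blast
  note ks[measurable] = measurable_prob_algebraD[OF k]
  note ks'[measurable] = measurable_prob_algebraD[OF k']
  have ks2[measurable]: "\<kappa> \<in> M \<rightarrow>\<^sub>M subprob_algebra borel"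
    by measurable
  have [measurable_cong]: "sets (\<kappa> x) = sets borel" "sets (\<kappa>' x) = sets borel" for x
    using sets_kernel[OF ks, of x] sets_kernel[OF ks', of x] by auto
  have ks'x: "\<kappa>' \<in> \<kappa> x \<rightarrow>\<^sub>M subprob_algebra borel" for x
    using ks' by (subst measurable_cong_sets[OF sets_kernel[OF ks, of x] refl]) simp_all
  have [measurable]: "(\<lambda>x. \<integral>\<^sup>+y. pcost p x y \<partial>\<kappa> x) \<in> borel_measurable borel"
    "(\<lambda>x. \<integral>\<^sup>+y. pcost p x y \<partial>\<kappa>' x) \<in> borel_measurable borel"
    by (rule nn_integral_measurable_subprob_algebra2[OF _ ks], measurable)
       (rule nn_integral_measurable_subprob_algebra2[OF _ ks'], measurable)
  have [measurable]: "(\<lambda>x. \<integral>\<^sup>+y. (\<integral>\<^sup>+z. pcost p y z \<partial>\<kappa>' y) \<partial>\<kappa> x) \<in> borel_measurable borel"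
    by (rule nn_integral_measurable_subprob_algebra2[OF _ ks], measurable)
  have P1: "emeasure (\<kappa>' y) (space (\<kappa>' y)) = 1" for y
    using measurable_space[OF k', of y] by (simp add: space_prob_algebra prob_space.emeasure_space_1)
  define A where "A = (\<alpha> + \<beta>) powr (p - 1)"
  define e where "e = ennreal (1 / \<alpha> powr (p - 1))"
  define e' where "e' = ennreal (1 / \<beta> powr (p - 1))"
  have de: "C / ennreal (\<alpha> powr (p - 1)) = C * e" "C / ennreal (\<beta> powr (p - 1)) = C * e'" for C
    using assms by (simp_all add: divide_ennreal_def e_def e'_def inverse_ennreal inverse_eq_divide)
  have pt: "pcost p x z \<le>
     ennreal A * (pcost p x y * e + pcost p y z * e')" for x y z :: 'a
  proof -
    have "norm (x - z) powr p \<le> (norm (x - y) + norm (y - z)) powr p"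
      using assms norm_triangle_ineq[of "x - y" "y - z"] by (intro powr_mono2) auto
    also have "\<dots> \<le> A * (norm (x - y) powr p * (1/ \<alpha> powr (p - 1)) + norm (y - z) powr p * (1/ \<beta> powr (p - 1)))"
      using powr_add_le[of p "norm (x - y)" "norm (y - z)" \<alpha> \<beta>] assms by (simp add: A_def)
    finally have "pcost p x z \<le> ennreal \<dots>" by (rule ennreal_leI)
    also have "\<dots> = ennreal A * (pcost p x y * e + pcost p y z * e')"
      unfolding e_def e'_def A_def by (simp add: ennreal_mult ennreal_plus flip: ennreal_mult')
    finally show ?thesis .
  qed
  have mk: "f \<in> borel_measurable (\<kappa> x)" if "f \<in> borel_measurable borel" for f :: "'a \<Rightarrow> ennreal" and x
    using that by (subst measurable_cong_sets[OF sets_kernel[OF ks, of x] refl]) simp_all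
  have mb: "(\<lambda>y. pcost p x y) \<in> borel_measurable (\<kappa> x)" for x
    by (rule mk) measurable
  have in1: "(\<integral>\<^sup>+z. pcost p x z \<partial>(\<kappa> x \<bind> \<kappa>')) \<le>
     ennreal A * ((\<integral>\<^sup>+y. pcost p x y \<partial>\<kappa> x) * e
       + (\<integral>\<^sup>+y. \<integral>\<^sup>+z. pcost p y z \<partial>\<kappa>' y \<partial>\<kappa> x) * e')" for x
  proof -
    have "(\<integral>\<^sup>+z. pcost p x z \<partial>(\<kappa> x \<bind> \<kappa>')) =
       (\<integral>\<^sup>+y. \<integral>\<^sup>+z. pcost p x z \<partial>\<kappa>' y \<partial>\<kappa> x)"
      by (rule nn_integral_bind[where B=borel, OF _ ks'x]) measurable
    also have "\<dots> \<le> (\<integral>\<^sup>+y. \<integral>\<^sup>+z. ennreal A * (pcost p x y * e + pcost p y z * e') \<partial>\<kappa>' y \<partial>\<kappa> x)"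
      by (intro nn_integral_mono pt)
    also have "\<dots> = (\<integral>\<^sup>+y. ennreal A * (pcost p x y * e + (\<integral>\<^sup>+z. pcost p y z \<partial>\<kappa>' y) * e') \<partial>\<kappa> x)"
      by (simp add: nn_integral_cmult nn_integral_add nn_integral_multc P1)
    also have "\<dots> = ennreal A * ((\<integral>\<^sup>+y. pcost p x y \<partial>\<kappa> x) * e
       + (\<integral>\<^sup>+y. \<integral>\<^sup>+z. pcost p y z \<partial>\<kappa>' y \<partial>\<kappa> x) * e')"
      by (simp add: nn_integral_cmult nn_integral_add nn_integral_multc mk mb)
    finally show ?thesis .
  qed
  show ?thesis
    unfolding transportable_def
  proof (intro bexI[of _ "\<lambda>x. \<kappa> x \<bind> \<kappa>'"] conjI)
    show "(\<lambda>x. \<kappa> x \<bind> \<kappa>') \<in> borel \<rightarrow>\<^sub>M prob_algebra borel"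
      by (rule measurable_bind_prob_space[OF k k'])
    show "M \<bind> (\<lambda>x. \<kappa> x \<bind> \<kappa>') = R"
      unfolding R[symmetric] N[symmetric] by (rule bind_assoc[symmetric, OF ks2 ks'])
    have "(\<integral>\<^sup>+x. \<integral>\<^sup>+y. pcost p x y \<partial>(\<kappa> x \<bind> \<kappa>') \<partial>M)
      \<le> (\<integral>\<^sup>+x. ennreal A * ((\<integral>\<^sup>+y. pcost p x y \<partial>\<kappa> x) * e
       + (\<integral>\<^sup>+y. \<integral>\<^sup>+z. pcost p y z \<partial>\<kappa>' y \<partial>\<kappa> x) * e') \<partial>M)"
      by (intro nn_integral_mono in1)
    also have "\<dots> = ennreal A * ((\<integral>\<^sup>+x. \<integral>\<^sup>+y. pcost p x y \<partial>\<kappa> x \<partial>M) * e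
       + (\<integral>\<^sup>+x. \<integral>\<^sup>+y. \<integral>\<^sup>+z. pcost p y z \<partial>\<kappa>' y \<partial>\<kappa> x \<partial>M) * e')"
      by (simp add: nn_integral_cmult nn_integral_add nn_integral_multc)
    \<comment> \<open>The intermediate point is distributed as \<open>N\<close>, so the second half
      of the bound is the cost of the second plan.\<close>
    also have "(\<integral>\<^sup>+x. \<integral>\<^sup>+y. \<integral>\<^sup>+z. pcost p y z \<partial>\<kappa>' y \<partial>\<kappa> x \<partial>M)
      = (\<integral>\<^sup>+y. \<integral>\<^sup>+z. pcost p y z \<partial>\<kappa>' y \<partial>N)"
      unfolding N[symmetric] by (rule nn_integral_bind[where B=borel, symmetric]) measurable
    also have "ennreal A * ((\<integral>\<^sup>+x. \<integral>\<^sup>+y. pcost p x y \<partial>\<kappa> x \<partial>M) * e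
       + (\<integral>\<^sup>+y. \<integral>\<^sup>+z. pcost p y z \<partial>\<kappa>' y \<partial>N) * e') \<le> ennreal A * (c * e + c' * e')"
      using c c' by (intro mult_left_mono add_mono mult_right_mono) auto
    finally show "(\<integral>\<^sup>+x. \<integral>\<^sup>+y. pcost p x y \<partial>(\<kappa> x \<bind> \<kappa>') \<partial>M)
      \<le> ennreal ((\<alpha> + \<beta>) powr (p - 1)) * (c / ennreal (\<alpha> powr (p - 1)) + c' / ennreal (\<beta> powr (p - 1)))"
      by (simp add: de A_def)
  qed
qed

text \<open>The glued kernel follows the first plan at points of \<open>A\<close> and the second one
  elsewhere. As \<open>A\<close> and \<open>B\<close> are disjoint, source and target densities are
  sums of their pieces.\<close>

lemma transportable_Un:
  fixes u v :: "'a::euclidean_space \<Rightarrow> ennreal"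
  assumes [measurable]: "u \<in> borel_measurable borel" "v \<in> borel_measurable borel" "A \<in> sets borel" "B \<in> sets borel"
    and "A \<inter> B = {}"
    and "transportable p (density lborel (\<lambda>x. u x * indicator A x)) (density lborel (\<lambda>x. v x * indicator A x)) a"
    and "transportable p (density lborel (\<lambda>x. u x * indicator B x)) (density lborel (\<lambda>x. v x * indicator B x)) b"
  shows "transportable p (density lborel (\<lambda>x. u x * indicator (A \<union> B) x)) (density lborel (\<lambda>x. v x * indicator (A \<union> B) x)) (a + b)"
proof -
  let ?M = "\<lambda>A. density lborel (\<lambda>x. u x * indicator A x)"
  let ?N = "\<lambda>A. density lborel (\<lambda>x. v x * indicator A x)"
  obtain \<kappa> where k: "\<kappa> \<in> borel \<rightarrow>\<^sub>M prob_algebra borel" and N: "?M A \<bind> \<kappa> = ?N A"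
    and c: "(\<integral>\<^sup>+x. \<integral>\<^sup>+y. pcost p x y \<partial>\<kappa> x \<partial>?M A) \<le> a"
    using assms unfolding transportable_def by blast
  obtain \<kappa>' where k': "\<kappa>' \<in> borel \<rightarrow>\<^sub>M prob_algebra borel" and N': "?M B \<bind> \<kappa>' = ?N B"
    and c': "(\<integral>\<^sup>+x. \<integral>\<^sup>+y. pcost p x y \<partial>\<kappa>' x \<partial>?M B) \<le> b"
    using assms unfolding transportable_def by blast
  define \<nu> where "\<nu> = (\<lambda>x. if x \<in> A then \<kappa> x else \<kappa>' x)"
  have n: "\<nu> \<in> borel \<rightarrow>\<^sub>M prob_algebra borel"
    unfolding \<nu>_def by (rule measurable_If_set[OF k k']) simp
  note ks[measurable] = measurable_prob_algebraD[OF k]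
  note ks'[measurable] = measurable_prob_algebraD[OF k']
  note ns[measurable] = measurable_prob_algebraD[OF n]
  have sb: "\<kappa> \<in> density lborel f \<rightarrow>\<^sub>M subprob_algebra borel"
     "\<kappa>' \<in> density lborel f \<rightarrow>\<^sub>M subprob_algebra borel"
     "\<nu> \<in> density lborel f \<rightarrow>\<^sub>M subprob_algebra borel" for f
    using ks ks' ns by (simp_all add: measurable_density_eq1)
  have [measurable_cong]: "sets (\<kappa> x) = sets borel" "sets (\<kappa>' x) = sets borel" "sets (\<nu> x) = sets borel" for x
    using sets_kernel[OF ks, of x] sets_kernel[OF ks', of x] sets_kernel[OF ns, of x] by auto
  have [measurable]: "(\<lambda>x. \<integral>\<^sup>+y. pcost p x y \<partial>\<kappa> x) \<in> borel_measurable borel"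
    "(\<lambda>x. \<integral>\<^sup>+y. pcost p x y \<partial>\<kappa>' x) \<in> borel_measurable borel"
    "(\<lambda>x. \<integral>\<^sup>+y. pcost p x y \<partial>\<nu> x) \<in> borel_measurable borel"
    by (rule nn_integral_measurable_subprob_algebra2[OF _ ks], measurable)
       (rule nn_integral_measurable_subprob_algebra2[OF _ ks'], measurable,
        rule nn_integral_measurable_subprob_algebra2[OF _ ns], measurable)
  \<comment> \<open>Abstracting over the functional \<open>F\<close> of the kernel serves two
    purposes: with the mass given to a set it identifies the target, with the inner integral it
    bounds the cost.\<close>
  have split: "(\<integral>\<^sup>+x. F \<nu> x \<partial>?M (A \<union> B)) = (\<integral>\<^sup>+x. F \<kappa> x \<partial>?M A) + (\<integral>\<^sup>+x. F \<kappa>' x \<partial>?M B)"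
    if "F \<nu> \<in> borel_measurable borel" "F \<kappa> \<in> borel_measurable borel" "F \<kappa>' \<in> borel_measurable borel"
      and "\<And>x. x \<in> A \<Longrightarrow> F \<nu> x = F \<kappa> x" "\<And>x. x \<in> B \<Longrightarrow> F \<nu> x = F \<kappa>' x"
    for F :: "('a \<Rightarrow> 'a measure) \<Rightarrow> 'a \<Rightarrow> ennreal"
  proof -
    have "(\<integral>\<^sup>+x. F \<nu> x \<partial>?M (A \<union> B)) = (\<integral>\<^sup>+x. u x * indicator (A \<union> B) x * F \<nu> x \<partial>lborel)"
      using that by (subst nn_integral_density) auto
    also have "\<dots> = (\<integral>\<^sup>+x. u x * indicator A x * F \<kappa> x + u x * indicator B x * F \<kappa>' x \<partial>lborel)"
      using that \<open>A \<inter> B = {}\<close> by (intro nn_integral_cong) (auto split: split_indicator)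
    also have "\<dots> = (\<integral>\<^sup>+x. F \<kappa> x \<partial>?M A) + (\<integral>\<^sup>+x. F \<kappa>' x \<partial>?M B)"
      using that by (subst nn_integral_add) (auto simp: nn_integral_density)
    finally show ?thesis .
  qed
  have nu: "\<And>x. x \<in> A \<Longrightarrow> \<nu> x = \<kappa> x" "\<And>x. x \<in> B \<Longrightarrow> \<nu> x = \<kappa>' x"
    using \<open>A \<inter> B = {}\<close> by (auto simp: \<nu>_def)
  show ?thesis
    unfolding transportable_def
  proof (intro bexI[OF _ n] conjI)
    show "?M (A \<union> B) \<bind> \<nu> = ?N (A \<union> B)"
    proof (rule measure_eqI)
      show "sets (?M (A \<union> B) \<bind> \<nu>) = sets (?N (A \<union> B))"
        by (subst sets_bind[where N=borel]) (auto simp: sets_kernel[OF ns])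
      fix S assume "S \<in> sets (?M (A \<union> B) \<bind> \<nu>)"
      then have S[measurable]: "S \<in> sets borel"
        by (subst (asm) sets_bind[where N=borel]) (auto simp: sets_kernel[OF ns])
      have eb: "emeasure (density lborel f \<bind> \<mu>) S = (\<integral>\<^sup>+x. emeasure (\<mu> x) S \<partial>density lborel f)"
        if "\<mu> \<in> borel \<rightarrow>\<^sub>M subprob_algebra borel" for f \<mu>
        using that by (subst emeasure_bind[where N=borel]) (auto simp: measurable_density_eq1)
      have "emeasure (?M (A \<union> B) \<bind> \<nu>) S = emeasure (?M A \<bind> \<kappa>) S + emeasure (?M B \<bind> \<kappa>') S"
        unfolding eb[OF ks] eb[OF ks'] eb[OF ns]
        by (rule split[where F="\<lambda>\<mu> x. emeasure (\<mu> x) S"]) (auto simp: nu)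
      also have "\<dots> = (\<integral>\<^sup>+x. v x * indicator A x * indicator S x + v x * indicator B x * indicator S x \<partial>lborel)"
        unfolding N N' by (subst nn_integral_add) (auto simp: emeasure_density)
      also have "\<dots> = emeasure (?N (A \<union> B)) S"
        using \<open>A \<inter> B = {}\<close>
        by (subst emeasure_density) (auto intro!: nn_integral_cong split: split_indicator)
      finally show "emeasure (?M (A \<union> B) \<bind> \<nu>) S = emeasure (?N (A \<union> B)) S" .
    qed
    have "(\<integral>\<^sup>+x. \<integral>\<^sup>+y. pcost p x y \<partial>\<nu> x \<partial>?M (A \<union> B))
      = (\<integral>\<^sup>+x. \<integral>\<^sup>+y. pcost p x y \<partial>\<kappa> x \<partial>?M A) + (\<integral>\<^sup>+x. \<integral>\<^sup>+y. pcost p x y \<partial>\<kappa>' x \<partial>?M B)"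
      by (rule split[where F="\<lambda>\<mu> x. \<integral>\<^sup>+y. pcost p x y \<partial>\<mu> x"]) (auto simp: nu)
    also have "\<dots> \<le> a + b" using c c' by (rule add_mono)
    finally show "(\<integral>\<^sup>+x. \<integral>\<^sup>+y. pcost p x y \<partial>\<nu> x \<partial>?M (A \<union> B)) \<le> a + b" .
  qed
qed

lemma transportable_UN:
  fixes u v :: "'a::euclidean_space \<Rightarrow> ennreal"
  assumes "finite K" and [measurable]: "u \<in> borel_measurable borel" "v \<in> borel_measurable borel"
    and "\<And>k. k \<in> K \<Longrightarrow> A k \<in> sets borel" and "disjoint_family_on A K"
    and "\<And>k. k \<in> K \<Longrightarrow> transportable p (density lborel (\<lambda>x. u x * indicator (A k) x)) (density lborel (\<lambda>x. v x * indicator (A k) x)) (c k)"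
  shows "transportable p (density lborel (\<lambda>x. u x * indicator (\<Union>k\<in>K. A k) x))
    (density lborel (\<lambda>x. v x * indicator (\<Union>k\<in>K. A k) x)) (\<Sum>k\<in>K. c k)"
  using assms(1,4-)
proof (induction K)
  case empty
  then show ?case by (simp add: transportable_refl)
next
  case (insert k K)
  have "disjoint_family_on A K" and d: "A k \<inter> (\<Union>k\<in>K. A k) = {}"
    using insert.prems insert.hyps by (auto simp: disjoint_family_on_insert)
  then have "transportable p (density lborel (\<lambda>x. u x * indicator (A k \<union> (\<Union>k\<in>K. A k)) x))
    (density lborel (\<lambda>x. v x * indicator (A k \<union> (\<Union>k\<in>K. A k)) x)) (c k + (\<Sum>k\<in>K. c k))"
    using insert by (intro transportable_Un insert.IH) (auto intro!: sets.finite_UN)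
  then show ?case using insert.hyps by simp
qed

section \<open>Rearrangement along a coordinate\<close>

text \<open>The additive form gives measurability at once and turns integrals over \<open>r\<close>
  into translates, to which the invariance of \<open>lborel\<close> applies.\<close>

definition upd :: "real ^ 'd \<Rightarrow> 'd \<Rightarrow> real \<Rightarrow> real ^ 'd"
  where "upd x i r = x + (r - x $ i) *\<^sub>R axis i 1"

lemma upd_nth: "upd x i r $ k = (if k = i then r else x $ k)"
  by (simp add: upd_def axis_def)

lemma upd_upd [simp]: "upd (upd x i s) i r = upd x i r"
  by (simp add: vec_eq_iff upd_nth)

lemma upd_commute: "i \<noteq> k \<Longrightarrow> upd (upd x i s) k r = upd (upd x k r) i s"
  by (auto simp: vec_eq_iff upd_nth)

lemma borel_measurable_nth [measurable (raw)]:
  fixes f :: "'a \<Rightarrow> real ^ 'd"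
  assumes [measurable]: "f \<in> borel_measurable M"
  shows "(\<lambda>z. f z $ i) \<in> borel_measurable M"
proof -
  have [measurable]: "(\<lambda>x::real ^ 'd. x $ i) \<in> borel_measurable borel"
    by (intro borel_measurable_continuous_onI continuous_intros)
  show ?thesis by measurable
qed

lemma borel_measurable_upd [measurable (raw)]:
  "f \<in> borel_measurable M \<Longrightarrow> g \<in> borel_measurable M \<Longrightarrow> (\<lambda>z. upd (f z) i (g z)) \<in> borel_measurable M"
  unfolding upd_def
  by (intro borel_measurable_add borel_measurable_scaleR borel_measurable_diff borel_measurable_nth measurable_const) auto

lemma nn_integral_lborel_translate:
  fixes f :: "'a::euclidean_space \<Rightarrow> ennreal"
  assumes [measurable]: "f \<in> borel_measurable borel"
  shows "(\<integral>\<^sup>+x. f (c + x) \<partial>lborel) = (\<integral>\<^sup>+x. f x \<partial>lborel)"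
  by (subst (2) lborel_distr_plus[of c, symmetric], subst nn_integral_distr) auto

text \<open>Fubini for the coordinate \<open>i\<close> without decomposing the space: the additional variable \<open>r\<close> is split off by
  translation invariance, and the coordinate that it replaces is averaged over the unit interval.\<close>

lemma nn_integral_upd:
  fixes \<phi> :: "real ^ 'd \<Rightarrow> ennreal"
  assumes [measurable]: "\<phi> \<in> borel_measurable borel"
  shows "(\<integral>\<^sup>+x. \<phi> x \<partial>lborel) =
    (\<integral>\<^sup>+x. indicator {0..1} (x $ i) * (\<integral>\<^sup>+r. \<phi> (upd x i r) \<partial>lborel) \<partial>lborel)"
proof -
  have 1: "(\<integral>\<^sup>+r. \<phi> (upd x i r) \<partial>lborel) = (\<integral>\<^sup>+r. \<phi> (x + r *\<^sub>R axis i 1) \<partial>lborel)" for x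
    using nn_integral_lborel_translate[of "\<lambda>r. \<phi> (x + r *\<^sub>R axis i 1)" "- (x $ i)"]
    by (simp add: upd_def)
  have 2: "(\<integral>\<^sup>+x. indicator {0..1} (x $ i) * \<phi> (x + r *\<^sub>R axis i 1) \<partial>lborel)
      = (\<integral>\<^sup>+x. indicator {0..1} (x $ i - r) * \<phi> x \<partial>lborel)" for r
    using nn_integral_lborel_translate[of "\<lambda>x. indicator {0..1} (x $ i - r) * \<phi> x" "r *\<^sub>R axis i 1"]
    by (simp add: add.commute)
  \<comment> \<open>The averaging factor: those \<open>r\<close> for which the old coordinate
    \<open>t - r\<close> lies in the unit interval form an interval of length one.\<close>
  have 3: "(\<integral>\<^sup>+r. indicator {0..1} (t - r) \<partial>lborel) = 1" for t :: real
  proof -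
    have "(\<integral>\<^sup>+r. indicator {0..1} (t - r) \<partial>lborel) = (\<integral>\<^sup>+r. indicator {t - 1..t} r \<partial>lborel)"
      by (intro nn_integral_cong) (auto split: split_indicator)
    then show ?thesis by simp
  qed
  have "(\<integral>\<^sup>+x. indicator {0..1} (x $ i) * (\<integral>\<^sup>+r. \<phi> (upd x i r) \<partial>lborel) \<partial>lborel)
     = (\<integral>\<^sup>+x. \<integral>\<^sup>+r. indicator {0..1} (x $ i) * \<phi> (x + r *\<^sub>R axis i 1) \<partial>lborel \<partial>lborel)"
    unfolding 1 by (subst nn_integral_cmult) auto
  also have "\<dots> = (\<integral>\<^sup>+r. \<integral>\<^sup>+x. indicator {0..1} (x $ i) * \<phi> (x + r *\<^sub>R axis i 1) \<partial>lborel \<partial>lborel)"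
    by (rule lborel_pair.Fubini') measurable
  also have "\<dots> = (\<integral>\<^sup>+x. \<integral>\<^sup>+r. indicator {0..1} (x $ i - r) * \<phi> x \<partial>lborel \<partial>lborel)"
    unfolding 2 by (rule lborel_pair.Fubini') measurable
  also have "\<dots> = (\<integral>\<^sup>+x. \<phi> x \<partial>lborel)"
    by (subst nn_integral_multc) (auto simp: 3)
  finally show ?thesis by simp
qed

section \<open>Monotone rearrangement on an interval\<close>

abbreviation prim :: "real \<Rightarrow> (real \<Rightarrow> real) \<Rightarrow> real \<Rightarrow> real"
  where "prim a u t \<equiv> (LBINT r:{a..t}. u r)"

lemma set_integrable_bounded:
  fixes u :: "real \<Rightarrow> real"
  assumes [measurable]: "u \<in> borel_measurable borel" "S \<in> sets borel" and "S \<subseteq> {a..b}"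
    and "\<And>r. r \<in> {a..b} \<Longrightarrow> \<bar>u r\<bar> \<le> C"
  shows "set_integrable lborel S u"
proof -
  have "set_integrable lborel {a..b} (\<lambda>_. \<bar>C\<bar>)"
    by (auto simp: set_integrable_def emeasure_lborel_Icc_eq intro!: integrable_real_indicator)
  then have "set_integrable lborel S (\<lambda>_. \<bar>C\<bar>)"
    by (rule set_integrable_subset) (use assms in auto)
  then show ?thesis
  proof (rule set_integrable_bound)
    show "set_borel_measurable lborel S u" by (simp add: set_borel_measurable_def)
    show "AE x in lborel. x \<in> S \<longrightarrow> norm (u x) \<le> norm \<bar>C\<bar>"
      using assms(3,4) by (intro always_eventually) force
  qed
qed

text \<open>Bounds on a density are bounds on the slopes of its primitive. The lower one yields
  injectivity and controls displacements, the upper one yields continuity.\<close>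

lemma prim_diff:
  fixes u :: "real \<Rightarrow> real"
  assumes [measurable]: "u \<in> borel_measurable borel" and "\<And>r. r \<in> {a..b} \<Longrightarrow> c \<le> u r \<and> u r \<le> C"
    and st: "a \<le> s" "s \<le> t" "t \<le> b"
  shows "prim a u t - prim a u s = (LBINT r:{s<..t}. u r)"
    and "c * (t - s) \<le> prim a u t - prim a u s" and "prim a u t - prim a u s \<le> C * (t - s)"
proof -
  have b: "\<bar>u r\<bar> \<le> max \<bar>c\<bar> \<bar>C\<bar>" if "r \<in> {a..b}" for r
    using assms(2)[OF that] by auto
  note si = set_integrable_bounded[OF assms(1) _ _ b]
  have "(LBINT r:{a..s} \<union> {s<..t}. u r) = (LBINT r:{a..s}. u r) + (LBINT r:{s<..t}. u r)"
    by (intro set_integral_Un si) (use st in auto)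
  moreover have "{a..s} \<union> {s<..t} = {a..t}" using st by auto
  ultimately show e: "prim a u t - prim a u s = (LBINT r:{s<..t}. u r)" by simp
  have i: "set_integrable lborel {s<..t} u" by (rule si) (use st in auto)
  have ic: "set_integrable lborel {s<..t} (\<lambda>r. k)" "(LBINT r:{s<..t}. k) = k * (t - s)" for k :: real
    using st by (auto simp: set_integrable_def set_lebesgue_integral_def)
  have "(LBINT r:{s<..t}. c) \<le> (LBINT r:{s<..t}. u r)"
    by (intro set_integral_mono i ic) (use st assms(2) in auto)
  then show "c * (t - s) \<le> prim a u t - prim a u s" by (simp add: e ic)
  have "(LBINT r:{s<..t}. u r) \<le> (LBINT r:{s<..t}. C)"
    by (intro set_integral_mono i ic) (use st assms(2) in auto)
  then show "prim a u t - prim a u s \<le> C * (t - s)" by (simp add: e ic)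
qed

lemma prim_continuous:
  fixes u :: "real \<Rightarrow> real"
  assumes "u \<in> borel_measurable borel" and "\<And>r. r \<in> {a..b} \<Longrightarrow> 0 \<le> u r \<and> u r \<le> C" "0 \<le> C"
  shows "continuous_on {a..b} (prim a u)"
proof -
  have "C-lipschitz_on {a..b} (prim a u)"
  proof (rule lipschitz_onI)
    fix x y assume xy: "x \<in> {a..b}" "y \<in> {a..b}"
    have *: "\<bar>prim a u t - prim a u s\<bar> \<le> C * \<bar>t - s\<bar>" if "a \<le> s" "s \<le> t" "t \<le> b" for s t
      using prim_diff(2,3)[OF assms(1,2) that] that by auto
    show "dist (prim a u x) (prim a u y) \<le> C * dist x y"
      using *[of x y] *[of y x] xy by (cases "x \<le> y") (auto simp: dist_real_def abs_minus_commute)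
  qed fact
  then show ?thesis by (rule lipschitz_on_continuous_on)
qed

text \<open>The increasing rearrangement, or quantile transform: the distribution function of
  \<open>u\<close> followed by the inverse of that of \<open>v\<close>.\<close>

definition rearr :: "real \<Rightarrow> real \<Rightarrow> (real \<Rightarrow> real) \<Rightarrow> (real \<Rightarrow> real) \<Rightarrow> real \<Rightarrow> real"
  where "rearr a b u v t = the_inv_into {a..b} (prim a v) (prim a u t)"

text \<open>Lets the simplifier see that \<open>prim a w a\<close> vanishes, since
  \<open>{a..a}\<close> is rewritten to \<open>{a}\<close>.\<close>

lemma set_integral_singleton [simp]: "(LBINT r:{a}. w r) = 0" for w :: "real \<Rightarrow> real"
  unfolding set_lebesgue_integral_def
  by (intro integral_eq_zero_AE eventually_mono[OF AE_lborel_singleton[of a]]) auto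

text \<open>Models the restriction of two densities to one segment of a cube. The assumptions are
  symmetric in \<open>u\<close> and \<open>v\<close>, so each fact about one primitive transfers to
  the other by \<open>swap\<close>.\<close>

locale fibre =
  fixes a b c C :: real and u v :: "real \<Rightarrow> real"
  assumes ab: "a < b" and c: "0 < c"
    and u[measurable]: "u \<in> borel_measurable borel" and v[measurable]: "v \<in> borel_measurable borel"
    and ub: "\<And>r. r \<in> {a..b} \<Longrightarrow> c \<le> u r \<and> u r \<le> C" and vb: "\<And>r. r \<in> {a..b} \<Longrightarrow> c \<le> v r \<and> v r \<le> C"
    and mass: "prim a u b = prim a v b"
begin

lemma C: "0 \<le> C" using ub[of a] ab c by auto

lemma swap: "fibre a b c C v u"
  by unfold_locales (use ab c u v ub vb mass in auto)

lemma prim_mono_v: "a \<le> s \<Longrightarrow> s \<le> t \<Longrightarrow> t \<le> b \<Longrightarrow> c * (t - s) \<le> prim a v t - prim a v s"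
  by (rule prim_diff(2)[OF v vb])

lemma prim_le_v_iff: "s \<in> {a..b} \<Longrightarrow> t \<in> {a..b} \<Longrightarrow> prim a v s \<le> prim a v t \<longleftrightarrow> s \<le> t"
proof (cases "s \<le> t")
  case True
  assume "s \<in> {a..b}" "t \<in> {a..b}"
  with True have "c * (t - s) \<le> prim a v t - prim a v s" by (intro prim_mono_v) auto
  moreover have "0 \<le> c * (t - s)" using True c by simp
  ultimately show ?thesis using True by linarith
next
  case False
  assume "s \<in> {a..b}" "t \<in> {a..b}"
  with False have "c * (s - t) \<le> prim a v s - prim a v t" by (intro prim_mono_v) auto
  moreover have "0 < c * (s - t)" using False c by simp
  ultimately show ?thesis using False by linarith
qed

end

context fibre
begin

text \<open>The context was closed and reopened so that the facts proved for \<open>v\<close> can be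
  instantiated with the roles exchanged.\<close>

lemmas prim_le_u_iff = fibre.prim_le_v_iff[OF swap]

lemma inj_v: "inj_on (prim a v) {a..b}"
proof (rule inj_onI)
  fix x y assume "x \<in> {a..b}" "y \<in> {a..b}" "prim a v x = prim a v y"
  then show "x = y" using prim_le_v_iff[of x y] prim_le_v_iff[of y x] by simp
qed

text \<open>Intermediate value theorem: both primitives start at 0 and, by \<open>mass\<close>, end
  at the same value.\<close>

lemma prim_u_in_image: assumes "t \<in> {a..b}" shows "prim a u t \<in> prim a v ` {a..b}"
proof -
  have "continuous_on {a..b} (prim a v)"
    using vb c C by (intro prim_continuous[where C=C]) (auto intro: order_trans[of 0 c])
  moreover have "prim a v a \<le> prim a u t" "prim a u t \<le> prim a v b"
    using prim_le_u_iff[of a t] prim_le_u_iff[of t b] assms ab by (auto simp: mass)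
  ultimately obtain x where "x \<in> {a..b}" "prim a v x = prim a u t"
    using IVT'[of "prim a v" a "prim a u t" b] ab by auto
  then show ?thesis by (metis imageI)
qed

end

context fibre
begin

lemmas prim_v_in_image = fibre.prim_u_in_image[OF swap]

lemma rearr_in: "t \<in> {a..b} \<Longrightarrow> rearr a b u v t \<in> {a..b}"
  unfolding rearr_def by (rule the_inv_into_into[OF inj_v prim_u_in_image]) auto

lemma prim_rearr: "t \<in> {a..b} \<Longrightarrow> prim a v (rearr a b u v t) = prim a u t"
  unfolding rearr_def by (rule f_the_inv_into_f[OF inj_v prim_u_in_image])

text \<open>Eliminates the inverse function: sublevel sets of the rearrangement become comparisons
  of primitives, from which both its measurability and its pushforward are read off.\<close>

lemma rearr_le_iff: "t \<in> {a..b} \<Longrightarrow> y \<in> {a..b} \<Longrightarrow> rearr a b u v t \<le> y \<longleftrightarrow> prim a u t \<le> prim a v y"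
  using prim_le_v_iff[OF rearr_in, of t y] by (simp add: prim_rearr)

text \<open>Between \<open>t\<close> and its image the density \<open>v\<close> has mass
  \<open>\<bar>prim a u t - prim a v t\<bar>\<close>, and \<open>v\<close> is at least
  \<open>c\<close> there.\<close>

lemma rearr_dist:
  assumes "t \<in> {a..b}" and "\<bar>prim a u t - prim a v t\<bar> \<le> e"
  shows "\<bar>rearr a b u v t - t\<bar> \<le> e / c"
proof -
  let ?y = "rearr a b u v t"
  have "c * \<bar>?y - t\<bar> \<le> \<bar>prim a v ?y - prim a v t\<bar>"
    using prim_mono_v[of ?y t] prim_mono_v[of t ?y] rearr_in[OF assms(1)] assms(1)
    by (cases "?y \<le> t") auto
  then show ?thesis using assms c by (simp add: prim_rearr pos_le_divide_eq mult.commute)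
qed

text \<open>Finite measures on the line are determined by their values on rays, and the
  rearrangement pulls rays back to rays.\<close>

lemma rearr_push:
  assumes [measurable]: "\<psi> \<in> borel_measurable borel"
  shows "(\<integral>\<^sup>+r. ennreal (u r) * indicator {a..b} r * \<psi> (rearr a b u v r) \<partial>lborel) =
    (\<integral>\<^sup>+r. ennreal (v r) * indicator {a..b} r * \<psi> r \<partial>lborel)"
proof -
  \<comment> \<open>The identity outside the interval makes the rearrangement a total Borel map; no
    mass is located there.\<close>
  define \<tau> where "\<tau> t = (if t \<in> {a..b} then rearr a b u v t else t)" for t
  have em: "emeasure (dens (\<lambda>r. w r) {a..b}) {s<..}
      = ennreal (prim a w b - prim a w s)"
    if [measurable]: "w \<in> borel_measurable borel" and wb: "\<And>r. r \<in> {a..b} \<Longrightarrow> c \<le> w r \<and> w r \<le> C"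
      and s: "s \<in> {a..b}" for w :: "real \<Rightarrow> real" and s
  proof -
    have "emeasure (dens (\<lambda>r. w r) {a..b}) {s<..}
      = (\<integral>\<^sup>+r. ennreal (indicator {s<..b} r * w r) \<partial>lborel)"
      using s by (subst emeasure_density) (auto intro!: nn_integral_cong split: split_indicator)
    also have "\<dots> = ennreal (\<integral>r. indicator {s<..b} r * w r \<partial>lborel)"
    proof (rule nn_integral_eq_integral)
      have "set_integrable lborel {s<..b} w"
      proof (rule set_integrable_bounded[where a=a and b=b and C=C])
        fix r assume "r \<in> {a..b}" then show "\<bar>w r\<bar> \<le> C" using wb[of r] c by auto
      qed (use s in auto)
      then show "integrable lborel (\<lambda>r. indicator {s<..b} r * w r)"
        by (simp add: set_integrable_def)
      show "AE r in lborel. 0 \<le> indicator {s<..b} r * w r"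
      proof -
        have "0 \<le> w r" if "r \<in> {a..b}" for r using wb[OF that] c by auto
        then show ?thesis using s by (intro always_eventually) (auto split: split_indicator)
      qed
    qed
    also have "\<dots> = ennreal (prim a w b - prim a w s)"
      using s by (subst prim_diff(1)[OF that(1) wb, where b=b]) (auto simp: set_lebesgue_integral_def)
    finally show ?thesis .
  qed
  have "mono_on {a..b} (rearr a b u v)"
  proof (rule mono_onI)
    fix s t assume st: "s \<in> {a..b}" "t \<in> {a..b}" "s \<le> t"
    then have "prim a u s \<le> prim a v (rearr a b u v t)"
      by (simp add: prim_rearr prim_le_u_iff)
    then show "rearr a b u v s \<le> rearr a b u v t"
      using rearr_le_iff[OF st(1) rearr_in[OF st(2)]] by blast
  qed
  then have "rearr a b u v \<in> borel_measurable (restrict_space borel {a..b})"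
    by (rule borel_measurable_mono_on_fnc)
  then have tau[measurable]: "\<tau> \<in> borel_measurable borel"
  proof -
    have eq: "{t. a \<le> t \<and> t \<le> b} = {a..b}" by auto
    assume "rearr a b u v \<in> borel_measurable (restrict_space borel {a..b})"
    then show ?thesis
      unfolding \<tau>_def
      by (intro measurable_If_restrict_space_iff[THEN iffD2]) (auto simp: eq intro: measurable_restrict_space1)
  qed
  let ?U = "dens (\<lambda>r. u r) {a..b}"
  let ?V = "dens (\<lambda>r. v r) {a..b}"
  have top: "emeasure (dens (\<lambda>r. w r) {a..b}) {s<..} =
     emeasure (dens (\<lambda>r. w r) {a..b}) {a<..}"
    if [measurable]: "w \<in> borel_measurable borel" and "s < a" for w :: "real \<Rightarrow> real" and s
    using that AE_lborel_singleton[of a]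
    by (auto simp: emeasure_density intro!: nn_integral_cong_AE split: split_indicator elim!: eventually_mono)
  have bot: "emeasure (dens (\<lambda>r. w r) {a..b}) {s<..} = 0"
    if [measurable]: "w \<in> borel_measurable borel" and "b \<le> s" for w :: "real \<Rightarrow> real" and s
    using that by (auto simp: emeasure_density nn_integral_0_iff_AE split: split_indicator)
  have "distr ?U borel \<tau> = ?V"
  proof (rule measure_eqI_lessThan)
    have in_ab: "emeasure (distr ?U borel \<tau>) {s<..} = ennreal (prim a v b - prim a v s)"
      if s: "s \<in> {a..b}" for s
    proof -
      \<comment> \<open>The point \<open>s'\<close> has the same \<open>u\<close>-mass to its left
        as \<open>s\<close> has \<open>v\<close>-mass, so the preimage of the ray from
        \<open>s\<close> is the ray from \<open>s'\<close>.\<close>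
      obtain s' where "prim a v s = prim a u s'" "s' \<in> {a..b}"
        using prim_v_in_image[OF s] by (rule imageE)
      note s' = this(2) this(1)[symmetric]
      have iff: "s < rearr a b u v t \<longleftrightarrow> s' < t" if t: "t \<in> {a..b}" for t
        using rearr_le_iff[OF t s] prim_le_u_iff[OF t s'(1)] s'(2) by (simp add: not_le[symmetric])
      have "emeasure (distr ?U borel \<tau>) {s<..} = emeasure ?U (\<tau> -` {s<..})"
        by (subst emeasure_distr) auto
      also have "\<dots> = emeasure ?U {s'<..}"
        using iff measurable_sets[OF tau, of "{s<..}"]
        by (auto simp: emeasure_density \<tau>_def intro!: nn_integral_cong split: split_indicator)
      also have "\<dots> = ennreal (prim a v b - prim a v s)"
        using em[OF u ub s'(1)] by (simp add: s'(2) mass)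
      finally show ?thesis .
    qed
    have tail: "emeasure (distr ?U borel \<tau>) {s<..} = emeasure ?U {s<..}" if s: "s < a \<or> b \<le> s" for s
    proof -
      have iff: "s < rearr a b u v t \<longleftrightarrow> s < t" if t: "t \<in> {a..b}" for t
        using rearr_in[OF t] t s by auto
      have "emeasure (distr ?U borel \<tau>) {s<..} = emeasure ?U (\<tau> -` {s<..})"
        by (subst emeasure_distr) auto
      also have "\<dots> = emeasure ?U {s<..}"
        using iff measurable_sets[OF tau, of "{s<..}"]
        by (auto simp: emeasure_density \<tau>_def intro!: nn_integral_cong split: split_indicator)
      finally show ?thesis .
    qed
    show eq: "emeasure (distr ?U borel \<tau>) {s<..} = emeasure ?V {s<..}" for s
    proof -
      consider "s < a" | "b \<le> s" | "s \<in> {a..b}" by force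
      then show ?thesis
      proof cases
        case 1
        then show ?thesis using em[OF u ub, of a] em[OF v vb, of a] ab
          by (subst tail) (auto simp: top mass)
      next
        case 2
        then show ?thesis by (subst tail) (auto simp: bot)
      next
        case 3
        then show ?thesis using em[OF v vb 3] in_ab by simp
      qed
    qed
    show "emeasure (distr ?U borel \<tau>) {s<..} < \<infinity>" for s
    proof -
      consider "s < a" | "b \<le> s" | "s \<in> {a..b}" by force
      then show ?thesis
        using em[OF v vb, of a] em[OF v vb, of s] ab by cases (auto simp: eq top bot)
    qed
  qed auto
  then have "(\<integral>\<^sup>+r. \<psi> r \<partial>distr ?U borel \<tau>) = (\<integral>\<^sup>+r. \<psi> r \<partial>?V)" by simp
  then have "(\<integral>\<^sup>+r. ennreal (u r) * indicator {a..b} r * \<psi> (\<tau> r) \<partial>lborel) =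
      (\<integral>\<^sup>+r. ennreal (v r) * indicator {a..b} r * \<psi> r \<partial>lborel)"
    by (simp add: nn_integral_distr nn_integral_density)
  moreover have "(\<integral>\<^sup>+r. ennreal (u r) * indicator {a..b} r * \<psi> (\<tau> r) \<partial>lborel) =
     (\<integral>\<^sup>+r. ennreal (u r) * indicator {a..b} r * \<psi> (rearr a b u v r) \<partial>lborel)"
    by (intro nn_integral_cong) (auto simp: \<tau>_def split: split_indicator)
  ultimately show ?thesis by simp
qed

end

section \<open>Rearrangement of all parallel segments of a cube\<close>

definition ccube :: "real ^ 'd \<Rightarrow> real \<Rightarrow> (real ^ 'd) set"
  where "ccube A l = {x. \<forall>k. x $ k \<in> {A $ k..A $ k + l}}"

lemma ccube_measurable [measurable]: "ccube A l \<in> sets borel"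
proof -
  have "closed (ccube A l)"
    unfolding ccube_def atLeastAtMost_iff by (intro closed_Collect_all closed_Collect_conj closed_Collect_le continuous_intros)
  then show ?thesis by simp
qed

lemma upd_in_ccube: "x \<in> ccube A l \<Longrightarrow> r \<in> {A $ i..A $ i + l} \<Longrightarrow> upd x i r \<in> ccube A l"
  by (auto simp: ccube_def upd_nth)

lemma upd_in_ccube_iff: "x \<in> ccube A l \<Longrightarrow> upd x i r \<in> ccube A l \<longleftrightarrow> r \<in> {A $ i..A $ i + l}"
  by (auto simp: ccube_def upd_nth split: if_splits)

lemma borel_measurable_prim:
  fixes w :: "real ^ 'd \<Rightarrow> real"
  assumes [measurable]: "w \<in> borel_measurable borel" "f \<in> borel_measurable borel"
  shows "(\<lambda>x. prim a (\<lambda>r. w (upd x i r)) (f x)) \<in> borel_measurable borel"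
proof -
  have "(\<lambda>z. indicat_real {a..f (fst z)} (snd z) *\<^sub>R w (upd (fst z) i (snd z))) \<in> borel_measurable (borel \<Otimes>\<^sub>M lborel)"
    unfolding indicator_def atLeastAtMost_iff by measurable
  then show ?thesis
    unfolding set_lebesgue_integral_def by (intro lborel.borel_measurable_lebesgue_integral) (simp add: case_prod_beta')
qed

text \<open>Each segment in direction \<open>i\<close> is rearranged separately, which moves the
  single coordinate \<open>i\<close>. The pushforward is computed segment by segment through
  \<open>nn_integral_upd\<close>.\<close>

lemma fibre_transport:
  fixes u v :: "real ^ 'd \<Rightarrow> real"
  assumes l: "0 < l" and c: "0 < c"
    and [measurable]: "u \<in> borel_measurable borel" "v \<in> borel_measurable borel"
    and ub: "\<And>x. x \<in> ccube A l \<Longrightarrow> c \<le> u x \<and> u x \<le> C" and vb: "\<And>x. x \<in> ccube A l \<Longrightarrow> c \<le> v x \<and> v x \<le> C"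
    and mass: "\<And>x. x \<in> ccube A l \<Longrightarrow> prim (A $ i) (\<lambda>r. u (upd x i r)) (A $ i + l) = prim (A $ i) (\<lambda>r. v (upd x i r)) (A $ i + l)"
    and disp: "\<And>x. x \<in> ccube A l \<Longrightarrow>
      \<bar>prim (A $ i) (\<lambda>r. u (upd x i r)) (x $ i) - prim (A $ i) (\<lambda>r. v (upd x i r)) (x $ i)\<bar> \<le> e"
  obtains T where "T \<in> borel \<rightarrow>\<^sub>M borel"
    and "distr (dens (\<lambda>x. u x) (ccube A l)) borel T =
       dens (\<lambda>x. v x) (ccube A l)"
    and "\<And>x. x \<in> ccube A l \<Longrightarrow> T x \<in> ccube A l \<and> norm (T x - x) \<le> e / c"
proof -
  let ?Q = "ccube A l" and ?a = "A $ i" and ?b = "A $ i + l"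
  let ?u = "\<lambda>x r. u (upd x i r)" and ?v = "\<lambda>x r. v (upd x i r)"
  define \<tau> where "\<tau> x = (if x \<in> ?Q then rearr ?a ?b (?u x) (?v x) (x $ i) else x $ i)" for x
  define T where "T x = upd x i (\<tau> x)" for x
  have F: "fibre ?a ?b c C (?u x) (?v x)" if "x \<in> ?Q" for x
    using l c mass[OF that] ub[OF upd_in_ccube[OF that]] vb[OF upd_in_ccube[OF that]]
    by unfold_locales auto
  have xi: "x $ i \<in> {?a..?b}" if "x \<in> ?Q" for x
    using that unfolding ccube_def by blast
  have tin: "?a \<le> \<tau> x \<and> \<tau> x \<le> ?b" if "x \<in> ?Q" for x
    using fibre.rearr_in[OF F[OF that] xi[OF that]] that by (simp add: \<tau>_def)
  have tout: "\<tau> x = x $ i" if "x \<notin> ?Q" for x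
    using that by (simp add: \<tau>_def)
  \<comment> \<open>Joint measurability in all coordinates: a sublevel set of \<open>\<tau>\<close>
    inside the cube is described by two primitives that are measurable in the point, their upper
    limits included.\<close>
  have [measurable]: "\<tau> \<in> borel_measurable borel"
  proof (rule borel_measurable_iff_le[THEN iffD2], safe)
    fix y :: real
    note [measurable] = borel_measurable_prim
    consider "y < ?a" | "?b \<le> y" | "y \<in> {?a..?b}" by force
    then show "{x \<in> space borel. \<tau> x \<le> y} \<in> sets borel"
    proof cases
      case 1
      have "\<tau> x \<le> y \<longleftrightarrow> (x \<notin> ?Q \<and> x $ i \<le> y)" for x
        using 1 tin[of x] tout[of x] by (cases "x \<in> ?Q") auto
      then have "{x. \<tau> x \<le> y} = {x. x \<notin> ?Q \<and> x $ i \<le> y}" by simp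
      then show ?thesis by simp
    next
      case 2
      have "\<tau> x \<le> y \<longleftrightarrow> (x \<in> ?Q \<or> x $ i \<le> y)" for x
        using 2 tin[of x] tout[of x] by (cases "x \<in> ?Q") auto
      then have "{x. \<tau> x \<le> y} = {x. x \<in> ?Q \<or> x $ i \<le> y}" by simp
      then show ?thesis by simp
    next
      case 3
      have "{x. \<tau> x \<le> y} = {x. if x \<in> ?Q then prim ?a (?u x) (x $ i) \<le> prim ?a (?v x) y else x $ i \<le> y}"
        using fibre.rearr_le_iff[OF F xi 3] by (intro Collect_cong) (simp add: \<tau>_def)
      also have "\<dots> \<in> sets borel" by measurable
      finally show ?thesis by simp
    qed
  qed
  have [measurable]: "T \<in> borel \<rightarrow>\<^sub>M borel" unfolding T_def by measurable
  show thesis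
  proof
    show "T \<in> borel \<rightarrow>\<^sub>M borel" by fact
    fix x assume x: "x \<in> ?Q"
    have "\<bar>\<tau> x - x $ i\<bar> \<le> e / c"
      using fibre.rearr_dist[OF F[OF x] xi[OF x] disp[OF x]] x by (simp add: \<tau>_def)
    then have "norm (T x - x) \<le> e / c" by (simp add: T_def upd_def)
    moreover have "T x \<in> ?Q"
      using fibre.rearr_in[OF F[OF x] xi[OF x]] x unfolding T_def \<tau>_def by (simp add: upd_in_ccube)
    ultimately show "T x \<in> ?Q \<and> norm (T x - x) \<le> e / c" by simp
  next
    show "distr (dens (\<lambda>x. u x) ?Q) borel T = dens (\<lambda>x. v x) ?Q"
    proof (rule measure_eqI)
      fix S assume "S \<in> sets (distr (dens (\<lambda>x. u x) ?Q) borel T)"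
      then have [measurable]: "S \<in> sets borel" by simp
      have fib: "(\<integral>\<^sup>+r. ennreal (?u x r) * indicator ?Q (upd x i r) * indicator S (T (upd x i r)) \<partial>lborel)
        = (\<integral>\<^sup>+r. ennreal (?v x r) * indicator ?Q (upd x i r) * indicator S (upd x i r) \<partial>lborel)" for x
      proof (cases "upd x i ?a \<in> ?Q")
        case False
        then have "upd x i r \<notin> ?Q" for r
          using upd_in_ccube[of "upd x i r" A l ?a i] l by auto
        then show ?thesis by simp
      next
        case True
        \<comment> \<open>The point \<open>x\<close> may lie outside the cube although its line in
          direction \<open>i\<close> crosses it; \<open>y\<close> is the first point of that line in
          the cube.\<close>
        define y where "y = upd x i ?a"
        have y: "y \<in> ?Q" and yr: "upd x i r = upd y i r" for r using True by (auto simp: y_def)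
        have ind: "indicator ?Q (upd y i r) = (indicator {?a..?b} r :: ennreal)" for r
          using upd_in_ccube_iff[OF y, of i r] by (simp add: indicator_def)
        have "(\<integral>\<^sup>+r. ennreal (?u y r) * indicator ?Q (upd y i r) * indicator S (T (upd y i r)) \<partial>lborel)
          = (\<integral>\<^sup>+r. ennreal (?u y r) * indicator {?a..?b} r * indicator S (upd y i (rearr ?a ?b (?u y) (?v y) r)) \<partial>lborel)"
          unfolding ind
          by (intro nn_integral_cong) (auto simp: T_def \<tau>_def upd_in_ccube_iff[OF y] upd_nth split: split_indicator)
        also have "\<dots> = (\<integral>\<^sup>+r. ennreal (?v y r) * indicator {?a..?b} r * indicator S (upd y i r) \<partial>lborel)"
          by (rule fibre.rearr_push[OF F[OF y]]) measurable
        finally show ?thesis by (simp add: yr ind)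
      qed
      have "emeasure (distr (dens (\<lambda>x. u x) ?Q) borel T) S
         = (\<integral>\<^sup>+x. indicator S (T x) \<partial>dens (\<lambda>x. u x) ?Q)"
        by (subst nn_integral_indicator[symmetric], simp, subst nn_integral_distr) auto
      also have "\<dots> = (\<integral>\<^sup>+x. ennreal (u x) * indicator ?Q x * indicator S (T x) \<partial>lborel)"
        by (subst nn_integral_density) auto
      also have "\<dots> = (\<integral>\<^sup>+x. ennreal (v x) * indicator ?Q x * indicator S x \<partial>lborel)"
        by (subst (1 2) nn_integral_upd[where i=i]) (auto simp: fib)
      also have "\<dots> = emeasure (dens (\<lambda>x. v x) ?Q) S"
        by (subst emeasure_density) auto
      finally show "emeasure (distr (dens (\<lambda>x. u x) ?Q) borel T) S
         = emeasure (dens (\<lambda>x. v x) ?Q) S" .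
    qed simp
  qed
qed

text \<open>For the uniform distribution on the cube this is the conditional expectation of
  \<open>h\<close> given all coordinates except \<open>i\<close>. Hence \<open>h\<close> and its
  average have the same integral over every segment in direction \<open>i\<close>.\<close>

definition coord_avg :: "real ^ 'd \<Rightarrow> real \<Rightarrow> 'd \<Rightarrow> (real ^ 'd \<Rightarrow> real) \<Rightarrow> real ^ 'd \<Rightarrow> real"
  where "coord_avg A l i h x = prim (A $ i) (\<lambda>r. h (upd x i r)) (A $ i + l) / l"

lemma coord_avg_measurable [measurable]:
  "h \<in> borel_measurable borel \<Longrightarrow> coord_avg A l i h \<in> borel_measurable borel"
  unfolding coord_avg_def by (intro borel_measurable_divide borel_measurable_prim) auto

lemma coord_avg_upd_same [simp]: "coord_avg A l i h (upd x i r) = coord_avg A l i h x"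
  by (simp add: coord_avg_def)

text \<open>Averaging over one coordinate does not bring back the dependence on another that has
  been removed before; the induction over the coordinates relies on this.\<close>

lemma coord_avg_upd_other:
  assumes "i \<noteq> k" and x: "x \<in> ccube A l" and r: "r \<in> {A $ k..A $ k + l}"
    and h: "\<And>x r. x \<in> ccube A l \<Longrightarrow> r \<in> {A $ k..A $ k + l} \<Longrightarrow> h (upd x k r) = h x"
  shows "coord_avg A l i h (upd x k r) = coord_avg A l i h x"
  unfolding coord_avg_def set_lebesgue_integral_def
  using upd_in_ccube[OF x] h r \<open>i \<noteq> k\<close>
  by (intro arg_cong2[where f="(/)"] Bochner_Integration.integral_cong)
     (auto simp: upd_commute[of k i] split: split_indicator)

lemma prim_bound:
  fixes w :: "real \<Rightarrow> real"
  assumes "w \<in> borel_measurable borel" "\<And>r. r \<in> {a..b} \<Longrightarrow> \<bar>w r\<bar> \<le> H" "t \<in> {a..b}"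
  shows "\<bar>prim a w t\<bar> \<le> H * (t - a)"
proof -
  have wb: "- H \<le> w r \<and> w r \<le> H" if "r \<in> {a..b}" for r
    using assms(2)[OF that] by auto
  have "- H * (t - a) \<le> prim a w t - prim a w a" "prim a w t - prim a w a \<le> H * (t - a)"
    using assms(3) by (intro prim_diff(2,3)[OF assms(1) wb]; auto)+
  then show ?thesis by auto
qed

lemma coord_avg_bound:
  assumes "0 < l" "h \<in> borel_measurable borel" "\<And>x. x \<in> ccube A l \<Longrightarrow> \<bar>h x\<bar> \<le> H" "x \<in> ccube A l"
  shows "\<bar>coord_avg A l i h x\<bar> \<le> H"
proof -
  have "\<bar>prim (A $ i) (\<lambda>r. h (upd x i r)) (A $ i + l)\<bar> \<le> H * (A $ i + l - A $ i)"
    by (rule prim_bound[where b="A $ i + l"]) (use assms in \<open>auto intro!: assms(3) upd_in_ccube\<close>)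
  then show ?thesis using assms(1) by (simp add: coord_avg_def field_simps)
qed

lemma emeasure_ccube: "0 < l \<Longrightarrow> emeasure lborel (ccube A l :: (real ^ 'd) set) = ennreal (l ^ CARD('d))"
proof -
  assume l: "0 < l"
  have "ccube A l = cbox A (A + (\<chi> k. l))"
    by (auto simp: ccube_def mem_box_cart)
  moreover have "emeasure lborel (cbox A (A + (\<chi> k. l))) = ennreal (\<Prod>b\<in>Basis. (A + (\<chi> k. l) - A) \<bullet> b)"
    using l by (intro emeasure_lborel_cbox) (auto simp: Basis_vec_def inner_axis)
  moreover have "(\<Prod>b\<in>Basis. (A + (\<chi> k. l) - A) \<bullet> b) = (\<Prod>b\<in>(Basis :: (real ^ 'd) set). l)"
    by (intro prod.cong) (auto simp: Basis_vec_def inner_axis)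
  ultimately show ?thesis by simp
qed

text \<open>The difference \<open>h\<close> is the sum of functions whose integrals over all fibres in the direction of one coordinate
  vanish, namely \<open>h\<close> minus its average over the first coordinate, that average minus its average over the second
  one, and so on. Each of them is dealt with by monotone rearrangement of the fibres.\<close>

lemma flow_transport:
  fixes v h :: "real ^ 'd \<Rightarrow> real" and S :: "'d set"
  assumes l: "0 < l" and c: "0 < c" and [measurable]: "v \<in> borel_measurable borel"
    and vb: "\<And>x. x \<in> ccube A l \<Longrightarrow> c + H \<le> v x \<and> v x \<le> C"
    and "h \<in> borel_measurable borel" and "\<And>x. x \<in> ccube A l \<Longrightarrow> \<bar>h x\<bar> \<le> H"
    and "\<And>x i r. x \<in> ccube A l \<Longrightarrow> i \<notin> S \<Longrightarrow> r \<in> {A $ i..A $ i + l} \<Longrightarrow> h (upd x i r) = h x"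
    and "(\<integral>\<^sup>+x\<in>ccube A l. ennreal (v x - h x) \<partial>lborel) = (\<integral>\<^sup>+x\<in>ccube A l. ennreal (v x) \<partial>lborel)"
  shows "\<exists>T\<in>borel \<rightarrow>\<^sub>M borel.
    distr (dens (\<lambda>x. v x - h x) (ccube A l)) borel T =
       dens (\<lambda>x. v x) (ccube A l) \<and>
    (\<forall>x\<in>ccube A l. T x \<in> ccube A l \<and> norm (T x - x) \<le> card S * (2 * H * l / c))"
proof -
  have "finite S" by simp
  then show ?thesis
    using assms(5-)
  proof (induction S arbitrary: h)
    case empty
    note [measurable] = empty.prems(1)
    let ?Q = "ccube A l"
    have AQ: "A \<in> ?Q" using l by (simp add: ccube_def)
    \<comment> \<open>With no coordinate left to depend on, \<open>h\<close> is constant: the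
      coordinates of \<open>x\<close> are replaced by those of the corner one at a time.\<close>
    have hc: "h x = h A" if x: "x \<in> ?Q" for x
    proof -
      have "\<exists>y\<in>?Q. (\<forall>k\<in>K. y $ k = A $ k) \<and> h y = h x" if "finite K" for K :: "'d set"
        using that
      proof induction
        case empty
        then show ?case using x by auto
      next
        case (insert k K)
        then obtain y where y: "y \<in> ?Q" "\<forall>k\<in>K. y $ k = A $ k" "h y = h x" by auto
        then show ?case using empty.prems(3)[of y k "A $ k"] l
          by (intro bexI[of _ "upd y k (A $ k)"]) (auto simp: upd_nth upd_in_ccube)
      qed
      from this[of UNIV] show ?thesis by (auto simp: vec_eq_iff[symmetric])
    qed
    have ge: "0 \<le> v x" "0 \<le> v x - h A" if "x \<in> ?Q" for x
      using vb[OF that] empty.prems(2)[OF that] hc[OF that] c by auto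
    have fin: "(\<integral>\<^sup>+x\<in>?Q. ennreal (v x) \<partial>lborel) < \<infinity>"
    proof -
      have "(\<integral>\<^sup>+x\<in>?Q. ennreal (v x) \<partial>lborel) \<le> (\<integral>\<^sup>+x. ennreal C * indicator ?Q x \<partial>lborel)"
        using vb by (intro nn_integral_mono) (auto split: split_indicator intro: ennreal_leI)
      also have "\<dots> < \<infinity>"
        using l by (simp add: nn_integral_cmult_indicator emeasure_ccube ennreal_mult_less_top)
      finally show ?thesis .
    qed
    \<comment> \<open>A nonzero constant would change the mass by its modulus times the volume.
      Minimum and maximum treat both signs at once and keep all integrands nonnegative, and
      finiteness of the mass allows to cancel.\<close>
    have "h A = 0"
    proof (rule ccontr)
      assume "h A \<noteq> 0"
      have eq: "(\<integral>\<^sup>+x\<in>?Q. ennreal (v x - h A) \<partial>lborel) = (\<integral>\<^sup>+x\<in>?Q. ennreal (v x) \<partial>lborel)"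
        unfolding empty.prems(4)[symmetric] by (intro nn_integral_cong) (auto simp: hc split: split_indicator)
      let ?w = "\<lambda>x. min (v x) (v x - h A)"
      have sp: "(\<integral>\<^sup>+x\<in>?Q. ennreal (?w x) \<partial>lborel) + (\<integral>\<^sup>+x. ennreal \<bar>h A\<bar> * indicator ?Q x \<partial>lborel)
        = (\<integral>\<^sup>+x\<in>?Q. ennreal (max (v x) (v x - h A)) \<partial>lborel)"
        using ge by (subst nn_integral_add[symmetric])
          (auto intro!: nn_integral_cong split: split_indicator simp flip: ennreal_plus simp: min_def max_def)
      have "(\<integral>\<^sup>+x\<in>?Q. ennreal (?w x) \<partial>lborel) = (\<integral>\<^sup>+x\<in>?Q. ennreal (max (v x) (v x - h A)) \<partial>lborel)"
        using eq by (cases "h A > 0") (auto simp: min_def max_def)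
      moreover have "(\<integral>\<^sup>+x\<in>?Q. ennreal (?w x) \<partial>lborel) \<noteq> \<infinity>"
        using fin eq by (cases "h A > 0") (auto simp: min_def)
      moreover have "(\<integral>\<^sup>+x\<in>?Q. ennreal (?w x) \<partial>lborel) + (\<integral>\<^sup>+x. ennreal \<bar>h A\<bar> * indicator ?Q x \<partial>lborel)
          = (\<integral>\<^sup>+x\<in>?Q. ennreal (?w x) \<partial>lborel) + 0"
        using sp calculation(1) by simp
      ultimately have "(\<integral>\<^sup>+x. ennreal \<bar>h A\<bar> * indicator ?Q x \<partial>lborel) = 0"
        using ennreal_add_left_cancel by blast
      then show False
        using l \<open>h A \<noteq> 0\<close> by (simp add: nn_integral_cmult_indicator emeasure_ccube)
    qed
    then have e: "dens (\<lambda>x. v x - h x) ?Q = dens (\<lambda>x. v x) ?Q"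
      by (intro arg_cong[where f="density lborel"] ext) (auto simp: hc split: split_indicator)
    show ?case unfolding e
      by (rule bexI[of _ "\<lambda>x. x"]) (auto intro: distr_id2)
  next
    case (insert i S)
    note [measurable] = insert.prems(1)
    let ?Q = "ccube A l" and ?a = "A $ i" and ?b = "A $ i + l"
    \<comment> \<open>Replacing \<open>h\<close> by its average over coordinate \<open>i\<close> is
      one rearrangement; what is left depends on the coordinates in \<open>S\<close> alone.\<close>
    let ?g = "coord_avg A l i h"
    have gb: "\<bar>?g x\<bar> \<le> H" if "x \<in> ?Q" for x
      by (rule coord_avg_bound[OF l insert.prems(1,2) that])
    have ind: "?g (upd x k r) = ?g x" if "x \<in> ?Q" "k \<notin> S" "r \<in> {A $ k..A $ k + l}" for x k r
    proof (cases "k = i")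
      case False
      then show ?thesis using that insert.prems(3) by (intro coord_avg_upd_other) auto
    qed simp
    have pd: "prim ?a (\<lambda>r. v (upd x i r) - w (upd x i r)) t = prim ?a (\<lambda>r. v (upd x i r)) t - prim ?a (\<lambda>r. w (upd x i r)) t"
      if x: "x \<in> ?Q" and t: "t \<in> {?a..?b}" and [measurable]: "w \<in> borel_measurable borel"
        and wb: "\<And>x. x \<in> ?Q \<Longrightarrow> \<bar>w x\<bar> \<le> H" for x t w
    proof (rule set_integral_diff)
      show "set_integrable lborel {?a..t} (\<lambda>r. v (upd x i r))"
        by (rule set_integrable_bounded[where a="?a" and b="?b" and C="max \<bar>c + H\<bar> \<bar>C\<bar>"])
           (use t vb[OF upd_in_ccube[OF x]] in \<open>fastforce+\<close>)
      show "set_integrable lborel {?a..t} (\<lambda>r. w (upd x i r))"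
        by (rule set_integrable_bounded[where a="?a" and b="?b" and C=H])
           (use t wb[OF upd_in_ccube[OF x]] in auto)
    qed
    have pg: "prim ?a (\<lambda>r. ?g (upd x i r)) t = ?g x * (t - ?a)" if "t \<in> {?a..?b}" for x t
      using that by (simp add: set_lebesgue_integral_def)
    have ph: "prim ?a (\<lambda>r. h (upd x i r)) ?b = ?g x * l" for x
      using l by (simp add: coord_avg_def)
    have xi: "x $ i \<in> {?a..?b}" if "x \<in> ?Q" for x
      using that unfolding ccube_def by blast
    have bi: "?b \<in> {?a..?b}" using l by simp
    obtain T where T[measurable]: "T \<in> borel \<rightarrow>\<^sub>M borel"
      and dT: "distr (dens (\<lambda>x. v x - h x) ?Q) borel T =
       dens (\<lambda>x. v x - ?g x) ?Q"
      and nT: "\<And>x. x \<in> ?Q \<Longrightarrow> T x \<in> ?Q \<and> norm (T x - x) \<le> 2 * H * l / c"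
    proof (rule fibre_transport[of l c "\<lambda>x. v x - h x" "\<lambda>x. v x - ?g x" A "C + H" i "2 * H * l"])
      \<comment> \<open>The reserve \<open>H\<close> in the lower bound of \<open>v\<close> keeps
        every intermediate density above \<open>c\<close>, since averages of \<open>h\<close> stay
        within \<open>H\<close>.\<close>
      show "c \<le> v x - h x \<and> v x - h x \<le> C + H" if "x \<in> ?Q" for x
        using vb[OF that] insert.prems(2)[OF that] by auto
      show "c \<le> v x - ?g x \<and> v x - ?g x \<le> C + H" if "x \<in> ?Q" for x
        using vb[OF that] gb[OF that] by auto
      show "prim ?a (\<lambda>r. v (upd x i r) - h (upd x i r)) ?b = prim ?a (\<lambda>r. v (upd x i r) - ?g (upd x i r)) ?b"
        if "x \<in> ?Q" for x
        by (simp only: pd[OF that bi insert.prems(1,2)] pd[OF that bi coord_avg_measurable[OF insert.prems(1)] gb] pg[OF bi] ph)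
           simp
      \<comment> \<open>Origin of the factor 2: the partial integrals of \<open>h\<close> and of its
        average are each at most \<open>H * l\<close>.\<close>
      fix x assume x: "x \<in> ?Q"
      have "\<bar>prim ?a (\<lambda>r. h (upd x i r)) (x $ i)\<bar> \<le> H * (x $ i - ?a)"
        by (rule prim_bound[where b="?b"]) (use xi[OF x] insert.prems(2)[OF upd_in_ccube[OF x]] in auto)
      moreover have "\<bar>?g x * (x $ i - ?a)\<bar> \<le> H * (x $ i - ?a)"
        unfolding abs_mult using gb[OF x] xi[OF x] by (intro mult_mono) auto
      moreover have "H * (x $ i - ?a) \<le> H * l"
        using xi[OF x] gb[OF x] by (intro mult_left_mono) auto
      ultimately show "\<bar>prim ?a (\<lambda>r. v (upd x i r) - h (upd x i r)) (x $ i) - prim ?a (\<lambda>r. v (upd x i r) - ?g (upd x i r)) (x $ i)\<bar> \<le> 2 * H * l"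
        by (simp only: pd[OF x xi[OF x] insert.prems(1,2)] pd[OF x xi[OF x] coord_avg_measurable[OF insert.prems(1)] gb] pg[OF xi[OF x]])
    qed (use l c in auto)
    have mass: "(\<integral>\<^sup>+x\<in>?Q. ennreal (v x - ?g x) \<partial>lborel) = (\<integral>\<^sup>+x\<in>?Q. ennreal (v x) \<partial>lborel)"
    proof -
      have "emeasure (dens (\<lambda>x. v x - ?g x) ?Q) UNIV =
          emeasure (dens (\<lambda>x. v x - h x) ?Q) UNIV"
        unfolding dT[symmetric] by (subst emeasure_distr) auto
      then show ?thesis using insert.prems(4) by (simp add: emeasure_density)
    qed
    obtain T' where T'[measurable]: "T' \<in> borel \<rightarrow>\<^sub>M borel"
      and dT': "distr (dens (\<lambda>x. v x - ?g x) ?Q) borel T' =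
       dens (\<lambda>x. v x) ?Q"
      and nT': "\<And>x. x \<in> ?Q \<Longrightarrow> T' x \<in> ?Q \<and> norm (T' x - x) \<le> card S * (2 * H * l / c)"
      using insert.IH[OF coord_avg_measurable[OF insert.prems(1)] gb ind mass] by blast
    show ?case
    proof (intro bexI[of _ "T' \<circ> T"] conjI ballI)
      show "distr (dens (\<lambda>x. v x - h x) ?Q) borel (T' \<circ> T) =
       dens (\<lambda>x. v x) ?Q"
        unfolding dT'[symmetric] dT[symmetric] by (subst distr_distr) auto
      fix x assume x: "x \<in> ?Q"
      show "(T' \<circ> T) x \<in> ?Q" using nT'[of "T x"] nT[OF x] by simp
      have "norm (T' (T x) - x) \<le> norm (T' (T x) - T x) + norm (T x - x)"
        using norm_triangle_ineq[of "T' (T x) - T x" "T x - x"] by simp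
      also have "\<dots> \<le> card S * (2 * H * l / c) + 2 * H * l / c"
        using nT'[of "T x"] nT[OF x] by (intro add_mono) auto
      also have "\<dots> = card (insert i S) * (2 * H * l / c)"
        using insert.hyps by (simp add: algebra_simps add_divide_distrib)
      finally show "norm ((T' \<circ> T) x - x) \<le> card (insert i S) * (2 * H * l / c)" by simp
    qed measurable
  qed
qed

section \<open>Couplings of total variation type\<close>

text \<open>The common part of \<open>u\<close> and \<open>v\<close> stays in place. The excess of
  \<open>u\<close> is redistributed according to the normalised deficit, regardless of where it
  comes from, and travels at most the diameter of \<open>Q\<close>.\<close>

lemma transportable_tv:
  fixes u v :: "'a::euclidean_space \<Rightarrow> real"
  assumes [measurable]: "u \<in> borel_measurable borel" "v \<in> borel_measurable borel"
    and p: "0 < p" and u0: "\<And>x. 0 \<le> u x" and v0: "\<And>x. 0 \<le> v x"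
    and supp: "\<And>x. x \<notin> Q \<Longrightarrow> u x = 0 \<and> v x = 0"
    and diam: "\<And>x y. x \<in> Q \<Longrightarrow> y \<in> Q \<Longrightarrow> norm (x - y) \<le> r" 
    and mass: "(\<integral>\<^sup>+x. ennreal (u x) \<partial>lborel) = (\<integral>\<^sup>+x. ennreal (v x) \<partial>lborel)" "(\<integral>\<^sup>+x. ennreal (v x) \<partial>lborel) < \<infinity>"
  shows "transportable p (density lborel (\<lambda>x. ennreal (u x))) (density lborel (\<lambda>x. ennreal (v x)))
    (ennreal (r powr p) * (\<integral>\<^sup>+x. ennreal (v x - u x) \<partial>lborel))"
proof -
  define e where "e x = ennreal (v x - u x)" for x
  define e' where "e' x = ennreal (u x - v x)" for x
  define m where "m x = ennreal (min (u x) (v x))" for x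
  have [measurable]: "e \<in> borel_measurable borel" "e' \<in> borel_measurable borel" "m \<in> borel_measurable borel"
    unfolding e_def e'_def m_def by measurable
  define \<delta> where "\<delta> = (\<integral>\<^sup>+x. e x \<partial>lborel)"
  have me: "m x + e x = ennreal (v x)" "m x + e' x = ennreal (u x)" for x
    using u0[of x] v0[of x] unfolding m_def e_def e'_def
    by (auto simp: min_def ennreal_neg simp flip: ennreal_plus)
  have sum: "(\<integral>\<^sup>+x. m x \<partial>lborel) + \<delta> = (\<integral>\<^sup>+x. ennreal (v x) \<partial>lborel)"
    "(\<integral>\<^sup>+x. m x \<partial>lborel) + (\<integral>\<^sup>+x. e' x \<partial>lborel) = (\<integral>\<^sup>+x. ennreal (u x) \<partial>lborel)"
    unfolding \<delta>_def by (subst nn_integral_add[symmetric]; simp add: me)+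
  have fin: "(\<integral>\<^sup>+x. m x \<partial>lborel) \<noteq> \<infinity>" "\<delta> \<noteq> \<infinity>"
    using sum(1) mass(2) by auto
  have \<delta>': "(\<integral>\<^sup>+x. e' x \<partial>lborel) = \<delta>"
  proof -
    have "(\<integral>\<^sup>+x. m x \<partial>lborel) + (\<integral>\<^sup>+x. e' x \<partial>lborel) = (\<integral>\<^sup>+x. m x \<partial>lborel) + \<delta>"
      using sum mass(1) by simp
    then show ?thesis using fin(1) ennreal_add_left_cancel by blast
  qed
  show ?thesis
  proof (cases "\<delta> = 0")
    \<comment> \<open>A deficit of mass zero cannot be normalised, but then the two densities agree
      almost everywhere.\<close>
    case True
    have "AE x in lborel. e x = 0" "AE x in lborel. e' x = 0"
      using True \<delta>' nn_integral_0_iff_AE[of e lborel] nn_integral_0_iff_AE[of e' lborel]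
      by (simp_all add: \<delta>_def)
    then have "AE x in lborel. ennreal (u x) = ennreal (v x)"
      by eventually_elim (use me in metis)
    then have "density lborel (\<lambda>x. ennreal (u x)) = density lborel (\<lambda>x. ennreal (v x))"
      by (intro density_cong) auto
    then show ?thesis
      by (auto intro!: transportable_mono[OF transportable_refl])
  next
    case False
    have dd: "\<delta> / \<delta> = 1"
      using False fin(2) by (intro ennreal_divide_self) (auto simp: less_top)
    define \<nu> where "\<nu> = density lborel (\<lambda>x. e x / \<delta>)"
    \<comment> \<open>A uniform variable decides between staying and jumping, which presents the
      mixture as a composition of measurable kernels.\<close>
    define U where "U = uniform_measure lborel {0..1::real}"
    \<comment> \<open>The probability of staying at \<open>x\<close>. The value 1 where
      \<open>u\<close> vanishes merely keeps \<open>\<rho>\<close> in the unit interval, as no mass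
      starts there.\<close>
    define \<rho> where "\<rho> x = (if u x = 0 then 1 else min (u x) (v x) / u x)" for x
    have [measurable]: "\<rho> \<in> borel_measurable borel" unfolding \<rho>_def by measurable
    have \<rho>: "0 \<le> \<rho> x" "\<rho> x \<le> 1" for x
      using u0[of x] v0[of x] by (auto simp: \<rho>_def divide_le_eq_1)
    have u\<rho>: "ennreal (u x) * ennreal (\<rho> x) = m x" "ennreal (u x) * ennreal (1 - \<rho> x) = e' x" for x
    proof -
      have "u x * \<rho> x = min (u x) (v x)" using v0[of x] by (auto simp: \<rho>_def)
      moreover from this have "u x * (1 - \<rho> x) = max 0 (u x - v x)" by (auto simp: algebra_simps min_def max_def)
      ultimately show "ennreal (u x) * ennreal (\<rho> x) = m x" "ennreal (u x) * ennreal (1 - \<rho> x) = e' x"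
        using u0[of x] \<rho>[of x] by (auto simp: m_def e'_def max_def ennreal_neg simp flip: ennreal_mult')
    qed
    have nu[simp, measurable_cong]: "sets \<nu> = sets borel" by (simp add: \<nu>_def)
    interpret \<nu>: prob_space \<nu>
    proof
      have "emeasure \<nu> (space \<nu>) = \<delta> / \<delta>"
        by (simp add: \<nu>_def emeasure_density nn_integral_divide \<delta>_def)
      then show "emeasure \<nu> (space \<nu>) = 1" by (simp add: dd)
    qed
    have [simp, measurable_cong]: "sets U = sets borel" by (simp add: U_def)
    interpret U: prob_space U unfolding U_def by (rule prob_space_uniform_measure) auto
    define \<kappa> where "\<kappa> x = U \<bind> (\<lambda>t. if t \<le> \<rho> x then return borel x else \<nu>)" for x
    have [measurable]: "(\<lambda>x. \<nu>) \<in> M \<rightarrow>\<^sub>M prob_algebra borel" for M :: "('a \<times> real) measure"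
      by (intro measurable_const) (simp add: space_prob_algebra \<nu>.prob_space_axioms)
    have g: "(\<lambda>(x, t). if t \<le> \<rho> x then return borel x else \<nu>) \<in> borel \<Otimes>\<^sub>M borel \<rightarrow>\<^sub>M prob_algebra borel"
      unfolding case_prod_beta' by measurable
    have k: "\<kappa> \<in> borel \<rightarrow>\<^sub>M prob_algebra borel"
      unfolding \<kappa>_def
      by (rule measurable_bind_prob_space2[OF measurable_const g])
        (simp add: space_prob_algebra U.prob_space_axioms)
    note ks[measurable] = measurable_prob_algebraD[OF k]
    have int: "(\<integral>\<^sup>+y. \<phi> y \<partial>\<kappa> x) = ennreal (\<rho> x) * \<phi> x + ennreal (1 - \<rho> x) * (\<integral>\<^sup>+y. \<phi> y \<partial>\<nu>)"
      if [measurable]: "\<phi> \<in> borel_measurable borel" for \<phi> x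
    proof -
      have gm: "(\<lambda>t. if t \<le> \<rho> x then return borel x else \<nu>) \<in> U \<rightarrow>\<^sub>M subprob_algebra borel"
        using measurable_prob_algebraD[OF measurable_compose[OF _ g, of "\<lambda>t. (x, t)" borel]]
        by (simp add: measurable_cong_sets[of U borel])
      have sp: "{0..1} \<inter> {t. t \<le> \<rho> x} = {0..\<rho> x}" "{0..1} \<inter> {t. \<not> t \<le> \<rho> x} = {\<rho> x<..1}"
        using \<rho>[of x] by auto
      have "(\<integral>\<^sup>+y. \<phi> y \<partial>\<kappa> x) = (\<integral>\<^sup>+t. \<integral>\<^sup>+y. \<phi> y \<partial>(if t \<le> \<rho> x then return borel x else \<nu>) \<partial>U)"
        unfolding \<kappa>_def by (rule nn_integral_bind[OF _ gm]) simp
      also have "\<dots> = (\<integral>\<^sup>+t. \<phi> x * indicator {t. t \<le> \<rho> x} t + (\<integral>\<^sup>+y. \<phi> y \<partial>\<nu>) * indicator {t. \<not> t \<le> \<rho> x} t \<partial>U)"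
        by (intro nn_integral_cong) (auto simp: nn_integral_return)
      also have "\<dots> = \<phi> x * emeasure U {t. t \<le> \<rho> x} + (\<integral>\<^sup>+y. \<phi> y \<partial>\<nu>) * emeasure U {t. \<not> t \<le> \<rho> x}"
        by (subst nn_integral_add) (auto simp: nn_integral_cmult_indicator)
      also have "emeasure U {t. t \<le> \<rho> x} = ennreal (\<rho> x)"
        using \<rho>[of x] by (simp add: U_def sp divide_ennreal_def)
      also have "emeasure U {t. \<not> t \<le> \<rho> x} = ennreal (1 - \<rho> x)"
        using \<rho>[of x] by (simp add: U_def sp divide_ennreal_def)
      finally show ?thesis by (simp add: mult.commute)
    qed
    have nuint: "\<delta> * (\<integral>\<^sup>+y. \<phi> y \<partial>\<nu>) = (\<integral>\<^sup>+y. e y * \<phi> y \<partial>lborel)"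
      if [measurable]: "\<phi> \<in> borel_measurable borel" for \<phi>
    proof -
      have "\<delta> * (\<integral>\<^sup>+y. \<phi> y \<partial>\<nu>) = (\<integral>\<^sup>+y. \<delta> * (e y / \<delta> * \<phi> y) \<partial>lborel)"
        unfolding \<nu>_def by (simp add: nn_integral_density nn_integral_cmult)
      also have "\<dots> = (\<integral>\<^sup>+y. e y * \<phi> y \<partial>lborel)"
      proof (rule nn_integral_cong)
        fix y
        have "\<delta> * (e y / \<delta> * \<phi> y) = (\<delta> / \<delta>) * e y * \<phi> y"
          by (simp add: divide_ennreal_def ac_simps)
        then show "\<delta> * (e y / \<delta> * \<phi> y) = e y * \<phi> y" by (simp add: dd)
      qed
      finally show ?thesis .
    qed
    let ?M = "density lborel (\<lambda>x. ennreal (u x))"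
    have avg: "(\<integral>\<^sup>+x. \<integral>\<^sup>+y. \<phi> x y \<partial>\<kappa> x \<partial>?M) = (\<integral>\<^sup>+x. m x * \<phi> x x \<partial>lborel) + (\<integral>\<^sup>+x. e' x * (\<integral>\<^sup>+y. \<phi> x y \<partial>\<nu>) \<partial>lborel)"
      if [measurable]: "case_prod \<phi> \<in> borel_measurable (borel \<Otimes>\<^sub>M borel)" for \<phi>
    proof -
      have [measurable]: "(\<lambda>x. \<integral>\<^sup>+y. \<phi> x y \<partial>\<kappa> x) \<in> borel_measurable borel"
        by (rule nn_integral_measurable_subprob_algebra2[OF _ ks]) simp
      have [measurable]: "(\<lambda>x. \<integral>\<^sup>+y. \<phi> x y \<partial>\<nu>) \<in> borel_measurable borel"
        by (rule \<nu>.borel_measurable_nn_integral) measurable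
      have [measurable]: "(\<lambda>x. \<phi> x x) \<in> borel_measurable borel"
        using measurable_compose[OF _ that, of "\<lambda>x. (x, x)" borel] by simp
      have "(\<integral>\<^sup>+x. \<integral>\<^sup>+y. \<phi> x y \<partial>\<kappa> x \<partial>?M) = (\<integral>\<^sup>+x. ennreal (u x) * (\<integral>\<^sup>+y. \<phi> x y \<partial>\<kappa> x) \<partial>lborel)"
        by (subst nn_integral_density) auto
      also have "\<dots> = (\<integral>\<^sup>+x. m x * \<phi> x x + e' x * (\<integral>\<^sup>+y. \<phi> x y \<partial>\<nu>) \<partial>lborel)"
        by (intro nn_integral_cong) (subst int, measurable, simp add: distrib_left u\<rho> flip: mult.assoc)
      finally show ?thesis by (simp add: nn_integral_add)
    qed
    show ?thesis
      unfolding transportable_def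
    proof (intro bexI[OF _ k] conjI measure_eqI)
      have sets: "sets (?M \<bind> \<kappa>) = sets borel"
        by (subst sets_bind[where N=borel]) (auto simp: sets_kernel[OF ks])
      then show "sets (?M \<bind> \<kappa>) = sets (density lborel (\<lambda>x. ennreal (v x)))" by simp
      fix S assume "S \<in> sets (?M \<bind> \<kappa>)"
      then have S[measurable]: "S \<in> sets borel" using sets by simp
      have "emeasure (?M \<bind> \<kappa>) S = (\<integral>\<^sup>+x. emeasure (\<kappa> x) S \<partial>?M)"
        by (subst emeasure_bind[where N=borel]) (auto simp: measurable_density_eq1 ks)
      also have "\<dots> = (\<integral>\<^sup>+x. \<integral>\<^sup>+y. indicator S y \<partial>\<kappa> x \<partial>?M)"
        by (intro nn_integral_cong) (simp add: sets_kernel[OF ks])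
      also have "\<dots> = (\<integral>\<^sup>+x. m x * indicator S x \<partial>lborel) + (\<integral>\<^sup>+x. e' x * (\<integral>\<^sup>+y. indicator S y \<partial>\<nu>) \<partial>lborel)"
        by (subst avg) auto
      also have "(\<integral>\<^sup>+x. e' x * (\<integral>\<^sup>+y. indicator S y \<partial>\<nu>) \<partial>lborel) = \<delta> * (\<integral>\<^sup>+y. indicator S y \<partial>\<nu>)"
        by (subst nn_integral_multc) (auto simp: \<delta>')
      also have "\<dots> = (\<integral>\<^sup>+x. e x * indicator S x \<partial>lborel)"
        by (rule nuint) simp
      also have "(\<integral>\<^sup>+x. m x * indicator S x \<partial>lborel) + \<dots> = (\<integral>\<^sup>+x\<in>S. ennreal (v x) \<partial>lborel)"
        by (subst nn_integral_add[symmetric]) (auto simp: me simp flip: distrib_right)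
      also have "\<dots> = emeasure (density lborel (\<lambda>x. ennreal (v x))) S"
        by (simp add: emeasure_density)
      finally show "emeasure (?M \<bind> \<kappa>) S = emeasure (density lborel (\<lambda>x. ennreal (v x))) S" .
    next
      \<comment> \<open>Jumps end in \<open>Q\<close>: the deficit vanishes wherever
        \<open>u\<close> and \<open>v\<close> both do.\<close>
      have nuQ: "AE y in \<nu>. y \<in> Q"
      proof -
        have "x \<in> Q" if "0 < e x / \<delta>" for x
          using that supp[of x] by (cases "x \<in> Q") (auto simp: e_def)
        then show ?thesis unfolding \<nu>_def by (subst AE_density) auto
      qed
      have in_le: "e' x * (\<integral>\<^sup>+y. pcost p x y \<partial>\<nu>) \<le> e' x * ennreal (r powr p)" for x
      proof (cases "x \<in> Q")
        case True
        have "(\<integral>\<^sup>+y. pcost p x y \<partial>\<nu>) \<le> (\<integral>\<^sup>+y. ennreal (r powr p) \<partial>\<nu>)"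
          using nuQ diam[OF True] p
          by (intro nn_integral_mono_AE) (auto intro!: ennreal_leI powr_mono2 elim!: eventually_mono)
        then show ?thesis by (intro mult_left_mono) (auto simp: \<nu>.emeasure_space_1)
      next
        case False
        then show ?thesis using supp[of x] by (simp add: e'_def)
      qed
      have "(\<integral>\<^sup>+x. \<integral>\<^sup>+y. pcost p x y \<partial>\<kappa> x \<partial>?M) =
        (\<integral>\<^sup>+x. e' x * (\<integral>\<^sup>+y. pcost p x y \<partial>\<nu>) \<partial>lborel)"
        by (subst avg) auto
      also have "\<dots> \<le> (\<integral>\<^sup>+x. e' x * ennreal (r powr p) \<partial>lborel)"
        by (intro nn_integral_mono in_le)
      also have "\<dots> = ennreal (r powr p) * (\<integral>\<^sup>+x. ennreal (v x - u x) \<partial>lborel)"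
        by (simp add: nn_integral_multc \<delta>' \<delta>_def e_def mult.commute)
      finally show "(\<integral>\<^sup>+x. \<integral>\<^sup>+y. pcost p x y \<partial>\<kappa> x \<partial>?M) \<le>
        ennreal (r powr p) * (\<integral>\<^sup>+x. ennreal (v x - u x) \<partial>lborel)" .
    qed
  qed
qed

lemma transportable_bounded_map:
  fixes u :: "'a::euclidean_space \<Rightarrow> ennreal"
  assumes "0 \<le> p" and [measurable]: "u \<in> borel_measurable borel" "T \<in> borel \<rightarrow>\<^sub>M borel"
    and K: "\<And>x. u x \<noteq> 0 \<Longrightarrow> norm (T x - x) \<le> K"
    and N: "distr (density lborel u) borel T = N"
  shows "transportable p (density lborel u) N (ennreal (K powr p) * (\<integral>\<^sup>+x. u x \<partial>lborel))"
proof (rule transportable_map[OF _ _ N])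
  have "(\<integral>\<^sup>+x. ennreal (norm (x - T x) powr p) \<partial>density lborel u) = (\<integral>\<^sup>+x. u x * ennreal (norm (T x - x) powr p) \<partial>lborel)"
    by (subst nn_integral_density) (auto simp: norm_minus_commute)
  also have "\<dots> \<le> (\<integral>\<^sup>+x. u x * ennreal (K powr p) \<partial>lborel)"
  proof (intro nn_integral_mono)
    show "u x * ennreal (norm (T x - x) powr p) \<le> u x * ennreal (K powr p)" for x
      using K[of x] assms(1) by (cases "u x = 0") (auto intro!: mult_left_mono ennreal_leI powr_mono2)
  qed
  also have "\<dots> = ennreal (K powr p) * (\<integral>\<^sup>+x. u x \<partial>lborel)"
    by (simp add: nn_integral_multc mult.commute)
  finally show "(\<integral>\<^sup>+x. ennreal (norm (x - T x) powr p) \<partial>density lborel u) \<le> ennreal (K powr p) * (\<integral>\<^sup>+x. u x \<partial>lborel)" .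
qed auto

section \<open>From kernels to Wasserstein distances\<close>

lemma transport_cost_le:
  fixes M N :: "'a::euclidean_space measure" and R :: "'a measure"
  assumes tr: "transportable p M N c" and sM[measurable_cong]: "sets M = sets borel"
    and q[measurable]: "q \<in> borel \<rightarrow>\<^sub>M R" and i[measurable]: "(\<lambda>x. x) \<in> R \<rightarrow>\<^sub>M borel"
    and M': "distr M R q = M'" and N': "distr N R q = N'"
    and qM: "AE x in M. q x = x" and qN: "AE x in N. q x = x"
  shows "transport_cost p M' N' \<le> c"
proof -
  obtain \<kappa> where k: "\<kappa> \<in> borel \<rightarrow>\<^sub>M prob_algebra borel" and N: "M \<bind> \<kappa> = N"
    and c: "(\<integral>\<^sup>+x. \<integral>\<^sup>+y. pcost p x y \<partial>\<kappa> x \<partial>M) \<le> c"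
    using tr unfolding transportable_def by blast
  have spM: "space M = UNIV" using sets_eq_imp_space_eq[OF sM] by simp
  note ks[measurable] = measurable_prob_algebraD[OF k]
  \<comment> \<open>Carrying the starting point along turns the kernel into a joint law, whose
    marginals are \<open>M\<close> and \<open>N\<close>.\<close>
  define K where "K x = distr (\<kappa> x) (borel \<Otimes>\<^sub>M borel) (\<lambda>y. (x, y))" for x
  have Kp: "K \<in> borel \<rightarrow>\<^sub>M prob_algebra (borel \<Otimes>\<^sub>M borel)"
    unfolding K_def by (rule measurable_distr_prob_space2[OF k]) simp
  note Ks[measurable] = measurable_prob_algebraD[OF Kp]
  have KM[measurable]: "K \<in> M \<rightarrow>\<^sub>M subprob_algebra (borel \<Otimes>\<^sub>M borel)"
    using Ks by (simp add: measurable_cong_sets[OF sM refl])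
  have kM[measurable]: "\<kappa> \<in> M \<rightarrow>\<^sub>M subprob_algebra borel"
    using ks by (simp add: measurable_cong_sets[OF sM refl])
  have sk: "sets (\<kappa> x) = sets borel" for x using sets_kernel[OF ks, of x] by simp
  have pk: "prob_space (\<kappa> x)" for x using measurable_space[OF k, of x] by (simp add: space_prob_algebra)
  define \<pi> where "\<pi> = M \<bind> K"
  have s\<pi>[measurable_cong]: "sets \<pi> = sets (borel \<Otimes>\<^sub>M borel)"
    unfolding \<pi>_def by (subst sets_bind[where N="borel \<Otimes>\<^sub>M borel"]) (auto simp: sets_kernel[OF Ks] spM)
  have int: "(\<integral>\<^sup>+z. \<phi> z \<partial>\<pi>) = (\<integral>\<^sup>+x. \<integral>\<^sup>+y. \<phi> (x, y) \<partial>\<kappa> x \<partial>M)"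
    if [measurable]: "\<phi> \<in> borel_measurable (borel \<Otimes>\<^sub>M borel)" for \<phi>
  proof -
    have "(\<integral>\<^sup>+z. \<phi> z \<partial>\<pi>) = (\<integral>\<^sup>+x. \<integral>\<^sup>+z. \<phi> z \<partial>K x \<partial>M)"
      unfolding \<pi>_def by (rule nn_integral_bind[OF _ KM]) simp
    also have "\<dots> = (\<integral>\<^sup>+x. \<integral>\<^sup>+y. \<phi> (x, y) \<partial>\<kappa> x \<partial>M)"
      unfolding K_def
      by (intro nn_integral_cong, subst nn_integral_distr) (auto simp: measurable_cong_sets[OF sk refl])
    finally show ?thesis .
  qed
  have fst: "distr \<pi> borel fst = M"
  proof (rule measure_eqI)
    fix A assume "A \<in> sets (distr \<pi> borel fst)"
    then have [measurable]: "A \<in> sets borel" by simp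
    have "emeasure (distr \<pi> borel fst) A = (\<integral>\<^sup>+z. indicator A (fst z) \<partial>\<pi>)"
      by (subst nn_integral_indicator[symmetric], simp, subst nn_integral_distr) auto
    also have "\<dots> = (\<integral>\<^sup>+x. indicator A x \<partial>M)"
      by (subst int) (auto simp: prob_space.emeasure_space_1[OF pk])
    finally show "emeasure (distr \<pi> borel fst) A = emeasure M A" by simp
  qed (simp add: sM)
  have sN: "sets N = sets borel"
    unfolding N[symmetric] by (subst sets_bind[where N="borel"]) (auto simp: sk spM)
  have snd: "distr \<pi> borel snd = N"
  proof (rule measure_eqI)
    fix A assume "A \<in> sets (distr \<pi> borel snd)"
    then have [measurable]: "A \<in> sets borel" by simp
    have "emeasure (distr \<pi> borel snd) A = (\<integral>\<^sup>+z. indicator A (snd z) \<partial>\<pi>)"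
      by (subst nn_integral_indicator[symmetric], simp, subst nn_integral_distr) auto
    also have "\<dots> = (\<integral>\<^sup>+x. \<integral>\<^sup>+y. indicator A y \<partial>\<kappa> x \<partial>M)"
      by (subst int) auto
    also have "\<dots> = (\<integral>\<^sup>+y. indicator A y \<partial>N)"
      unfolding N[symmetric] by (rule nn_integral_bind[OF _ kM, symmetric]) simp
    finally show "emeasure (distr \<pi> borel snd) A = emeasure N A" by (simp add: sN)
  qed (simp add: sN)
  \<comment> \<open>The map \<open>q\<close> transfers the coupling to the smaller space
    \<open>R\<close>. It fixes almost every point, so the cost does not change.\<close>
  define \<pi>' where "\<pi>' = distr \<pi> (R \<Otimes>\<^sub>M R) (\<lambda>z. (q (fst z), q (snd z)))"
  have sM': "sets M' = sets R" and sN': "sets N' = sets R" using M' N' by auto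
  have "\<pi>' \<in> couplings M' N'"
    unfolding couplings_def
  proof (rule CollectI, intro conjI)
    show "sets \<pi>' = sets (M' \<Otimes>\<^sub>M N')"
      unfolding \<pi>'_def using sM' sN' by (simp cong: sets_pair_measure_cong)
    have "distr \<pi>' M' fst = distr \<pi>' R fst" by (rule distr_cong) (auto simp: sM')
    also have "\<dots> = distr \<pi> R (\<lambda>z. q (fst z))"
      unfolding \<pi>'_def by (subst distr_distr) (auto simp: comp_def)
    also have "\<dots> = distr (distr \<pi> borel fst) R q"
      by (subst distr_distr) (auto simp: comp_def)
    finally show "distr \<pi>' M' fst = M'" using M' fst by simp
    have "distr \<pi>' N' snd = distr \<pi>' R snd" by (rule distr_cong) (auto simp: sN')
    also have "\<dots> = distr \<pi> R (\<lambda>z. q (snd z))"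
      unfolding \<pi>'_def by (subst distr_distr) (auto simp: comp_def)
    also have "\<dots> = distr (distr \<pi> borel snd) R q"
      by (subst distr_distr) (auto simp: comp_def)
    finally show "distr \<pi>' N' snd = N'" using N' snd by simp
  qed
  then have "transport_cost p M' N' \<le> (\<integral>\<^sup>+z. ennreal (norm (fst z - snd z) powr p) \<partial>\<pi>')"
    unfolding transport_cost_def by (rule INF_lower)
  also have "\<dots> = (\<integral>\<^sup>+z. ennreal (norm (q (fst z) - q (snd z)) powr p) \<partial>\<pi>)"
  proof -
    have [measurable]: "(\<lambda>x. fst x) \<in> R \<Otimes>\<^sub>M R \<rightarrow>\<^sub>M borel" "(\<lambda>x. snd x) \<in> R \<Otimes>\<^sub>M R \<rightarrow>\<^sub>M borel"
      by (rule measurable_compose[OF _ i], simp)+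
    show ?thesis unfolding \<pi>'_def by (subst nn_integral_distr) auto
  qed
  also have "\<dots> = (\<integral>\<^sup>+z. ennreal (norm (fst z - snd z) powr p) \<partial>\<pi>)"
  proof (rule nn_integral_cong_AE)
    have "AE z in \<pi>. q (fst z) = fst z" using qM unfolding fst[symmetric] by (rule AE_distrD[rotated]) simp
    moreover have "AE z in \<pi>. q (snd z) = snd z" using qN unfolding snd[symmetric] by (rule AE_distrD[rotated]) simp
    ultimately show "AE z in \<pi>. ennreal (norm (q (fst z) - q (snd z)) powr p) = ennreal (norm (fst z - snd z) powr p)"
      by eventually_elim simp
  qed
  also have "\<dots> \<le> c" using c by (subst int) auto
  finally show ?thesis .
qed

abbreviation cube_density :: "(real ^ 'd \<Rightarrow> real) \<Rightarrow> (real ^ 'd) measure"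
  where "cube_density f \<equiv> dens (\<lambda>x. f x) unit_cube"

text \<open>Connects the restricted space of the definitions with the whole space of the kernels.
  The point 0, to which everything outside is sent, is an arbitrary point of the cube;
  \<open>cube_density f\<close> has no mass outside.\<close>

lemma density_measure_eq_distr:
  assumes "prob_density_on_cube f"
  shows "distr (cube_density f) cube_measure (\<lambda>x. if x \<in> unit_cube then x else 0) = density_measure f"
    and "(\<lambda>x. ennreal (f x) * indicator unit_cube x) \<in> borel_measurable borel"
proof -
  have f: "f \<in> borel_measurable cube_measure" using assms by (simp add: prob_density_on_cube_def)
  then have "(\<lambda>x. ennreal (f x)) \<in> borel_measurable cube_measure" by measurable
  then have m: "(\<lambda>x. ennreal (f x) * indicator unit_cube x) \<in> borel_measurable lborel"
    by (simp add: borel_measurable_restrict_space_iff_ennreal)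
  then show "(\<lambda>x. ennreal (f x) * indicator unit_cube x) \<in> borel_measurable borel" by simp
  have q[measurable]: "(\<lambda>x. if x \<in> unit_cube then x else 0) \<in> borel \<rightarrow>\<^sub>M cube_measure"
    by (rule measurable_restrict_space2) (auto simp: mem_box_cart)
  show "distr (cube_density f) cube_measure (\<lambda>x. if x \<in> unit_cube then x else 0) = density_measure f"
  proof (rule measure_eqI)
    show "sets (distr (cube_density f) cube_measure (\<lambda>x. if x \<in> unit_cube then x else 0)) = sets (density_measure f)"
      by (simp add: density_measure_def)
    fix A assume "A \<in> sets (distr (cube_density f) cube_measure (\<lambda>x. if x \<in> unit_cube then x else 0))"
    then have A: "A \<in> sets cube_measure" by simp
    then have Ab[measurable]: "A \<in> sets borel" and sub: "A \<subseteq> unit_cube"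
      by (auto simp: sets_restrict_space_iff)
    have vim: "(\<lambda>x. if x \<in> unit_cube then x else 0) -` A \<in> sets borel"
      using measurable_sets[OF q A] by simp
    have "emeasure (distr (cube_density f) cube_measure (\<lambda>x. if x \<in> unit_cube then x else 0)) A
      = emeasure (cube_density f) ((\<lambda>x. if x \<in> unit_cube then x else 0) -` A)"
      using A by (subst emeasure_distr) auto
    also have "\<dots> = (\<integral>\<^sup>+x. ennreal (f x) * indicator unit_cube x * indicator ((\<lambda>x. if x \<in> unit_cube then x else 0) -` A) x \<partial>lborel)"
      using m vim by (subst emeasure_density) auto
    also have "\<dots> = (\<integral>\<^sup>+x. ennreal (f x) * indicator A x * indicator unit_cube x \<partial>lborel)"
      using sub by (intro nn_integral_cong) (auto split: split_indicator)
    also have "\<dots> = (\<integral>\<^sup>+x. ennreal (f x) * indicator A x \<partial>cube_measure)"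
      by (simp add: nn_integral_restrict_space)
    also have "\<dots> = emeasure (density_measure f) A"
      unfolding density_measure_def using A f by (subst emeasure_density) auto
    finally show "emeasure (distr (cube_density f) cube_measure (\<lambda>x. if x \<in> unit_cube then x else 0)) A = emeasure (density_measure f) A" .
  qed
qed

lemma wasserstein_le:
  assumes f: "prob_density_on_cube f" and g: "prob_density_on_cube g"
    and tr: "transportable p (cube_density f) (cube_density g) (ennreal c)" and "0 \<le> c" "0 < p"
  shows "wasserstein p (density_measure f) (density_measure g) \<le> ennreal (c powr (1 / p))"
proof -
  let ?q = "\<lambda>x. if x \<in> unit_cube then x else 0"
  have i: "(\<lambda>x. x) \<in> cube_measure \<rightarrow>\<^sub>M borel" by (rule measurable_restrict_space1) simp
  have AE: "AE x in cube_density f. ?q x = x" if "prob_density_on_cube f" for f :: "real ^ 'b \<Rightarrow> real"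
    using density_measure_eq_distr(2)[OF that] by (subst AE_density) (auto intro!: always_eventually split: split_indicator_asm)
  have "transport_cost p (density_measure f) (density_measure g) \<le> ennreal c"
    by (rule transport_cost_le[OF tr _ _ i density_measure_eq_distr(1)[OF f] density_measure_eq_distr(1)[OF g] AE[OF f] AE[OF g]])
       (auto intro!: measurable_restrict_space2 simp: mem_box_cart)
  moreover from this have "transport_cost p (density_measure f) (density_measure g) \<noteq> \<top>"
    by (auto simp: top_unique)
  ultimately show ?thesis
    unfolding wasserstein_def using assms
    by (auto intro!: ennreal_leI powr_mono2 enn2real_leI)
qed

section \<open>One refinement step inside one cell\<close>

lemma ccube_diam:
  fixes x y :: "real ^ 'd"
  assumes "x \<in> ccube A l" "y \<in> ccube A l"
  shows "norm (x - y) \<le> real CARD('d) * l"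
proof -
  have "norm (x - y) \<le> (\<Sum>i\<in>UNIV. \<bar>(x - y) $ i\<bar>)" by (rule norm_le_l1_cart)
  also have "\<dots> \<le> (\<Sum>i\<in>(UNIV :: 'd set). l)"
  proof (rule sum_mono)
    fix i
    have "x $ i \<in> {A $ i..A $ i + l}" "y $ i \<in> {A $ i..A $ i + l}"
      using assms unfolding ccube_def by blast+
    then show "\<bar>(x - y) $ i\<bar> \<le> l" by auto
  qed
  finally show ?thesis by simp
qed

text \<open>A cell \<open>Q\<close> with subcells \<open>P k\<close>; \<open>\<alpha>\<close> and
  \<open>b k\<close> are the factors of \<open>f\<close> before and after the step. Dyadic cells
  miss some of their faces whereas rearrangement needs complete segments, so \<open>Q\<close> is
  tied to a closed cube up to a null set.\<close>

locale cell_split =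
  fixes A :: "real ^ 'd" and l :: real and Q :: "(real ^ 'd) set" and K :: "'k set" and P :: "'k \<Rightarrow> (real ^ 'd) set"
    and f \<beta> :: "real ^ 'd \<Rightarrow> real" and F b :: "'k \<Rightarrow> real" and \<alpha> :: real
  assumes l: "0 < l" and Q_sub: "Q \<subseteq> ccube A l" and Q_ae: "AE x in lborel. x \<in> ccube A l \<longrightarrow> x \<in> Q"
    and K: "finite K" and Q_eq: "Q = (\<Union>k\<in>K. P k)" and disj: "disjoint_family_on P K"
    and P[measurable]: "\<And>k. k \<in> K \<Longrightarrow> P k \<in> sets borel"
    and f[measurable]: "f \<in> borel_measurable borel" and f0: "\<And>x. 0 \<le> f x"
    and \<beta>[measurable]: "\<beta> \<in> borel_measurable borel" and \<beta>b: "\<And>k x. k \<in> K \<Longrightarrow> x \<in> P k \<Longrightarrow> \<beta> x = b k"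
    and F: "\<And>k. k \<in> K \<Longrightarrow> (\<integral>\<^sup>+x\<in>P k. ennreal (f x) \<partial>lborel) = ennreal (F k)"
    and F0: "\<And>k. k \<in> K \<Longrightarrow> 0 \<le> F k" and b0: "\<And>k. k \<in> K \<Longrightarrow> 0 \<le> b k" and \<alpha>0: "0 \<le> \<alpha>"
    and mass: "\<alpha> * (\<Sum>k\<in>K. F k) = (\<Sum>k\<in>K. b k * F k)"
begin

text \<open>The L1 distance of the two densities on the cell.\<close>

abbreviation D where "D \<equiv> \<Sum>k\<in>K. \<bar>b k - \<alpha>\<bar> * F k"
abbreviation src where "src \<equiv> dens (\<lambda>x. \<alpha> * f x) Q"
abbreviation tgt where "tgt \<equiv> dens (\<lambda>x. \<beta> x * f x) Q"

lemma Q_meas [measurable]: "Q \<in> sets borel"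
  unfolding Q_eq using K P by (intro sets.finite_UN) auto

lemma beta_nonneg: "x \<in> Q \<Longrightarrow> 0 \<le> \<beta> x"
  using \<beta>b b0 unfolding Q_eq by force

lemma piecewise_integral:
  assumes g: "\<And>k x. k \<in> K \<Longrightarrow> x \<in> P k \<Longrightarrow> g x = c k * f x" and c: "\<And>k. k \<in> K \<Longrightarrow> 0 \<le> c k"
  shows "(\<integral>\<^sup>+x\<in>Q. ennreal (g x) \<partial>lborel) = ennreal (\<Sum>k\<in>K. c k * F k)"
proof -
  have "(\<integral>\<^sup>+x\<in>Q. ennreal (g x) \<partial>lborel) = (\<integral>\<^sup>+x. (\<Sum>k\<in>K. ennreal (c k) * (ennreal (f x) * indicator (P k) x)) \<partial>lborel)"
  proof (intro nn_integral_cong)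
    fix x
    have "(\<Sum>k\<in>K. ennreal (c k) * (ennreal (f x) * indicator (P k) x)) = (\<Sum>k\<in>K. ennreal (g x) * indicator (P k) x)"
      using g c f0[of x] by (intro sum.cong) (auto simp: ennreal_mult split: split_indicator)
    also have "\<dots> = ennreal (g x) * indicator Q x"
      unfolding Q_eq by (subst indicator_UN_disjoint[OF K disj]) (simp add: sum_distrib_left)
    finally show "ennreal (g x) * indicator Q x = (\<Sum>k\<in>K. ennreal (c k) * (ennreal (f x) * indicator (P k) x))" ..
  qed
  also have "\<dots> = (\<Sum>k\<in>K. ennreal (c k) * ennreal (F k))"
    by (subst nn_integral_sum) (auto simp: nn_integral_cmult F)
  also have "\<dots> = ennreal (\<Sum>k\<in>K. c k * F k)"
    using c F0 by (subst sum_ennreal[symmetric]) (auto simp: ennreal_mult)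
  finally show ?thesis .
qed

lemma src_mass: "(\<integral>\<^sup>+x\<in>Q. ennreal (\<alpha> * f x) \<partial>lborel) = ennreal (\<alpha> * (\<Sum>k\<in>K. F k))"
  using \<alpha>0 by (subst piecewise_integral[where c="\<lambda>_. \<alpha>"]) (auto simp: sum_distrib_left)

lemma tgt_mass: "(\<integral>\<^sup>+x\<in>Q. ennreal (\<beta> x * f x) \<partial>lborel) = ennreal (\<alpha> * (\<Sum>k\<in>K. F k))"
  unfolding mass using b0 by (subst piecewise_integral[where c=b]) (auto simp: \<beta>b)

text \<open>Only the excess mass moves: it is at most \<open>D\<close>, and the diameter of the cell
  bounds its path.\<close>

lemma transportable_rough:
  assumes p: "0 < p"
  shows "transportable p src tgt (ennreal ((CARD('d) * l) powr p * D))"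
proof -
  let ?u = "\<lambda>x. \<alpha> * f x * indicator Q x" and ?v = "\<lambda>x. \<beta> x * f x * indicator Q x"
  have e: "ennreal (?u x) = ennreal (\<alpha> * f x) * indicator Q x" "ennreal (?v x) = ennreal (\<beta> x * f x) * indicator Q x" for x
    by (auto split: split_indicator)
  have "transportable p (density lborel (\<lambda>x. ennreal (?u x))) (density lborel (\<lambda>x. ennreal (?v x)))
    (ennreal ((CARD('d) * l) powr p) * (\<integral>\<^sup>+x. ennreal (?v x - ?u x) \<partial>lborel))"
  proof (rule transportable_tv[where Q=Q])
    show "norm (x - y) \<le> real CARD('d) * l" if "x \<in> Q" "y \<in> Q" for x y
      using that Q_sub by (intro ccube_diam[of x A l y]) auto
    show "0 \<le> ?u x" "0 \<le> ?v x" for x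
      using \<alpha>0 f0 beta_nonneg by (auto split: split_indicator)
    show "(\<integral>\<^sup>+x. ennreal (?u x) \<partial>lborel) = (\<integral>\<^sup>+x. ennreal (?v x) \<partial>lborel)"
      unfolding e by (simp add: src_mass tgt_mass)
    show "(\<integral>\<^sup>+x. ennreal (?v x) \<partial>lborel) < \<infinity>"
      unfolding e by (simp add: tgt_mass)
  qed (use p in auto)
  then have "transportable p src tgt (ennreal ((CARD('d) * l) powr p) * (\<integral>\<^sup>+x. ennreal (?v x - ?u x) \<partial>lborel))"
    by (simp only: e)
  moreover have "(\<integral>\<^sup>+x. ennreal (?v x - ?u x) \<partial>lborel) \<le> ennreal D"
  proof -
    have "(\<integral>\<^sup>+x. ennreal (?v x - ?u x) \<partial>lborel) \<le> (\<integral>\<^sup>+x\<in>Q. ennreal (\<bar>\<beta> x - \<alpha>\<bar> * f x) \<partial>lborel)"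
    proof (intro nn_integral_mono)
      fix x
      have "(\<beta> x - \<alpha>) * f x \<le> \<bar>\<beta> x - \<alpha>\<bar> * f x" using f0[of x] by (intro mult_right_mono) auto
      then show "ennreal (?v x - ?u x) \<le> ennreal (\<bar>\<beta> x - \<alpha>\<bar> * f x) * indicator Q x"
        by (auto split: split_indicator intro!: ennreal_leI simp: algebra_simps)
    qed
    also have "\<dots> = ennreal D"
      by (rule piecewise_integral) (auto simp: \<beta>b)
    finally show ?thesis .
  qed
  ultimately show ?thesis
    by (auto elim!: transportable_mono intro!: mult_left_mono simp: ennreal_mult')
qed

text \<open>Let \<rho> be a large constant times the relative deviation \<open>Z / S\<close>, where
  \<open>S\<close> is the mass of the cell. If \<rho> is at most 1, all mass is moved by at most
  \<rho> times the diameter bound, at a cost of order \<rho>^p S, which \<rho>^2 S dominates because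
  \<open>p\<close> is at least 2. If \<rho> exceeds 1, then \<open>Z\<close> itself is below a
  multiple of \<open>Z\<^sup>2 / S\<close> and the rough plan suffices.\<close>

lemma transportable_good:
  assumes p: "2 \<le> p" and m: "0 < m" and fm: "\<And>x. x \<in> Q \<Longrightarrow> m \<le> f x \<and> f x \<le> 3 * m"
    and vol: "\<And>k. k \<in> K \<Longrightarrow> emeasure lborel (P k) = ennreal ((l / 2) ^ CARD('d))"
    and Z: "D \<le> Z" "\<bar>\<alpha> - 1\<bar> * (\<Sum>k\<in>K. F k) \<le> Z" and Kne: "K \<noteq> {}"
  shows "transportable p src tgt (ennreal ((CARD('d) * l) powr p * (2 * (72 * 2 ^ CARD('d))\<^sup>2 * Z\<^sup>2 / (\<Sum>k\<in>K. F k))))"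
proof -
  \<comment> \<open>The factor 72 is 3 times 4 times 6: 3 from the oscillation of \<open>f\<close>,
    4 from the displacement bound and 6 from the lower density bound \<open>w\<close>;
    \<open>2 ^ CARD('d)\<close> compares the volumes of cell and subcell.\<close>
  define R :: real where "R = 72 * 2 ^ CARD('d)"
  define S where "S = (\<Sum>k\<in>K. F k)"
  have R: "72 \<le> R" unfolding R_def using one_le_power[of "2::real" "CARD('d)"] by simp
  have Fk: "m * (l / 2) ^ CARD('d) \<le> F k" if k: "k \<in> K" for k
  proof -
    have "ennreal (m * (l / 2) ^ CARD('d)) = (\<integral>\<^sup>+x. ennreal m * indicator (P k) x \<partial>lborel)"
      using k m l by (simp add: nn_integral_cmult_indicator vol ennreal_mult)
    also have "\<dots> \<le> (\<integral>\<^sup>+x\<in>P k. ennreal (f x) \<partial>lborel)"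
      using fm k by (intro nn_integral_mono) (auto split: split_indicator intro!: ennreal_leI simp: Q_eq)
    finally show ?thesis using F0[OF k] by (simp add: F[OF k] ennreal_le_iff)
  qed
  have Fkpos: "0 < F k" if "k \<in> K" for k
    using Fk[OF that] m l by (smt (verit) mult_pos_pos zero_less_power half_gt_zero)
  have S: "0 < S" unfolding S_def using K Kne Fkpos by (intro sum_pos) auto
  have S_le: "S \<le> 3 * m * l ^ CARD('d)"
  proof -
    have "ennreal S = (\<integral>\<^sup>+x\<in>Q. ennreal (1 * f x) \<partial>lborel)"
      by (subst piecewise_integral[where c="\<lambda>_. 1"]) (auto simp: S_def)
    also have "\<dots> \<le> (\<integral>\<^sup>+x\<in>ccube A l. ennreal (3 * m) \<partial>lborel)"
      using fm Q_sub by (intro nn_integral_mono) (auto split: split_indicator intro!: ennreal_leI)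
    also have "\<dots> = ennreal (3 * m * l ^ CARD('d))"
      using m l by (simp add: nn_integral_cmult_indicator emeasure_ccube ennreal_mult)
    finally show ?thesis using m l by (simp add: ennreal_le_iff)
  qed
  have D0: "0 \<le> D" using F0 by (intro sum_nonneg) auto
  have Z0: "0 \<le> Z" using Z(1) D0 by simp
  let ?d = "CARD('d)"
  show ?thesis
  proof (cases "S < R * Z")
    \<comment> \<open>Large relative deviation: \<open>Z \<le> R * Z\<^sup>2 / S\<close>, so the
      total variation plan is good enough.\<close>
    case True
    have "Z * 1 \<le> Z * (R * Z / S)" using True S Z0 by (intro mult_left_mono) (auto simp: pos_le_divide_eq)
    also have "\<dots> = R * Z\<^sup>2 / S" by (simp add: power2_eq_square)
    also have "\<dots> \<le> 2 * R\<^sup>2 * Z\<^sup>2 / S"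
      using R S by (intro divide_right_mono mult_right_mono) (auto simp: power2_eq_square)
    finally have "D \<le> 2 * R\<^sup>2 * Z\<^sup>2 / S" using Z(1) by simp
    then have "(?d * l) powr p * D \<le> (?d * l) powr p * (2 * R\<^sup>2 * Z\<^sup>2 / S)"
      by (intro mult_left_mono) auto
    then show ?thesis
      using p unfolding R_def S_def
      by (intro transportable_mono[OF transportable_rough ennreal_leI]) simp_all
  next
    case False
    \<comment> \<open>\<open>H\<close> bounds the difference of the densities: the factor of a
      subcell changes by at most \<open>Z\<close> over its mass, which is at least
      \<open>m * (l / 2) ^ CARD('d)\<close>, and \<open>f\<close> is at most \<open>3 * m\<close>. A
      sixth of the mean density is at most \<open>m / 2\<close>, hence at most the source
      density.\<close>
    define w where "w = S / (6 * l ^ ?d)"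
    define H where "H = 3 * 2 ^ ?d * Z / l ^ ?d"
    have w: "0 < w" and H: "0 \<le> H" unfolding w_def H_def using S l Z0 by auto
    have Hw: "4 * H / w = R * Z / S" using l S by (simp add: w_def H_def R_def field_simps)
    have "4 * H / w \<le> 1" unfolding Hw using False S by (simp add: divide_le_eq_1)
    then have "4 * H \<le> w" using w by (simp add: pos_divide_le_eq)
    have wm: "w \<le> m / 2" unfolding w_def using S_le l by (simp add: field_simps)
    have \<alpha>: "1 / 2 \<le> \<alpha>" "\<alpha> \<le> 2"
    proof -
      have "\<bar>\<alpha> - 1\<bar> * S \<le> Z" using Z(2) by (simp add: S_def)
      moreover have "72 * Z \<le> R * Z" using R Z0 by (intro mult_right_mono) auto
      ultimately have "\<bar>\<alpha> - 1\<bar> * S \<le> (1 / 72) * S" using False by simp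
      then have "\<bar>\<alpha> - 1\<bar> \<le> 1 / 72" using S by (simp only: mult_le_cancel_right_pos)
      then show "1 / 2 \<le> \<alpha>" "\<alpha> \<le> 2" by linarith+
    qed
    have bk: "\<bar>b k - \<alpha>\<bar> * (3 * m) \<le> H" if k: "k \<in> K" for k
    proof -
      have "\<bar>b k - \<alpha>\<bar> * (m * (l / 2) ^ ?d) \<le> \<bar>b k - \<alpha>\<bar> * F k"
        by (intro mult_left_mono Fk k) auto
      also have "\<dots> \<le> D"
        using K k F0 by (intro member_le_sum[where f="\<lambda>k. \<bar>b k - \<alpha>\<bar> * F k"]) auto
      finally have "\<bar>b k - \<alpha>\<bar> * (m * (l / 2) ^ ?d) \<le> Z" using Z(1) by simp
      then show ?thesis unfolding H_def using l by (simp add: power_divide field_simps)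
    qed
    let ?C = "w / 2 + H + (\<Sum>k\<in>K. b k) * (3 * m)"
    \<comment> \<open>Outside \<open>Q\<close> the values serve only to satisfy the pointwise
      bounds; inside the closed cube they concern a null set.\<close>
    define v where "v x = (if x \<in> Q then \<beta> x * f x else w / 2 + H)" for x
    define h where "h x = (if x \<in> Q then \<beta> x * f x - \<alpha> * f x else 0)" for x
    have [measurable]: "v \<in> borel_measurable borel" "h \<in> borel_measurable borel"
      unfolding v_def h_def by measurable
    have hH: "\<bar>h x\<bar> \<le> H" for x
    proof (cases "x \<in> Q")
      case True
      then obtain k where k: "k \<in> K" "x \<in> P k" by (auto simp: Q_eq)
      have "\<bar>h x\<bar> = \<bar>b k - \<alpha>\<bar> * f x"
        using True k f0[of x] by (simp add: h_def \<beta>b abs_mult flip: left_diff_distrib)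
      also have "\<dots> \<le> \<bar>b k - \<alpha>\<bar> * (3 * m)" using fm[OF True] by (intro mult_left_mono) auto
      finally show ?thesis using bk[OF k(1)] by simp
    qed (simp add: h_def H)
    have vb: "w / 2 + H \<le> v x \<and> v x \<le> ?C" for x
    proof (cases "x \<in> Q")
      case True
      then obtain k where k: "k \<in> K" "x \<in> P k" by (auto simp: Q_eq)
      have "(1 / 2) * m \<le> \<alpha> * f x" using \<alpha> fm[OF True] m by (intro mult_mono) auto
      then have "w \<le> \<alpha> * f x" using wm by simp
      moreover have "v x = \<alpha> * f x + h x" using True by (simp add: v_def h_def)
      \<comment> \<open>The target is at least \<open>w - H\<close>, and
        \<open>4 * H \<le> w\<close> turns this into \<open>w / 2 + H\<close>, the reserve that the
        flow requires.\<close>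
      ultimately have 1: "w / 2 + H \<le> v x" using hH[of x] \<open>4 * H \<le> w\<close> w by linarith
      have "v x = b k * f x" using True k by (simp add: v_def \<beta>b)
      also have "\<dots> \<le> (\<Sum>k\<in>K. b k) * (3 * m)"
        using fm[OF True] b0 K k m by (intro mult_mono member_le_sum) (auto intro!: sum_nonneg)
      also have "\<dots> \<le> ?C" using w H by linarith
      finally show ?thesis using 1 by simp
    next
      case False
      have "0 \<le> (\<Sum>k\<in>K. b k) * (3 * m)" using b0 m by (auto intro!: mult_nonneg_nonneg sum_nonneg)
      then show ?thesis using False by (simp add: v_def) 
    qed
    have es: "dens (\<lambda>x. v x - h x) (ccube A l) = src"
      using Q_ae Q_sub by (intro density_cong) (auto simp: v_def h_def split: split_indicator elim!: eventually_mono)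
    have et: "dens (\<lambda>x. v x) (ccube A l) = tgt"
      using Q_ae Q_sub by (intro density_cong) (auto simp: v_def split: split_indicator elim!: eventually_mono)
    have "(\<integral>\<^sup>+x\<in>ccube A l. ennreal (v x - h x) \<partial>lborel) = emeasure src UNIV"
      unfolding es[symmetric] by (simp add: emeasure_density)
    also have "\<dots> = emeasure tgt UNIV"
      using src_mass tgt_mass by (simp add: emeasure_density)
    also have "\<dots> = (\<integral>\<^sup>+x\<in>ccube A l. ennreal (v x) \<partial>lborel)"
      unfolding et[symmetric] by (simp add: emeasure_density)
    finally obtain T where T: "T \<in> borel \<rightarrow>\<^sub>M borel" "distr src borel T = tgt"
      and Tx: "\<And>x. x \<in> ccube A l \<Longrightarrow> norm (T x - x) \<le> ?d * (2 * H * l / (w / 2))"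
      using flow_transport[of l "w / 2" v A H ?C h UNIV] l w vb hH unfolding es et by auto
    define \<rho> where "\<rho> = R * Z / S"
    have \<rho>: "0 \<le> \<rho>" "\<rho> \<le> 1" using R Z0 S False by (auto simp: \<rho>_def)
    have "?d * (2 * H * l / (w / 2)) = (?d * l) * (4 * H / w)" by simp
    also have "\<dots> = (?d * l) * \<rho>" by (simp add: Hw \<rho>_def)
    finally have K_eq: "?d * (2 * H * l / (w / 2)) = (?d * l) * \<rho>" .
    have "transportable p src tgt (ennreal (((?d * l) * \<rho>) powr p) * (\<integral>\<^sup>+x\<in>Q. ennreal (\<alpha> * f x) \<partial>lborel))"
      using p T Tx Q_sub unfolding K_eq
      by (intro transportable_bounded_map[where T=T]) (auto split: split_indicator_asm)
    moreover have "ennreal (((?d * l) * \<rho>) powr p) * (\<integral>\<^sup>+x\<in>Q. ennreal (\<alpha> * f x) \<partial>lborel)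
      = ennreal (((?d * l) * \<rho>) powr p * (\<alpha> * S))"
      unfolding src_mass S_def by (simp add: ennreal_mult')
    moreover have "((?d * l) * \<rho>) powr p * (\<alpha> * S) \<le> (?d * l) powr p * (2 * R\<^sup>2 * Z\<^sup>2 / S)"
    proof -
      \<comment> \<open>Here \<open>p \<ge> 2\<close> produces the quadratic dependence on the
        deviation.\<close>
      have "\<rho> powr p \<le> \<rho>\<^sup>2"
        using \<rho> p powr_mono'[of 2 p \<rho>] by (cases "\<rho> = 0") (auto simp: powr_numeral)
      then have "\<rho> powr p * (\<alpha> * S) \<le> \<rho>\<^sup>2 * (2 * S)"
        using \<alpha> S by (intro mult_mono) auto
      also have "\<dots> = 2 * R\<^sup>2 * Z\<^sup>2 / S"
        using S by (simp add: \<rho>_def power2_eq_square field_simps)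
      finally have "(?d * l) powr p * (\<rho> powr p * (\<alpha> * S)) \<le> (?d * l) powr p * (2 * R\<^sup>2 * Z\<^sup>2 / S)"
        by (rule mult_left_mono) simp
      moreover have "((?d * l) * \<rho>) powr p = (?d * l) powr p * \<rho> powr p"
        by (intro powr_mult)
      ultimately show ?thesis by (simp only: mult.assoc)
    qed
    ultimately show ?thesis
      by (auto elim!: transportable_mono intro!: ennreal_leI simp: R_def S_def)
  qed
qed

end

section \<open>Dyadic cells\<close>

text \<open>The two-step bound is iterated with the accumulated weight as its first weight, whose
  power cancels the factor in front of the previous bound.\<close>

lemma transportable_chain:
  fixes g :: "nat \<Rightarrow> 'a::euclidean_space measure"
  assumes p: "1 < p" and sets: "\<And>j. j \<le> N \<Longrightarrow> sets (g j) = sets borel"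
    and w: "\<And>j. j < N \<Longrightarrow> 0 < w j" and c: "\<And>j. j < N \<Longrightarrow> 0 \<le> c j"
    and tr: "\<And>j. j < N \<Longrightarrow> transportable p (g j) (g (Suc j)) (ennreal (c j))"
  shows "transportable p (g 0) (g N) (ennreal ((\<Sum>j<N. w j) powr (p - 1) * (\<Sum>j<N. c j / w j powr (p - 1))))"
  using sets w c tr
proof (induction N)
  case 0
  then show ?case by (auto intro!: transportable_mono[OF transportable_refl])
next
  case (Suc N)
  show ?case
  proof (cases "N = 0")
    \<comment> \<open>The first step stands apart, since an accumulated weight of 0 is not allowed
      in the two-step bound.\<close>
    case True
    then show ?thesis using Suc.prems(2)[of 0] Suc.prems(4)[of 0] by simp
  next
    case False
    let ?W = "\<Sum>j<N. w j" and ?S = "\<Sum>j<N. c j / w j powr (p - 1)"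
    have W: "0 < ?W" using False Suc.prems(2) by (intro sum_pos) auto
    have S: "0 \<le> ?S" using Suc.prems(3) by (intro sum_nonneg divide_nonneg_nonneg) auto
    have "transportable p (g 0) (g (Suc N)) (ennreal ((?W + w N) powr (p - 1)) *
      (ennreal (?W powr (p - 1) * ?S) / ennreal (?W powr (p - 1)) + ennreal (c N) / ennreal (w N powr (p - 1))))"
      using Suc W p by (intro transportable_trans) auto
    moreover have "ennreal ((?W + w N) powr (p - 1)) *
      (ennreal (?W powr (p - 1) * ?S) / ennreal (?W powr (p - 1)) + ennreal (c N) / ennreal (w N powr (p - 1)))
      = ennreal ((?W + w N) powr (p - 1) * (?S + c N / w N powr (p - 1)))"
    proof -
      have "ennreal (?W powr (p - 1) * ?S) / ennreal (?W powr (p - 1)) = ennreal ?S"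
        using W S by (subst divide_ennreal) auto
      moreover have "ennreal (c N) / ennreal (w N powr (p - 1)) = ennreal (c N / w N powr (p - 1))"
        using Suc.prems(2,3)[of N] by (subst divide_ennreal) auto
      ultimately show ?thesis
        using S Suc.prems(3)[of N] by (simp add: ennreal_mult' ennreal_plus)
    qed
    ultimately show ?thesis by simp
  qed
qed

text \<open>The dyadic intervals are closed on the left only, except that the last one contains 1.
  This makes the cells a partition of the closed cube.\<close>

definition digit :: "nat \<Rightarrow> real \<Rightarrow> nat"
  where "digit j t = (if t = 1 then 2 ^ j - 1 else nat \<lfloor>2 ^ j * t\<rfloor>)"

definition cell_index :: "nat \<Rightarrow> real ^ 'd \<Rightarrow> 'd \<Rightarrow> nat"
  where "cell_index j x = (\<lambda>i. digit j (x $ i))"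

definition cell :: "nat \<Rightarrow> ('d \<Rightarrow> nat) \<Rightarrow> (real ^ 'd) set"
  where "cell j k = {x \<in> unit_cube. cell_index j x = k}"

text \<open>Over \<open>UNIV\<close> the dependent product is an ordinary function space; this form
  gives finiteness and cardinality directly.\<close>

definition indices :: "nat \<Rightarrow> ('d \<Rightarrow> nat) set"
  where "indices j = (\<Pi>\<^sub>E i\<in>UNIV. {..<2 ^ j})"

definition children :: "('d \<Rightarrow> nat) \<Rightarrow> ('d \<Rightarrow> nat) set"
  where "children k = (\<Pi>\<^sub>E i\<in>UNIV. {2 * k i, 2 * k i + 1})"

lemma indices_iff: "k \<in> indices j \<longleftrightarrow> (\<forall>i. k i < 2 ^ j)"
  by (auto simp: indices_def PiE_iff)

lemma children_iff: "k' \<in> children k \<longleftrightarrow> (\<forall>i. k' i div 2 = k i)"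
proof -
  have "n \<in> {2 * m, 2 * m + 1} \<longleftrightarrow> n div 2 = m" for n m :: nat by auto
  then show ?thesis by (auto simp: children_def PiE_iff)
qed

lemma finite_indices [simp]: "finite (indices j :: ('d::finite \<Rightarrow> nat) set)"
  by (auto simp: indices_def intro!: finite_PiE)

lemma finite_children [simp]: "finite (children (k :: 'd::finite \<Rightarrow> nat))"
  by (auto simp: children_def intro!: finite_PiE)

lemma card_indices: "card (indices j :: ('d::finite \<Rightarrow> nat) set) = (2 ^ j) ^ CARD('d)"
  by (simp add: indices_def card_PiE)

lemma card_children: "card (children (k :: 'd::finite \<Rightarrow> nat)) = 2 ^ CARD('d)"
  by (simp add: children_def card_PiE numeral_2_eq_2)

lemma children_nonempty: "children (k :: 'd::finite \<Rightarrow> nat) \<noteq> {}"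
  by (simp add: children_def PiE_eq_empty_iff)

lemma children_subset: "k \<in> indices j \<Longrightarrow> children k \<subseteq> indices (Suc j)"
proof
  fix k' assume "k \<in> indices j" "k' \<in> children k"
  then have "k' i div 2 < 2 ^ j" for i by (simp add: indices_iff children_iff)
  then show "k' \<in> indices (Suc j)" by (auto simp: indices_iff less_mult_imp_div_less div_less_iff_less_mult mult.commute)
qed

lemma indices_0: "indices 0 = {\<lambda>_. 0}"
  by (auto simp: indices_iff fun_eq_iff)

lemma digit_less: "0 \<le> t \<Longrightarrow> t \<le> 1 \<Longrightarrow> digit j t < 2 ^ j"
proof -
  assume t: "0 \<le> t" "t \<le> 1"
  show ?thesis
  proof (cases "t = 1")
    case False
    then have "2 ^ j * t < 2 ^ j * 1" using t by (intro mult_strict_left_mono) auto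
    then have "\<lfloor>2 ^ j * t\<rfloor> < 2 ^ j" by (simp add: floor_less_iff)
    then show ?thesis using False t by (simp add: digit_def nat_less_iff)
  qed (simp add: digit_def)
qed

text \<open>Halving drops the last binary digit, and the convention at 1 is compatible with it. This
  is what nests the partitions.\<close>

lemma digit_Suc: "0 \<le> t \<Longrightarrow> digit (Suc j) t div 2 = digit j t"
proof (cases "t = 1")
  case True
  have "(2 * 2 ^ j - Suc 0) div 2 = 2 ^ j - Suc 0"
    using one_le_power[of "2::nat" j] by presburger
  then show ?thesis using True by (simp add: digit_def)
next
  case False
  assume "0 \<le> t"
  have "\<lfloor>2 ^ Suc j * t\<rfloor> div 2 = \<lfloor>2 ^ j * t\<rfloor>"
    using floor_divide_real_eq_div[of 2 "2 ^ Suc j * t"] by simp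
  moreover have "nat \<lfloor>2 ^ Suc j * t\<rfloor> div 2 = nat (\<lfloor>2 ^ Suc j * t\<rfloor> div 2)"
    using \<open>0 \<le> t\<close> by (simp add: nat_div_distrib)
  ultimately show ?thesis using False by (simp add: digit_def)
qed

lemma digit_bounds: "0 \<le> t \<Longrightarrow> t \<le> 1 \<Longrightarrow> t \<in> {digit j t / 2 ^ j..(real (digit j t) + 1) / 2 ^ j}"
proof -
  assume t: "0 \<le> t" "t \<le> 1"
  show ?thesis
  proof (cases "t = 1")
    case True
    have "real (2 ^ j - 1) = 2 ^ j - 1" by (simp add: of_nat_diff)
    then show ?thesis using True by (simp add: digit_def divide_le_eq_1)
  next
    case False
    have "0 \<le> \<lfloor>2 ^ j * t\<rfloor>" using t by simp
    then have "real (digit j t) = real_of_int \<lfloor>2 ^ j * t\<rfloor>"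
      using False by (simp add: digit_def)
    moreover have "\<lfloor>2 ^ j * t\<rfloor> \<le> 2 ^ j * t" "2 ^ j * t \<le> \<lfloor>2 ^ j * t\<rfloor> + 1" by linarith+
    ultimately show ?thesis by (simp add: field_simps)
  qed
qed

lemma digit_eqI:
  assumes "real n / 2 ^ j \<le> t" "t < (real n + 1) / 2 ^ j" "n < 2 ^ j"
  shows "digit j t = n"
proof -
  have "real n + 1 \<le> 2 ^ j"
  proof -
    have "real (n + 1) \<le> real (2 ^ j)" using assms(3) by (intro of_nat_mono) simp
    then show ?thesis by simp
  qed
  then have "(real n + 1) / 2 ^ j \<le> 1" by simp
  then have "t < 1" using assms(2) by linarith
  moreover have "\<lfloor>2 ^ j * t\<rfloor> = int n"
    using assms(1,2) by (intro floor_unique) (auto simp: field_simps)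
  ultimately show ?thesis by (simp add: digit_def)
qed

lemma unit_cube_iff: "x \<in> unit_cube \<longleftrightarrow> (\<forall>i. 0 \<le> x $ i \<and> x $ i \<le> 1)" for x :: "real ^ 'd"
  by (simp add: mem_box_cart)

lemma cell_index_in: "x \<in> unit_cube \<Longrightarrow> cell_index j x \<in> indices j"
  by (auto simp: indices_iff cell_index_def unit_cube_iff intro!: digit_less)

lemma digit_measurable [measurable]: "digit j \<in> borel \<rightarrow>\<^sub>M count_space UNIV"
  unfolding digit_def by measurable

lemma cell_measurable [measurable]: "cell j k \<in> sets borel"
proof -
  have "cell j k = unit_cube \<inter> {x. \<forall>i\<in>UNIV. digit j (x $ i) = k i}"
    by (auto simp: cell_def cell_index_def fun_eq_iff)
  also have "\<dots> \<in> sets borel" by measurable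
  finally show ?thesis .
qed

lemma Union_cells: "(\<Union>k\<in>indices j. cell j k) = unit_cube"
  using cell_index_in by (auto simp: cell_def)

lemma disjoint_cells: "disjoint_family_on (cell j) K"
  by (auto simp: disjoint_family_on_def cell_def)

lemma cell_Suc: "cell j k = (\<Union>k'\<in>children k. cell (Suc j) k')"
proof -
  have "cell_index (Suc j) x \<in> children k \<longleftrightarrow> cell_index j x = k" if "x \<in> unit_cube" for x
    using that by (auto simp: children_iff cell_index_def unit_cube_iff digit_Suc fun_eq_iff)
  then show ?thesis by (auto simp: cell_def)
qed

definition corner :: "nat \<Rightarrow> ('d \<Rightarrow> nat) \<Rightarrow> real ^ 'd"
  where "corner j k = (\<chi> i. k i / 2 ^ j)"

lemma cell_subset_ccube: "cell j k \<subseteq> ccube (corner j k) (1 / 2 ^ j)"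
proof
  fix x assume x: "x \<in> cell j k"
  have "x $ i \<in> {real (k i) / 2 ^ j..(real (k i) + 1) / 2 ^ j}" for i
    using digit_bounds[of "x $ i" j] x unfolding cell_def cell_index_def unit_cube_iff by auto
  then show "x \<in> ccube (corner j k) (1 / 2 ^ j)"
    unfolding ccube_def corner_def by (simp add: add_divide_distrib)
qed

text \<open>Every line in direction \<open>i\<close> meets the hyperplane in a single point.\<close>

lemma AE_nth_neq: "AE x in lborel. (x :: real ^ 'd) $ i \<noteq> c"
proof -
  have "emeasure lborel {x :: real ^ 'd. x $ i = c} = (\<integral>\<^sup>+x. indicator {x. x $ i = c} x \<partial>lborel)"
    by (subst nn_integral_indicator) auto
  also have "\<dots> = (\<integral>\<^sup>+x. indicator {0..1} ((x :: real ^ 'd) $ i) * (\<integral>\<^sup>+r. indicator {c} r \<partial>lborel) \<partial>lborel)"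
  proof -
    have "indicator {x :: real ^ 'd. x $ i = c} (upd x i r) = (indicator {c} r :: ennreal)" for x r
      by (simp add: upd_nth indicator_def)
    then show ?thesis by (subst nn_integral_upd[where i=i]) simp_all
  qed
  also have "\<dots> = 0" by simp
  finally show ?thesis by (intro AE_I[where N="{x. x $ i = c}"]) auto
qed

text \<open>Off the upper faces, which lie in finitely many hyperplanes, the closed cube is
  contained in the cell.\<close>

lemma ccube_AE_cell:
  assumes "k \<in> indices j"
  shows "AE x in lborel. x \<in> ccube (corner j k) (1 / 2 ^ j) \<longrightarrow> x \<in> cell j k"
proof -
  have "AE x in lborel. \<forall>i\<in>UNIV. (x :: real ^ 'a) $ i \<noteq> (real (k i) + 1) / 2 ^ j"
    by (subst AE_finite_all) (auto intro: AE_nth_neq)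
  then show ?thesis
  proof eventually_elim
    case (elim x)
    show ?case
    proof
      assume x: "x \<in> ccube (corner j k) (1 / 2 ^ j)"
      have b: "real (k i) / 2 ^ j \<le> x $ i \<and> x $ i < (real (k i) + 1) / 2 ^ j" for i
      proof -
        have "x $ i \<in> {corner j k $ i..corner j k $ i + 1 / 2 ^ j}" using x unfolding ccube_def by blast
        then have "real (k i) / 2 ^ j \<le> x $ i" "x $ i \<le> (real (k i) + 1) / 2 ^ j"
          by (simp_all add: corner_def add_divide_distrib)
        moreover have "x $ i \<noteq> (real (k i) + 1) / 2 ^ j" using elim by blast
        ultimately show ?thesis by linarith
      qed
      have kl: "k i < 2 ^ j" for i using assms by (simp add: indices_iff)
      have "0 \<le> x $ i \<and> x $ i \<le> 1" for i
      proof -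
        have "real (k i + 1) \<le> real (2 ^ j)" using kl[of i] by (intro of_nat_mono) simp
        then have "(real (k i) + 1) / 2 ^ j \<le> 1" by simp
        moreover have "0 \<le> real (k i) / 2 ^ j" by simp
        ultimately show ?thesis using b[of i] by linarith
      qed
      moreover have "cell_index j x = k"
        using b kl by (auto simp: cell_index_def fun_eq_iff intro!: digit_eqI)
      ultimately show "x \<in> cell j k" by (simp add: cell_def unit_cube_iff)
    qed
  qed
qed

lemma emeasure_cell:
  assumes "k \<in> indices j"
  shows "emeasure lborel (cell j k :: (real ^ 'd) set) = ennreal ((1 / 2 ^ j) ^ CARD('d))"
proof -
  have "emeasure lborel (cell j k) = emeasure lborel (ccube (corner j k) (1 / 2 ^ j))"
    using ccube_AE_cell[OF assms] cell_subset_ccube[of j k]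
    by (intro emeasure_eq_AE) (auto elim!: eventually_mono)
  then show ?thesis by (simp add: emeasure_ccube)
qed

lemma is_cube_cell:
  assumes "k \<in> indices j"
  shows "is_cube (cell j k :: (real ^ 'd) set)"
  unfolding is_cube_def
proof (intro exI conjI allI)
  \<comment> \<open>Half-open, or closed if the interval ends at 1: the description by digits covers
    both.\<close>
  let ?I = "\<lambda>i. {t \<in> {0..1}. digit j t = k i}"
  show "0 < (1 / 2 ^ j :: real)" by simp
  show "cell j k = {x. \<forall>i. x $ i \<in> ?I i}"
    by (auto simp: cell_def cell_index_def unit_cube_iff fun_eq_iff)
  fix i
  have kl: "k i < 2 ^ j" using assms by (simp add: indices_iff)
  then have "real (k i + 1) \<le> real (2 ^ j)" by (intro of_nat_mono) simp
  then have k1: "(real (k i) + 1) / 2 ^ j \<le> 1" "0 \<le> real (k i) / 2 ^ j" by simp_all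
  have "t \<in> ?I i" if "real (k i) / 2 ^ j < t" "t < (real (k i) + 1) / 2 ^ j" for t
  proof -
    have "digit j t = k i" using that kl by (intro digit_eqI) auto
    moreover have "0 \<le> t" "t \<le> 1" using that k1 by linarith+
    ultimately show ?thesis by simp
  qed
  then show "{corner j k $ i<..<corner j k $ i + 1 / 2 ^ j} \<subseteq> ?I i"
    by (auto simp: corner_def add_divide_distrib)
  show "?I i \<subseteq> {corner j k $ i..corner j k $ i + 1 / 2 ^ j}"
  proof
    fix t assume t: "t \<in> ?I i"
    then have "t \<in> {digit j t / 2 ^ j..(real (digit j t) + 1) / 2 ^ j}" by (intro digit_bounds) auto
    then show "t \<in> {corner j k $ i..corner j k $ i + 1 / 2 ^ j}"
      using t by (simp add: corner_def add_divide_distrib)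
  qed
qed

section \<open>The chain of reweighted densities\<close>

definition step_fun :: "nat \<Rightarrow> (('d \<Rightarrow> nat) \<Rightarrow> real) \<Rightarrow> real ^ 'd \<Rightarrow> real"
  where "step_fun j c x = (\<Sum>k\<in>indices j. c k * indicator (cell j k) x)"

lemma step_fun_measurable [measurable]: "step_fun j c \<in> borel_measurable borel"
  unfolding step_fun_def by measurable

lemma step_fun_eq: "k \<in> indices j \<Longrightarrow> x \<in> cell j k \<Longrightarrow> step_fun j c x = c k"
proof -
  assume k: "k \<in> indices j" and x: "x \<in> cell j k"
  have "step_fun j c x = (\<Sum>k'\<in>indices j. if k' = k then c k else 0)"
    unfolding step_fun_def using x by (intro sum.cong) (auto simp: cell_def)
  then show ?thesis using k by simp
qed

lemma step_fun_nonneg: "(\<And>k. k \<in> indices j \<Longrightarrow> 0 \<le> c k) \<Longrightarrow> 0 \<le> step_fun j c x"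
  unfolding step_fun_def by (intro sum_nonneg) auto

text \<open>Smoothness enters only through the oscillation on dyadic cells. This form includes
  bounded densities as \<open>s = 0\<close> and lets \<open>\<kappa>\<close> absorb the diameter of
  the unit cube.\<close>

locale holder_density =
  fixes f :: "real ^ 'd \<Rightarrow> real" and p s \<kappa> :: real
  assumes f[measurable]: "f \<in> borel_measurable borel" and f0: "\<And>x. 0 \<le> f x"
    and f_int: "(\<integral>\<^sup>+x\<in>unit_cube. ennreal (f x) \<partial>lborel) = 1"
    and osc: "\<And>j k x y. x \<in> cell j k \<Longrightarrow> y \<in> cell j k \<Longrightarrow> \<bar>f x - f y\<bar> \<le> \<kappa> * (1 / 2 ^ j) powr s"
    and \<kappa>: "0 < \<kappa>" and p: "2 \<le> p"
begin

definition F :: "nat \<Rightarrow> ('d \<Rightarrow> nat) \<Rightarrow> real"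
  where "F j k = enn2real (\<integral>\<^sup>+x\<in>cell j k. ennreal (f x) \<partial>lborel)"

lemma cell_sub: "cell j k \<subseteq> unit_cube" by (auto simp: cell_def)

lemma ennreal_F: "(\<integral>\<^sup>+x\<in>cell j k. ennreal (f x) \<partial>lborel) = ennreal (F j k)"
proof -
  have "(\<integral>\<^sup>+x\<in>cell j k. ennreal (f x) \<partial>lborel) \<le> (\<integral>\<^sup>+x\<in>unit_cube. ennreal (f x) \<partial>lborel)"
    using cell_sub by (intro nn_integral_mono) (auto split: split_indicator)
  then have "(\<integral>\<^sup>+x\<in>cell j k. ennreal (f x) \<partial>lborel) < \<top>"
    using f_int by (simp add: le_less_trans ennreal_one_less_top)
  then show ?thesis unfolding F_def by simp
qed

lemma F0: "0 \<le> F j k" by (simp add: F_def)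

lemma F_Suc: "F j k = (\<Sum>k'\<in>children k. F (Suc j) k')"
proof -
  have "ennreal (F j k) = (\<integral>\<^sup>+x. (\<Sum>k'\<in>children k. ennreal (f x) * indicator (cell (Suc j) k') x) \<partial>lborel)"
    unfolding ennreal_F[symmetric] cell_Suc[of j k]
    by (subst indicator_UN_disjoint[OF finite_children disjoint_cells]) (simp add: sum_distrib_left)
  also have "\<dots> = ennreal (\<Sum>k'\<in>children k. F (Suc j) k')"
    by (subst nn_integral_sum) (auto simp: ennreal_F F0 sum_ennreal)
  finally show ?thesis using F0 by (subst (asm) ennreal_inj) (auto intro: sum_nonneg)
qed

text \<open>Exceeding twice the oscillation bound at one point confines \<open>f\<close> on the
  whole cell to half and three halves of that value.\<close>

definition good :: "nat \<Rightarrow> ('d \<Rightarrow> nat) \<Rightarrow> bool"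
  where "good j k \<longleftrightarrow> (\<exists>x\<in>cell j k. 2 * \<kappa> * (1 / 2 ^ j) powr s < f x)"

lemma bad_F:
  assumes "k \<in> indices j" "\<not> good j k"
  shows "F j k \<le> 2 * \<kappa> * (1 / 2 ^ j) powr s * (1 / 2 ^ j) ^ CARD('d)"
proof -
  have "ennreal (F j k) \<le> (\<integral>\<^sup>+x\<in>cell j k. ennreal (2 * \<kappa> * (1 / 2 ^ j) powr s) \<partial>lborel)"
    unfolding ennreal_F[symmetric] using assms(2)
    by (intro nn_integral_mono) (auto split: split_indicator intro!: ennreal_leI simp: good_def not_less)
  also have "\<dots> = ennreal (2 * \<kappa> * (1 / 2 ^ j) powr s * (1 / 2 ^ j) ^ CARD('d))"
    using \<kappa> by (simp add: nn_integral_cmult_indicator emeasure_cell[OF assms(1)] ennreal_mult)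
  finally show ?thesis using \<kappa> by (subst (asm) ennreal_le_iff) auto
qed

text \<open>The coefficient of the squared errors in the cost of a cell. The factor
  \<open>1 + 2 ^ CARD('d)\<close> counts a cell together with its children and comes from the
  Cauchy-Schwarz inequality.\<close>

definition coef :: "nat \<Rightarrow> real \<Rightarrow> ('d \<Rightarrow> nat) \<Rightarrow> real"
  where "coef j t k = (1 + 2 ^ CARD('d)) * (if good j k then 2 * (72 * 2 ^ CARD('d))\<^sup>2 / F j k else 1 / t)"

lemma coef_nonneg: "0 < t \<Longrightarrow> 0 \<le> coef j t k"
  unfolding coef_def using F0 by auto

end

text \<open>The numbers \<open>m j k\<close> stand for observed frequencies, of which only
  consistency is assumed. The transport argument is thus deterministic; randomness is confined to
  \<open>m_null\<close>, which holds almost surely.\<close>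

locale histogram_chain = holder_density f p s \<kappa>
  for f :: "real ^ 'd \<Rightarrow> real" and p s \<kappa> :: real +
  fixes m :: "nat \<Rightarrow> ('d \<Rightarrow> nat) \<Rightarrow> real"
  assumes m0: "\<And>j k. 0 \<le> m j k" and m_root: "m 0 (\<lambda>_. 0) = 1"
    and m_Suc: "\<And>j k. k \<in> indices j \<Longrightarrow> m j k = (\<Sum>k'\<in>children k. m (Suc j) k')"
    and m_null: "\<And>j k. k \<in> indices j \<Longrightarrow> F j k = 0 \<Longrightarrow> m j k = 0"
begin

lemma ratio_F: "k \<in> indices j \<Longrightarrow> m j k / F j k * F j k = m j k"
  using m_null by (cases "F j k = 0") auto

text \<open>The deviation written \<open>Z\<close> in the overview.\<close>

definition dev :: "nat \<Rightarrow> ('d \<Rightarrow> nat) \<Rightarrow> real"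
  where "dev j k = \<bar>m j k - F j k\<bar> + (\<Sum>k'\<in>children k. \<bar>m (Suc j) k' - F (Suc j) k'\<bar>)"

text \<open>The density \<open>g\<^sub>j\<close> is \<open>ratio j\<close> times \<open>f\<close>.
  Cells without mass of \<open>f\<close> get the factor 0 from division by zero, which is consistent
  by \<open>m_null\<close>.\<close>

definition ratio :: "nat \<Rightarrow> real ^ 'd \<Rightarrow> real"
  where "ratio j = step_fun j (\<lambda>k. m j k / F j k)"

lemma ratio_measurable [measurable]: "ratio j \<in> borel_measurable borel"
  unfolding ratio_def by measurable

lemma cell_split_children:
  assumes k: "k \<in> indices j"
  shows "cell_split (corner j k) (1 / 2 ^ j) (cell j k) (children k) (cell (Suc j)) f (ratio (Suc j))
    (F (Suc j)) (\<lambda>k'. m (Suc j) k' / F (Suc j) k') (m j k / F j k)"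
proof
  have ch: "k' \<in> indices (Suc j)" if "k' \<in> children k" for k'
    using that children_subset[OF k] by auto
  show "ratio (Suc j) x = m (Suc j) k' / F (Suc j) k'" if "k' \<in> children k" "x \<in> cell (Suc j) k'" for k' x
    unfolding ratio_def using that ch by (intro step_fun_eq) auto
  show "m j k / F j k * (\<Sum>k'\<in>children k. F (Suc j) k') =
      (\<Sum>k'\<in>children k. m (Suc j) k' / F (Suc j) k' * F (Suc j) k')"
  proof -
    have "(\<Sum>k'\<in>children k. m (Suc j) k' / F (Suc j) k' * F (Suc j) k') = (\<Sum>k'\<in>children k. m (Suc j) k')"
      by (intro sum.cong refl ratio_F ch)
    then show ?thesis unfolding F_Suc[of j k, symmetric] ratio_F[OF k] by (simp add: m_Suc[OF k])
  qed
qed (use k in \<open>auto simp: cell_subset_ccube ccube_AE_cell cell_Suc[symmetric] disjoint_cells ennreal_F F0 m0 f0 divide_nonneg_nonneg\<close>)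

text \<open>Both reweighted densities are compared with \<open>f\<close>: each child contributes its
  own deviation, and the errors of the parent's factor add up to the deviation of the
  parent.\<close>

lemma split_deviation:
  assumes k: "k \<in> indices j"
  shows "(\<Sum>k'\<in>children k. \<bar>m (Suc j) k' / F (Suc j) k' - m j k / F j k\<bar> * F (Suc j) k') \<le> dev j k"
    and "\<bar>m j k / F j k - 1\<bar> * (\<Sum>k'\<in>children k. F (Suc j) k') \<le> dev j k"
proof -
  let ?\<alpha> = "m j k / F j k"
  have a: "\<bar>?\<alpha> - 1\<bar> * F j k = \<bar>m j k - F j k\<bar>"
  proof -
    have "\<bar>?\<alpha> - 1\<bar> * F j k = \<bar>(?\<alpha> - 1) * F j k\<bar>" using F0 by (simp add: abs_mult)
    then show ?thesis using ratio_F[OF k] by (simp add: left_diff_distrib)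
  qed
  have "\<bar>m (Suc j) k' / F (Suc j) k' - ?\<alpha>\<bar> * F (Suc j) k' \<le> \<bar>m (Suc j) k' - F (Suc j) k'\<bar> + \<bar>?\<alpha> - 1\<bar> * F (Suc j) k'"
    if "k' \<in> children k" for k'
  proof -
    have k': "k' \<in> indices (Suc j)" using that children_subset[OF k] by auto
    have "\<bar>m (Suc j) k' / F (Suc j) k' - ?\<alpha>\<bar> * F (Suc j) k' = \<bar>m (Suc j) k' / F (Suc j) k' * F (Suc j) k' - ?\<alpha> * F (Suc j) k'\<bar>"
    proof -
      have "\<bar>X - ?\<alpha>\<bar> * F (Suc j) k' = \<bar>(X - ?\<alpha>) * F (Suc j) k'\<bar>" for X
        using F0[of "Suc j" k'] by (simp add: abs_mult)
      then show ?thesis by (simp only: left_diff_distrib)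
    qed
    also have "\<dots> = \<bar>(m (Suc j) k' - F (Suc j) k') - (?\<alpha> - 1) * F (Suc j) k'\<bar>"
      unfolding ratio_F[OF k'] by (simp add: algebra_simps)
    also have "\<dots> \<le> \<bar>m (Suc j) k' - F (Suc j) k'\<bar> + \<bar>?\<alpha> - 1\<bar> * F (Suc j) k'"
      using F0[of "Suc j" k'] by (intro order_trans[OF abs_triangle_ineq4]) (simp add: abs_mult)
    finally show ?thesis .
  qed
  then have "(\<Sum>k'\<in>children k. \<bar>m (Suc j) k' / F (Suc j) k' - ?\<alpha>\<bar> * F (Suc j) k')
    \<le> (\<Sum>k'\<in>children k. \<bar>m (Suc j) k' - F (Suc j) k'\<bar> + \<bar>?\<alpha> - 1\<bar> * F (Suc j) k')"
    by (rule sum_mono)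
  also have "\<dots> = (\<Sum>k'\<in>children k. \<bar>m (Suc j) k' - F (Suc j) k'\<bar>) + \<bar>?\<alpha> - 1\<bar> * (\<Sum>k'\<in>children k. F (Suc j) k')"
    by (simp only: sum.distrib sum_distrib_left)
  also have "\<dots> = dev j k"
    unfolding F_Suc[of j k, symmetric] a dev_def by simp
  finally show "(\<Sum>k'\<in>children k. \<bar>m (Suc j) k' / F (Suc j) k' - ?\<alpha>\<bar> * F (Suc j) k') \<le> dev j k" .
  show "\<bar>?\<alpha> - 1\<bar> * (\<Sum>k'\<in>children k. F (Suc j) k') \<le> dev j k"
    unfolding F_Suc[of j k, symmetric] a dev_def by (simp add: sum_nonneg)
qed

lemma dev_nonneg: "0 \<le> dev j k" unfolding dev_def by (intro add_nonneg_nonneg sum_nonneg) auto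

text \<open>The bound \<open>dev \<le> t + dev\<^sup>2 / t\<close> on the bad cells leaves only second moments to be estimated.\<close>

definition cell_cost :: "nat \<Rightarrow> real \<Rightarrow> ('d \<Rightarrow> nat) \<Rightarrow> real"
  where "cell_cost j t k =
    (if good j k then 2 * (72 * 2 ^ CARD('d))\<^sup>2 * (dev j k)\<^sup>2 / F j k else t + (dev j k)\<^sup>2 / t)"

lemma cell_cost_nonneg: "0 < t \<Longrightarrow> 0 \<le> cell_cost j t k"
  unfolding cell_cost_def using F0 by auto

lemma transportable_cell:
  assumes k: "k \<in> indices j" and t: "0 < t"
  shows "transportable p (dens (\<lambda>x. ratio j x * f x) (cell j k))
    (dens (\<lambda>x. ratio (Suc j) x * f x) (cell j k))
    (ennreal ((CARD('d) / 2 ^ j) powr p * cell_cost j t k))"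
proof -
  interpret cell_split "corner j k" "1 / 2 ^ j" "cell j k" "children k" "cell (Suc j)" f "ratio (Suc j)"
    "F (Suc j)" "\<lambda>k'. m (Suc j) k' / F (Suc j) k'" "m j k / F j k"
    by (rule cell_split_children[OF k])
  have src: "dens (\<lambda>x. ratio j x * f x) (cell j k) = src"
    unfolding ratio_def
    by (intro arg_cong[where f="density lborel"] ext) (auto simp: step_fun_eq[OF k] split: split_indicator)
  show ?thesis
  proof (cases "good j k")
    case True
    then obtain x where x: "x \<in> cell j k" "2 * \<kappa> * (1 / 2 ^ j) powr s < f x" by (auto simp: good_def)
    define \<omega> where "\<omega> = \<kappa> * (1 / 2 ^ j) powr s"
    have \<omega>: "2 * \<omega> < f x" "0 < \<omega>" using x \<kappa> by (auto simp: \<omega>_def)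
    \<comment> \<open>The bounds demanded of a good cell, with \<open>m = f x / 2\<close>.\<close>
    have "f x / 2 \<le> f y \<and> f y \<le> 3 * (f x / 2)" if "y \<in> cell j k" for y
      using osc[OF x(1) that] \<omega> by (auto simp flip: \<omega>_def)
    then have "transportable p src tgt (ennreal ((real CARD('d) * (1 / 2 ^ j)) powr p *
       (2 * (72 * 2 ^ CARD('d))\<^sup>2 * (dev j k)\<^sup>2 / (\<Sum>k'\<in>children k. F (Suc j) k'))))"
      using p \<omega> split_deviation[OF k] children_subset[OF k]
      by (intro transportable_good[where m="f x / 2"]) (auto simp: children_nonempty emeasure_cell subset_iff mult.commute)
    then show ?thesis using True unfolding F_Suc[of j k, symmetric] src cell_cost_def by simp
  next
    case False
    have "dev j k \<le> t + (dev j k)\<^sup>2 / t"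
    proof (cases "dev j k \<le> t")
      case True
      then show ?thesis using t by (simp add: add_increasing2)
    next
      case False
      then have "dev j k * t \<le> (dev j k)\<^sup>2" using dev_nonneg[of j k] by (simp add: power2_eq_square mult_left_mono)
      then show ?thesis using t by (simp add: pos_le_divide_eq add_increasing)
    qed
    then have "D \<le> cell_cost j t k" using False split_deviation(1)[OF k] by (simp add: cell_cost_def)
    then have "(real CARD('d) * (1 / 2 ^ j)) powr p * D \<le> (real CARD('d) * (1 / 2 ^ j)) powr p * cell_cost j t k"
      by (rule mult_left_mono) simp
    then have "transportable p src tgt (ennreal ((real CARD('d) * (1 / 2 ^ j)) powr p * cell_cost j t k))"
      using p by (intro transportable_mono[OF transportable_rough ennreal_leI]) simp_all
    then show ?thesis unfolding src by simp
  qed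
qed

lemma transportable_level:
  assumes t: "0 < t"
  shows "transportable p (cube_density (\<lambda>x. ratio j x * f x)) (cube_density (\<lambda>x. ratio (Suc j) x * f x))
    (ennreal ((CARD('d) / 2 ^ j) powr p * (\<Sum>k\<in>indices j. cell_cost j t k)))"
proof -
  have "transportable p (dens (\<lambda>x. ratio j x * f x) (\<Union>k\<in>indices j. cell j k))
    (dens (\<lambda>x. ratio (Suc j) x * f x) (\<Union>k\<in>indices j. cell j k))
    (\<Sum>k\<in>indices j. ennreal ((CARD('d) / 2 ^ j) powr p * cell_cost j t k))"
    using t by (intro transportable_UN transportable_cell) (auto simp: disjoint_cells)
  then show ?thesis
    using cell_cost_nonneg[OF t] by (simp add: Union_cells sum_ennreal sum_distrib_left)
qed

definition hist :: "nat \<Rightarrow> real ^ 'd \<Rightarrow> real"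
  where "hist J = step_fun J (\<lambda>k. m J k * (2 ^ J) ^ CARD('d))"

text \<open>On a cell the source is \<open>m J k / F J k\<close> times \<open>f\<close>, and the
  histogram is the same factor times the mean of \<open>f\<close>. They differ by at most that
  factor times the oscillation. The factor is kept because its expectation is at most 1.\<close>

lemma transportable_hist_cell:
  assumes k: "k \<in> indices J"
  shows "transportable p (dens (\<lambda>x. ratio J x * f x) (cell J k))
    (dens (\<lambda>x. hist J x) (cell J k))
    (ennreal ((CARD('d) / 2 ^ J) powr p * (\<kappa> * (1 / 2 ^ J) powr s * (m J k / F J k * (1 / 2 ^ J) ^ CARD('d)))))"
proof -
  let ?Q = "cell J k" and ?\<alpha> = "m J k / F J k" and ?V = "(1 / 2 ^ J :: real) ^ CARD('d)"
  let ?u = "\<lambda>x. ?\<alpha> * f x * indicator ?Q x" and ?v = "\<lambda>x. m J k / ?V * indicator ?Q x"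
  have V: "0 < ?V" by simp
  have \<alpha>: "0 \<le> ?\<alpha>" using m0 F0 by simp
  have u: "(\<lambda>x. ennreal (ratio J x * f x) * indicator ?Q x) = (\<lambda>x. ennreal (?u x))"
    unfolding ratio_def by (auto simp: fun_eq_iff step_fun_eq[OF k] split: split_indicator)
  have v: "(\<lambda>x. ennreal (hist J x) * indicator ?Q x) = (\<lambda>x. ennreal (?v x))"
    unfolding hist_def by (auto simp: fun_eq_iff step_fun_eq[OF k] power_one_over split: split_indicator)
  have iu: "(\<integral>\<^sup>+x. ennreal (?u x) \<partial>lborel) = ennreal (m J k)"
  proof -
    have "(\<integral>\<^sup>+x. ennreal (?u x) \<partial>lborel) = (\<integral>\<^sup>+x. ennreal ?\<alpha> * (ennreal (f x) * indicator ?Q x) \<partial>lborel)"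
    proof (rule nn_integral_cong)
      fix x
      have "ennreal (?\<alpha> * f x) = ennreal ?\<alpha> * ennreal (f x)" using \<alpha> by (rule ennreal_mult')
      then show "ennreal (?u x) = ennreal ?\<alpha> * (ennreal (f x) * indicator ?Q x)"
        by (cases "x \<in> ?Q") (simp_all only: indicator_simps mult_1_right mult_zero_right ennreal_0, simp)
    qed
    also have "\<dots> = ennreal (?\<alpha> * F J k)"
      unfolding ennreal_mult'[OF \<alpha>] by (subst nn_integral_cmult) (auto simp: ennreal_F)
    finally show ?thesis by (simp only: ratio_F[OF k])
  qed
  have iv: "(\<integral>\<^sup>+x. ennreal (?v x) \<partial>lborel) = ennreal (m J k)"
  proof -
    have "(\<integral>\<^sup>+x. ennreal (?v x) \<partial>lborel) = (\<integral>\<^sup>+x\<in>?Q. ennreal (m J k / ?V) \<partial>lborel)"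
      by (intro nn_integral_cong) (auto split: split_indicator)
    also have "\<dots> = ennreal (m J k / ?V) * ennreal ?V"
      by (subst nn_integral_cmult_indicator) (auto simp: emeasure_cell[OF k])
    also have "\<dots> = ennreal (m J k / ?V * ?V)"
      using V by (intro ennreal_mult''[symmetric]) simp
    finally show ?thesis using V by simp
  qed
  have F_le: "F J k \<le> (f x + \<kappa> * (1 / 2 ^ J) powr s) * ?V" if x: "x \<in> ?Q" for x
  proof -
    have "ennreal (F J k) \<le> (\<integral>\<^sup>+x'. ennreal (f x + \<kappa> * (1 / 2 ^ J) powr s) * indicator ?Q x' \<partial>lborel)"
      unfolding ennreal_F[symmetric]
    proof (intro nn_integral_mono)
      fix y
      show "ennreal (f y) * indicator ?Q y \<le> ennreal (f x + \<kappa> * (1 / 2 ^ J) powr s) * indicator ?Q y"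
        using osc[OF x, of y] by (auto split: split_indicator intro!: ennreal_leI)
    qed
    also have "\<dots> = ennreal ((f x + \<kappa> * (1 / 2 ^ J) powr s) * ?V)"
      using f0[of x] \<kappa> by (simp add: nn_integral_cmult_indicator emeasure_cell[OF k] ennreal_mult)
    finally show ?thesis using f0[of x] \<kappa> by (subst (asm) ennreal_le_iff) auto
  qed
  have vu: "?v x - ?u x \<le> ?\<alpha> * (\<kappa> * (1 / 2 ^ J) powr s) * indicator ?Q x" for x
  proof (cases "x \<in> ?Q")
    case True
    have "m J k / ?V - ?\<alpha> * f x = ?\<alpha> * (F J k / ?V - f x)"
      using ratio_F[OF k] by (simp add: right_diff_distrib)
    also have "\<dots> \<le> ?\<alpha> * (\<kappa> * (1 / 2 ^ J) powr s)"
      using F_le[OF True] V by (intro mult_left_mono \<alpha>) (simp add: pos_divide_le_eq diff_le_eq add.commute)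
    finally show ?thesis using True by simp
  qed simp
  have "transportable p (density lborel (\<lambda>x. ennreal (?u x))) (density lborel (\<lambda>x. ennreal (?v x)))
     (ennreal ((CARD('d) / 2 ^ J) powr p) * (\<integral>\<^sup>+x. ennreal (?v x - ?u x) \<partial>lborel))"
  proof (rule transportable_tv[where Q="?Q"])
    show "norm (x - y) \<le> real CARD('d) / 2 ^ J" if "x \<in> ?Q" "y \<in> ?Q" for x y
      using ccube_diam[of x "corner J k" "1 / 2 ^ J" y] that cell_subset_ccube by auto
    show "0 \<le> ?u x" "0 \<le> ?v x" for x
      using m0[of J k] F0[of J k] f0[of x] by (auto intro!: mult_nonneg_nonneg divide_nonneg_nonneg split: split_indicator)
    show "(\<integral>\<^sup>+x. ennreal (?u x) \<partial>lborel) = (\<integral>\<^sup>+x. ennreal (?v x) \<partial>lborel)" by (simp only: iu iv)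
    show "(\<integral>\<^sup>+x. ennreal (?v x) \<partial>lborel) < \<infinity>" by (simp only: iv) simp
  qed (use p in auto)
  moreover have "(\<integral>\<^sup>+x. ennreal (?v x - ?u x) \<partial>lborel) \<le> ennreal (\<kappa> * (1 / 2 ^ J) powr s * (?\<alpha> * ?V))"
  proof -
    have "(\<integral>\<^sup>+x. ennreal (?v x - ?u x) \<partial>lborel) \<le> (\<integral>\<^sup>+x\<in>?Q. ennreal (?\<alpha> * (\<kappa> * (1 / 2 ^ J) powr s)) \<partial>lborel)"
    proof (intro nn_integral_mono)
      fix x
      have "ennreal (?v x - ?u x) \<le> ennreal (?\<alpha> * (\<kappa> * (1 / 2 ^ J) powr s) * indicator ?Q x)"
        by (rule ennreal_leI[OF vu])
      then show "ennreal (?v x - ?u x) \<le> ennreal (?\<alpha> * (\<kappa> * (1 / 2 ^ J) powr s)) * indicator ?Q x"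
        by (cases "x \<in> ?Q") simp_all
    qed
    also have "\<dots> = ennreal (?\<alpha> * (\<kappa> * (1 / 2 ^ J) powr s)) * ennreal ?V"
      by (subst nn_integral_cmult_indicator) (auto simp: emeasure_cell[OF k])
    also have "\<dots> = ennreal (?\<alpha> * (\<kappa> * (1 / 2 ^ J) powr s) * ?V)"
      using V by (intro ennreal_mult''[symmetric]) simp
    finally show ?thesis by (simp add: ac_simps)
  qed
  then have "ennreal ((CARD('d) / 2 ^ J) powr p) * (\<integral>\<^sup>+x. ennreal (?v x - ?u x) \<partial>lborel)
     \<le> ennreal ((CARD('d) / 2 ^ J) powr p * (\<kappa> * (1 / 2 ^ J) powr s * (?\<alpha> * ?V)))"
    by (simp only: ennreal_mult'[OF powr_ge_zero]) (rule mult_left_mono, auto)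
  ultimately show ?thesis unfolding u v by (rule transportable_mono)
qed

lemma transportable_hist:
  "transportable p (cube_density (\<lambda>x. ratio J x * f x)) (cube_density (hist J))
    (ennreal ((CARD('d) / 2 ^ J) powr p * (\<kappa> * (1 / 2 ^ J) powr s * (\<Sum>k\<in>indices J. m J k / F J k * (1 / 2 ^ J) ^ CARD('d)))))"
proof -
  have [measurable]: "hist J \<in> borel_measurable borel" unfolding hist_def by measurable
  let ?c = "\<lambda>k. (CARD('d) / 2 ^ J) powr p * (\<kappa> * (1 / 2 ^ J) powr s * (m J k / F J k * (1 / 2 ^ J) ^ CARD('d)))"
  have "transportable p (dens (\<lambda>x. ratio J x * f x) (\<Union>k\<in>indices J. cell J k))
    (dens (\<lambda>x. hist J x) (\<Union>k\<in>indices J. cell J k))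
    (\<Sum>k\<in>indices J. ennreal (?c k))"
    by (intro transportable_UN transportable_hist_cell) (auto simp: disjoint_cells)
  moreover have "(\<Sum>k\<in>indices J. ennreal (?c k)) = ennreal (\<Sum>k\<in>indices J. ?c k)"
    using m0 F0 \<kappa> by (intro sum_ennreal) (auto intro!: mult_nonneg_nonneg divide_nonneg_nonneg)
  ultimately show ?thesis
    by (simp add: Union_cells sum_distrib_left)
qed

definition sq_dev :: "nat \<Rightarrow> ('d \<Rightarrow> nat) \<Rightarrow> real"
  where "sq_dev j k = (m j k - F j k)\<^sup>2 + (\<Sum>k'\<in>children k. (m (Suc j) k' - F (Suc j) k')\<^sup>2)"

lemma dev_sq_le: "(dev j k)\<^sup>2 \<le> (1 + 2 ^ CARD('d)) * sq_dev j k"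
proof -
  \<comment> \<open>The cell and its children as one index set, the cell being \<open>None\<close>,
    for a single use of the Cauchy-Schwarz inequality.\<close>
  let ?I = "insert None (Some ` children k)"
  let ?a = "\<lambda>x. case x of None \<Rightarrow> \<bar>m j k - F j k\<bar> | Some k' \<Rightarrow> \<bar>m (Suc j) k' - F (Suc j) k'\<bar>"
  have "dev j k = (\<Sum>x\<in>?I. ?a x)"
    by (simp add: dev_def sum.reindex)
  moreover have "(\<Sum>x\<in>?I. ?a x)\<^sup>2 \<le> (\<Sum>x\<in>?I. (?a x)\<^sup>2) * card ?I"
    using Cauchy_Schwarz_ineq_sum[of ?a "\<lambda>_. 1" ?I] by simp
  moreover have "(\<Sum>x\<in>?I. (?a x)\<^sup>2) = sq_dev j k"
    by (simp add: sq_dev_def sum.reindex)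
  moreover have "real (card ?I) = 1 + 2 ^ CARD('d)"
    by (subst card_insert_disjoint) (auto simp: card_image card_children)
  ultimately show ?thesis by (simp only: mult.commute)
qed

lemma cell_cost_le:
  assumes "0 < t"
  shows "cell_cost j t k \<le> t + coef j t k * sq_dev j k"
proof (cases "good j k")
  case True
  have "2 * (72 * 2 ^ CARD('d))\<^sup>2 * (dev j k)\<^sup>2 / F j k \<le> 2 * (72 * 2 ^ CARD('d))\<^sup>2 * ((1 + 2 ^ CARD('d)) * sq_dev j k) / F j k"
    using F0[of j k] by (intro divide_right_mono mult_left_mono dev_sq_le) auto
  also have "\<dots> = coef j t k * sq_dev j k" using True by (simp add: coef_def)
  finally show ?thesis using True assms by (simp add: cell_cost_def)
next
  case False
  have "(dev j k)\<^sup>2 / t \<le> ((1 + 2 ^ CARD('d)) * sq_dev j k) / t"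
    using assms by (intro divide_right_mono dev_sq_le) auto
  then show ?thesis using False assms by (simp add: cell_cost_def coef_def)
qed

text \<open>Indices below \<open>J\<close> are refinement steps; the index \<open>J\<close> itself
  is the passage from the last reweighted density to the histogram.\<close>

definition level_cost :: "nat \<Rightarrow> (nat \<Rightarrow> real) \<Rightarrow> nat \<Rightarrow> real"
  where "level_cost J t j = (CARD('d) / 2 ^ j) powr p *
    (if j < J then (\<Sum>k\<in>indices j. t j + coef j (t j) k * sq_dev j k)
     else \<kappa> * (1 / 2 ^ J) powr s * (\<Sum>k\<in>indices J. m J k / F J k * (1 / 2 ^ J) ^ CARD('d)))"

lemma sq_dev_nonneg: "0 \<le> sq_dev j k" unfolding sq_dev_def by (intro add_nonneg_nonneg sum_nonneg) auto

lemma level_cost_nonneg: "(\<And>j. 0 < t j) \<Longrightarrow> 0 \<le> level_cost J t j"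
  unfolding level_cost_def using m0 F0 \<kappa> coef_nonneg sq_dev_nonneg
  by (auto intro!: mult_nonneg_nonneg sum_nonneg add_nonneg_nonneg divide_nonneg_nonneg intro: less_imp_le)

lemma transportable_histogram:
  assumes t: "\<And>j. 0 < t j" and w: "\<And>j. 0 < w j"
  shows "transportable p (cube_density f) (cube_density (hist J))
    (ennreal ((\<Sum>j\<le>J. w j) powr (p - 1) * (\<Sum>j\<le>J. level_cost J t j / w j powr (p - 1))))"
proof -
  \<comment> \<open>A chain of \<open>J + 1\<close> steps: the histogram has position
    \<open>Suc J\<close>.\<close>
  define g where "g j = (if j \<le> J then cube_density (\<lambda>x. ratio j x * f x) else cube_density (hist J))" for j
  have "transportable p (g 0) (g (Suc J)) (ennreal ((\<Sum>j<Suc J. w j) powr (p - 1) * (\<Sum>j<Suc J. level_cost J t j / w j powr (p - 1))))"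
  proof (rule transportable_chain)
    fix j assume j: "j < Suc J"
    show "transportable p (g j) (g (Suc j)) (ennreal (level_cost J t j))"
    proof (cases "j < J")
      case True
      have "(CARD('d) / 2 ^ j) powr p * (\<Sum>k\<in>indices j. cell_cost j (t j) k) \<le> level_cost J t j"
        unfolding level_cost_def using True t by (auto intro!: mult_left_mono sum_mono cell_cost_le)
      then have "transportable p (cube_density (\<lambda>x. ratio j x * f x)) (cube_density (\<lambda>x. ratio (Suc j) x * f x))
          (ennreal (level_cost J t j))"
        by (intro transportable_mono[OF transportable_level[OF t] ennreal_leI])
      then show ?thesis using True by (simp add: g_def)
    next
      case False
      then have "j = J" using j by simp
      then show ?thesis using transportable_hist by (simp add: g_def level_cost_def)
    qed
  qed (use p w level_cost_nonneg[OF t] in \<open>auto simp: g_def\<close>)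
  moreover have "g 0 = cube_density f"
  proof -
    have cube: "cell 0 (\<lambda>_. 0) = (unit_cube :: (real ^ 'd) set)"
      using Union_cells[of 0] by (simp add: indices_0)
    have "F 0 (\<lambda>_. 0) = 1" using ennreal_F[of 0 "\<lambda>_. 0"] f_int by (simp add: cube)
    then have "ratio 0 x = 1" if "x \<in> unit_cube" for x
      unfolding ratio_def using that cube m_root step_fun_eq[of "\<lambda>_. 0" 0 x] by (simp add: indices_0)
    then show ?thesis unfolding g_def
      by simp (intro arg_cong[where f="density lborel"] ext, auto split: split_indicator)
  qed
  ultimately show ?thesis by (simp add: g_def lessThan_Suc_atMost)
qed

end

section \<open>Empirical frequencies\<close>

context prob_space
begin

lemma integral_PiM_component:
  fixes g :: "'a \<Rightarrow> real"
  assumes [measurable]: "g \<in> borel_measurable M" and "i \<in> I"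
  shows "(\<integral>X. g (X i) \<partial>(\<Pi>\<^sub>M i\<in>I. M)) = (\<integral>x. g x \<partial>M)"
proof -
  have "(\<integral>x. g x \<partial>M) = (\<integral>x. g x \<partial>distr (\<Pi>\<^sub>M i\<in>I. M) M (\<lambda>X. X i))"
    using assms(2) prob_space_axioms by (subst distr_PiM_component) auto
  also have "\<dots> = (\<integral>X. g (X i) \<partial>(\<Pi>\<^sub>M i\<in>I. M))"
    using assms(2) by (subst integral_distr) auto
  finally show ?thesis ..
qed

text \<open>Centred indicators of independent observations are orthogonal, so only the
  \<open>n\<close> diagonal terms remain, each a Bernoulli variance and hence at most
  \<open>prob B\<close>.\<close>

lemma empirical_second_moment:
  assumes B[measurable]: "B \<in> sets M" and n: "0 < n"
  shows "(\<integral>\<^sup>+X. ennreal (((\<Sum>i<n. indicator B (X i)) / real n - prob B)\<^sup>2) \<partial>(\<Pi>\<^sub>M i\<in>{..<n}. M)) \<le> ennreal (prob B / real n)"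
proof -
  define q where "q = prob B"
  define Y where "Y x = indicator B x - q" for x
  have q: "0 \<le> q" "q \<le> 1" by (auto simp: q_def)
  have Ym[measurable]: "Y \<in> borel_measurable M" unfolding Y_def by measurable
  have Yb: "\<bar>Y x\<bar> \<le> 1" for x using q by (auto simp: Y_def split: split_indicator)
  let ?P = "\<Pi>\<^sub>M i\<in>{..<n}. M"
  interpret P: product_prob_space "\<lambda>_. M" "{..<n}" by unfold_locales
  have fm: "finite_measure ?P"
    by (intro prob_space.finite_measure prob_space_PiM prob_space_axioms)
  have Bi: "integrable M (indicat_real B)"
    by (rule integrable_const_bound[where B=1]) auto
  have Yi: "integrable M Y" by (rule integrable_const_bound[where B=1]) (use Yb in auto)
  have EY: "(\<integral>x. Y x \<partial>M) = 0"
  proof -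
    have "(\<integral>x. Y x \<partial>M) = (\<integral>x. indicator B x \<partial>M) - (\<integral>x. q \<partial>M)"
      unfolding Y_def by (intro Bochner_Integration.integral_diff Bi) auto
    then show ?thesis by (simp add: q_def prob_space)
  qed
  have EY2: "(\<integral>x. Y x * Y x \<partial>M) \<le> q"
  proof -
    have "(\<integral>x. Y x * Y x \<partial>M) = (\<integral>x. (1 - 2 * q) * indicator B x + q * q \<partial>M)"
      by (intro Bochner_Integration.integral_cong) (auto simp: Y_def algebra_simps split: split_indicator)
    also have "\<dots> = (1 - 2 * q) * q + q * q"
      by (subst Bochner_Integration.integral_add) (auto simp: q_def prob_space Bi)
    also have "\<dots> \<le> q" using q by (simp add: algebra_simps)
    finally show ?thesis .
  qed
  have Yc[measurable]: "(\<lambda>X. Y (X i)) \<in> borel_measurable ?P" if "i < n" for i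
    using that by (intro measurable_compose[OF measurable_component_singleton[of i "{..<n}" "\<lambda>_. M"] Ym]) simp
  have int: "integrable ?P (\<lambda>X. Y (X i) * Y (X j))" if "i < n" "j < n" for i j
  proof (rule finite_measure.integrable_const_bound[OF fm, where B=1])
    have "\<bar>Y (X i)\<bar> * \<bar>Y (X j)\<bar> \<le> 1" for X
      using mult_mono[OF Yb[of "X i"] Yb[of "X j"]] by simp
    then show "AE X in ?P. norm (Y (X i) * Y (X j)) \<le> 1" by (simp add: abs_mult)
  qed (use that in auto)
  have cross: "(\<integral>X. Y (X i) * Y (X j) \<partial>?P) = 0" if ij: "i < n" "j < n" "i \<noteq> j" for i j
  proof -
    \<comment> \<open>Factors 1 in the other coordinates extend the product of two variables to one
      over the whole sample, to which the product formula applies.\<close>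
    let ?g = "\<lambda>l x. if l \<in> {i, j} then Y x else 1"
    have "(\<Prod>l\<in>{..<n}. ?g l (X l)) = Y (X i) * Y (X j)" for X
      using ij prod.inter_restrict[of "{..<n}" "\<lambda>l. Y (X l)" "{i, j}"] by (simp add: Int_absorb1)
    then have "(\<integral>X. Y (X i) * Y (X j) \<partial>?P) = (\<integral>X. (\<Prod>l\<in>{..<n}. ?g l (X l)) \<partial>?P)" by simp
    also have "\<dots> = (\<Prod>l\<in>{..<n}. \<integral>x. ?g l x \<partial>M)"
    proof (rule P.product_integral_prod)
      show "integrable M (?g l)" for l by (cases "l \<in> {i, j}") (simp_all add: Yi)
    qed simp
    also have "\<dots> = 0" using ij EY by (intro prod_zero) (auto intro!: bexI[of _ i])
    finally show ?thesis .
  qed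
  have diag: "(\<integral>X. Y (X i) * Y (X i) \<partial>?P) \<le> q" if "i < n" for i
    using integral_PiM_component[of "\<lambda>x. Y x * Y x" i "{..<n}"] EY2 that by simp
  have eq: "((\<Sum>i<n. indicator B (X i)) / real n - q)\<^sup>2 = (\<Sum>i<n. \<Sum>j<n. Y (X i) * Y (X j)) / (real n)\<^sup>2" for X
  proof -
    have "(\<Sum>i<n. indicator B (X i)) / real n - q = (\<Sum>i<n. Y (X i)) / real n"
      using n by (simp add: Y_def sum_subtractf diff_divide_distrib)
    then show ?thesis by (simp add: power_divide power2_eq_square sum_product)
  qed
  have "(\<integral>X. (\<Sum>i<n. \<Sum>j<n. Y (X i) * Y (X j)) \<partial>?P) = (\<Sum>i<n. \<Sum>j<n. \<integral>X. Y (X i) * Y (X j) \<partial>?P)"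
    using int by (subst Bochner_Integration.integral_sum; (intro sum.cong refl Bochner_Integration.integral_sum Bochner_Integration.integrable_sum)?) auto
  also have "\<dots> = (\<Sum>i<n. \<integral>X. Y (X i) * Y (X i) \<partial>?P)"
  proof (intro sum.cong refl)
    fix i assume "i \<in> {..<n}"
    then have "(\<Sum>j<n. \<integral>X. Y (X i) * Y (X j) \<partial>?P) = (\<Sum>j<n. if j = i then \<integral>X. Y (X i) * Y (X i) \<partial>?P else 0)"
      by (intro sum.cong) (auto simp: cross)
    then show "(\<Sum>j<n. \<integral>X. Y (X i) * Y (X j) \<partial>?P) = (\<integral>X. Y (X i) * Y (X i) \<partial>?P)"
      using \<open>i \<in> {..<n}\<close> by simp
  qed
  also have "\<dots> \<le> (\<Sum>i<n. q)" by (intro sum_mono diag) auto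
  finally have le: "(\<integral>X. (\<Sum>i<n. \<Sum>j<n. Y (X i) * Y (X j)) \<partial>?P) \<le> real n * q" by simp
  have "(\<integral>\<^sup>+X. ennreal (((\<Sum>i<n. indicator B (X i)) / real n - q)\<^sup>2) \<partial>?P)
     = ennreal (\<integral>X. ((\<Sum>i<n. indicator B (X i)) / real n - q)\<^sup>2 \<partial>?P)"
  proof (rule nn_integral_eq_integral)
    show "integrable ?P (\<lambda>X. ((\<Sum>i<n. indicator B (X i)) / real n - q)\<^sup>2)"
      unfolding eq using int by (intro integrable_divide Bochner_Integration.integrable_sum) auto
  qed simp
  also have "(\<integral>X. ((\<Sum>i<n. indicator B (X i)) / real n - q)\<^sup>2 \<partial>?P) \<le> q / real n"
    using le n unfolding eq by (simp add: power2_eq_square field_simps)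
  finally show ?thesis by (simp add: q_def ennreal_leI)
qed

lemma empirical_mean:
  assumes B[measurable]: "B \<in> sets M" and n: "0 < n"
  shows "(\<integral>\<^sup>+X. ennreal ((\<Sum>i<n. indicator B (X i)) / real n) \<partial>(\<Pi>\<^sub>M i\<in>{..<n}. M)) = ennreal (prob B)"
proof -
  let ?P = "\<Pi>\<^sub>M i\<in>{..<n}. M"
  have fm: "finite_measure ?P"
    by (intro prob_space.finite_measure prob_space_PiM prob_space_axioms)
  have [measurable]: "(\<lambda>X. indicator B (X i) :: real) \<in> borel_measurable ?P" if "i < n" for i
    using that by (intro measurable_compose[OF measurable_component_singleton[of i "{..<n}" "\<lambda>_. M"] borel_measurable_indicator]) auto
  have int: "integrable ?P (\<lambda>X. indicator B (X i) :: real)" if "i < n" for i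
    by (rule finite_measure.integrable_const_bound[OF fm, where B=1]) (use that in auto)
  have "(\<integral>\<^sup>+X. ennreal ((\<Sum>i<n. indicator B (X i)) / real n) \<partial>?P) = ennreal (\<integral>X. (\<Sum>i<n. indicator B (X i)) / real n \<partial>?P)"
    using int by (intro nn_integral_eq_integral) (auto intro!: Bochner_Integration.integrable_sum divide_nonneg_nonneg sum_nonneg)
  also have "(\<integral>X. (\<Sum>i<n. indicator B (X i)) / real n \<partial>?P) = (\<Sum>i<n. \<integral>X. indicator B (X i) \<partial>?P) / real n"
    using int by (simp add: Bochner_Integration.integral_sum)
  also have "\<dots> = (\<Sum>i<n. prob B) / real n"
    by (intro arg_cong2[where f="(/)"] sum.cong refl) (subst integral_PiM_component, auto)
  finally show ?thesis using n by simp
qed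

end

section \<open>The estimator\<close>

text \<open>For an empty sample the volumes replace the frequencies, so that the histogram is the
  uniform density and remains an estimator for \<open>n = 0\<close>.\<close>

definition empirical :: "nat \<Rightarrow> (nat \<Rightarrow> real ^ 'd) \<Rightarrow> nat \<Rightarrow> ('d \<Rightarrow> nat) \<Rightarrow> real"
  where "empirical n X j k =
    (if n = 0 then (1 / 2 ^ j) ^ CARD('d) else (\<Sum>i<n. indicator (cell j k) (X i)) / real n)"

definition histogram :: "nat \<Rightarrow> nat \<Rightarrow> (nat \<Rightarrow> real ^ 'd) \<Rightarrow> real ^ 'd \<Rightarrow> real"
  where "histogram n J X = step_fun J (\<lambda>k. empirical n X J k * (2 ^ J) ^ CARD('d))"

lemma empirical_nonneg: "0 \<le> empirical n X j k"
  unfolding empirical_def by (auto intro!: divide_nonneg_nonneg sum_nonneg)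

lemma sum_empirical:
  fixes X :: "nat \<Rightarrow> real ^ 'd"
  assumes "X \<in> {..<n} \<rightarrow>\<^sub>E unit_cube"
  shows "(\<Sum>k\<in>indices J. empirical n X J k) = 1"
proof (cases "n = 0")
  case True
  then show ?thesis by (simp add: empirical_def card_indices power_one_over)
next
  case False
  have 1: "(\<Sum>k\<in>indices J. indicator (cell J k) (X i)) = (1 :: real)" if "i < n" for i
  proof -
    have "X i \<in> unit_cube" using assms that by (auto simp: PiE_iff)
    then show ?thesis
      unfolding indicator_UN_disjoint[OF finite_indices disjoint_cells, symmetric] Union_cells by simp
  qed
  have "(\<Sum>k\<in>indices J. empirical n X J k) = (\<Sum>k\<in>indices J. \<Sum>i<n. indicator (cell J k) (X i)) / n"
    using False by (simp add: empirical_def sum_divide_distrib)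
  also have "\<dots> = (\<Sum>i<n. \<Sum>k\<in>indices J. indicator (cell J k) (X i)) / n"
    by (subst sum.swap) simp
  also have "\<dots> = 1" using False by (simp add: 1)
  finally show ?thesis .
qed

lemma empirical_Suc:
  assumes "0 < n"
  shows "empirical n X j k = (\<Sum>k'\<in>children k. empirical n X (Suc j) k')"
proof -
  have "indicator (cell j k) x = (\<Sum>k'\<in>children k. indicator (cell (Suc j) k') x :: real)" for x
    unfolding cell_Suc[of j k] by (rule indicator_UN_disjoint[OF finite_children disjoint_cells])
  then have "(\<Sum>i<n. indicator (cell j k) (X i)) = (\<Sum>k'\<in>children k. \<Sum>i<n. indicator (cell (Suc j) k') (X i) :: real)"
    by (subst sum.swap) simp
  then show ?thesis using assms by (simp add: empirical_def sum_divide_distrib)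
qed

lemma cell_in_cube_measure: "cell j k \<in> sets cube_measure"
  using cell_measurable[of j k] by (auto simp: sets_restrict_space_iff cell_def)

lemma prob_density_histogram:
  fixes X :: "nat \<Rightarrow> real ^ 'd"
  assumes X: "X \<in> {..<n} \<rightarrow>\<^sub>E unit_cube"
  shows "prob_density_on_cube (histogram n J X)"
  unfolding prob_density_on_cube_def
proof (intro conjI ballI)
  show "histogram n J X \<in> borel_measurable cube_measure"
    unfolding histogram_def by (intro measurable_restrict_space1) measurable
  show "0 \<le> histogram n J X x" for x
    unfolding histogram_def by (intro step_fun_nonneg mult_nonneg_nonneg empirical_nonneg) auto
  let ?c = "\<lambda>k. empirical n X J k * (2 ^ J) ^ CARD('d)"
  have c0: "0 \<le> ?c k" for k by (intro mult_nonneg_nonneg empirical_nonneg) auto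
  have "(\<integral>\<^sup>+x. ennreal (histogram n J X x) \<partial>cube_measure) = (\<integral>\<^sup>+x. (\<Sum>k\<in>indices J. ennreal (?c k) * indicator (cell J k) x) \<partial>lborel)"
  proof -
    have pt: "ennreal (histogram n J X x) * indicator unit_cube x = (\<Sum>k\<in>indices J. ennreal (?c k) * indicator (cell J k) x)" for x
    proof (cases "x \<in> unit_cube")
      case True
      have "ennreal (histogram n J X x) = (\<Sum>k\<in>indices J. ennreal (?c k * indicator (cell J k) x))"
        unfolding histogram_def step_fun_def using c0 by (intro sum_ennreal[symmetric]) auto
      also have "\<dots> = (\<Sum>k\<in>indices J. ennreal (?c k) * indicator (cell J k) x)"
        by (intro sum.cong refl) (auto split: split_indicator)
      finally show ?thesis using True by simp
    next
      case False
      then show ?thesis by (auto simp: cell_def)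
    qed
    show ?thesis unfolding pt[symmetric] by (rule nn_integral_restrict_space) simp
  qed
  also have "\<dots> = (\<Sum>k\<in>indices J. ennreal (?c k) * ennreal ((1 / 2 ^ J) ^ CARD('d)))"
    by (subst nn_integral_sum) (auto simp: nn_integral_cmult_indicator emeasure_cell)
  also have "\<dots> = (\<Sum>k\<in>indices J. ennreal (empirical n X J k))"
    using c0 by (intro sum.cong refl) (simp add: power_one_over flip: ennreal_mult)
  also have "\<dots> = 1"
    using sum_empirical[OF X, of J] by (simp add: sum_ennreal empirical_nonneg)
  finally show "(\<integral>\<^sup>+x. ennreal (histogram n J X x) \<partial>cube_measure) = 1" .
qed

lemma empirical_measurable [measurable]:
  "(\<lambda>X. empirical n X j k) \<in> borel_measurable (\<Pi>\<^sub>M i\<in>{..<n}. cube_measure)"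
proof -
  have "(\<lambda>X. indicator (cell j k) (X i) :: real) \<in> borel_measurable (\<Pi>\<^sub>M i\<in>{..<n}. cube_measure)" if "i \<in> {..<n}" for i
    by (rule measurable_compose[OF measurable_component_singleton[OF that] borel_measurable_indicator[OF cell_in_cube_measure]])
  then show ?thesis
    unfolding empirical_def by (cases "n = 0") (auto intro!: borel_measurable_divide borel_measurable_sum)
qed

lemma cell_nonempty: "k \<in> indices j \<Longrightarrow> cell j k \<noteq> ({} :: (real ^ 'd) set)"
  using emeasure_cell[of k j] by auto

lemma histogram_estimator_histogram:
  "histogram_estimator n (histogram n J :: (nat \<Rightarrow> real ^ 'd) \<Rightarrow> real ^ 'd \<Rightarrow> real)"
  unfolding histogram_estimator_def
proof (intro conjI ballI)
  have "(\<lambda>z. indicator (cell J k) (snd z) :: real) \<in> borel_measurable ((\<Pi>\<^sub>M i\<in>{..<n}. cube_measure) \<Otimes>\<^sub>M cube_measure)" for k :: "'d \<Rightarrow> nat"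
    by (rule measurable_compose[OF measurable_snd borel_measurable_indicator[OF cell_in_cube_measure]])
  moreover have "(\<lambda>z. empirical n (fst z) J k) \<in> borel_measurable ((\<Pi>\<^sub>M i\<in>{..<n}. cube_measure) \<Otimes>\<^sub>M cube_measure)" for k :: "'d \<Rightarrow> nat"
    by (rule measurable_compose[OF measurable_fst empirical_measurable])
  ultimately show "(\<lambda>(X, x). histogram n J X x) \<in> borel_measurable ((\<Pi>\<^sub>M i\<in>{..<n}. cube_measure) \<Otimes>\<^sub>M (cube_measure :: (real ^ 'd) measure))"
    unfolding histogram_def step_fun_def case_prod_beta'
    by (intro borel_measurable_sum borel_measurable_times) auto
  show "prob_density_on_cube (histogram n J X)" if "X \<in> {..<n} \<rightarrow>\<^sub>E unit_cube" for X :: "nat \<Rightarrow> real ^ 'd"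
    by (rule prob_density_histogram[OF that])
  let ?P = "cell J ` indices J :: (real ^ 'd) set set"
  show "\<exists>P. finite P \<and> partition_on (unit_cube :: (real ^ 'd) set) P \<and> (\<forall>Q\<in>P. is_cube Q) \<and>
    (\<forall>X\<in>{..<n} \<rightarrow>\<^sub>E unit_cube. \<forall>Q\<in>P. histogram n J X constant_on Q)"
  proof (intro exI[of _ ?P] conjI ballI)
    show "partition_on unit_cube ?P"
    proof (rule partition_onI)
      show "\<Union>?P = unit_cube" by (simp add: Union_cells)
      show "disjnt p q" if "p \<in> ?P" "q \<in> ?P" "p \<noteq> q" for p q
        using that by (auto simp: disjnt_def cell_def)
      show "{} \<notin> ?P" using cell_nonempty by (metis (no_types) imageE)
    qed
    show "is_cube Q" if "Q \<in> ?P" for Q using that is_cube_cell by auto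
    show "histogram n J X constant_on Q" if "Q \<in> ?P" for X Q
      using that unfolding constant_on_def histogram_def by (auto simp: step_fun_eq)
  qed simp
qed

lemma space_sample_measure: "space (sample_measure n f) = {..<n} \<rightarrow>\<^sub>E unit_cube"
  by (simp add: sample_measure_def space_PiM density_measure_def space_restrict_space)

lemma sets_sample_measure [measurable_cong]: "sets (sample_measure n f) = sets (\<Pi>\<^sub>M i\<in>{..<n}. cube_measure)"
  unfolding sample_measure_def by (intro sets_PiM_cong) (auto simp: density_measure_def)

text \<open>The histogram, hence its Wasserstein distance to anything, depends on the sample only through
  the finitely many possible lists of cells that the observations fall into.\<close>

lemma wasserstein_histogram_measurable:
  fixes f :: "real ^ 'd \<Rightarrow> real" and \<Phi> :: "(real ^ 'd \<Rightarrow> real) \<Rightarrow> ennreal"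
  shows "(\<lambda>X. \<Phi> (histogram n J X)) \<in> borel_measurable (sample_measure n f)"
proof -
  let ?M = "sample_measure n f"
  define A where "A = ({..<n} \<rightarrow>\<^sub>E indices J :: (nat \<Rightarrow> 'd \<Rightarrow> nat) set)"
  define I where "I X = (\<lambda>i\<in>{..<n}. cell_index J (X i))" for X :: "nat \<Rightarrow> real ^ 'd"
  \<comment> \<open>The same histogram, computed from the list \<open>a\<close> of cell indices
    instead of the observations.\<close>
  define G where "G a = \<Phi> (step_fun J (\<lambda>k. (if n = 0 then (1 / 2 ^ J) ^ CARD('d)
     else (\<Sum>i<n. of_bool (a i = k)) / real n) * (2 ^ J) ^ CARD('d)))" for a
  have A: "finite A" unfolding A_def by (intro finite_PiE) auto
  have cube: "X i \<in> unit_cube" if "X \<in> space ?M" "i < n" for X i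
    using that unfolding space_sample_measure by auto
  have eq: "\<Phi> (histogram n J X) = G (I X)" if "X \<in> space ?M" for X
  proof -
    have ind: "indicator (cell J k) (X i) = (of_bool (I X i = k) :: real)" if "i < n" for i k
      using cube[OF \<open>X \<in> space ?M\<close> that] that by (auto simp: cell_def I_def split: split_indicator)
    have "empirical n X J k = (if n = 0 then (1 / 2 ^ J) ^ CARD('d) else (\<Sum>i<n. of_bool (I X i = k)) / real n)" for k
      unfolding empirical_def by (auto simp: ind)
    then show ?thesis unfolding G_def histogram_def by simp
  qed
  have "I \<in> measurable ?M (count_space A)"
    unfolding measurable_count_space_eq2[OF A]
  proof (intro conjI ballI)
    show "I \<in> space ?M \<rightarrow> A"
    proof (rule Pi_I)
      fix X assume "X \<in> space ?M"
      then show "I X \<in> A"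
        unfolding I_def A_def restrict_PiE_iff by (intro ballI cell_index_in cube) auto
    qed
    fix a assume "a \<in> A"
    then have ext: "a \<in> extensional {..<n}" by (auto simp: A_def PiE_def)
    have iff: "I X = a \<longleftrightarrow> (\<forall>i\<in>{..<n}. cell_index J (X i) = a i)" for X
    proof
      assume "\<forall>i\<in>{..<n}. cell_index J (X i) = a i"
      then show "I X = a"
        unfolding I_def by (intro extensionalityI[OF restrict_extensional ext]) simp
    qed (auto simp: I_def)
    have "I -` {a} \<inter> space ?M = (\<Pi>\<^sub>E i\<in>{..<n}. cell J (a i))"
    proof (intro set_eqI iffI)
      fix X assume "X \<in> I -` {a} \<inter> space ?M"
      then have X: "X \<in> space ?M" and Ia: "I X = a" by auto
      show "X \<in> (\<Pi>\<^sub>E i\<in>{..<n}. cell J (a i))"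
      proof (rule PiE_I)
        show "X i \<in> cell J (a i)" if "i \<in> {..<n}" for i
          using cube[OF X, of i] Ia that unfolding iff cell_def by simp
        show "X i = undefined" if "i \<notin> {..<n}" for i
          using X that unfolding space_sample_measure by (rule PiE_arb)
      qed
    next
      fix X assume X: "X \<in> (\<Pi>\<^sub>E i\<in>{..<n}. cell J (a i))"
      then have "I X = a" unfolding iff using PiE_mem[OF X] by (simp add: cell_def)
      moreover have "X \<in> space ?M"
        unfolding space_sample_measure using X by (rule PiE_mono[THEN subsetD, rotated]) (simp add: cell_def)
      ultimately show "X \<in> I -` {a} \<inter> space ?M" by simp
    qed
    also have "\<dots> \<in> sets ?M"
      unfolding sets_sample_measure by (intro sets_PiM_I_finite cell_in_cube_measure) simp
    finally show "I -` {a} \<inter> space ?M \<in> sets ?M" .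
  qed
  then have "(\<lambda>X. G (I X)) \<in> borel_measurable ?M"
    by (rule measurable_compose) simp
  then show ?thesis by (subst measurable_cong[OF eq])
qed

text \<open>Members of the class are arbitrary off the cube, hence the indicator. A cell has
  diameter at most \<open>CARD('d)\<close> times its side, and the power \<open>s\<close> of this
  factor is at most \<open>CARD('d)\<close>.\<close>

lemma holder_density_of_class:
  fixes f :: "real ^ 'd \<Rightarrow> real"
  assumes f: "f \<in> holder_class s L" and L: "0 < L" and s: "0 \<le> s" "s < 1" and p: "2 \<le> p"
  shows "holder_density (\<lambda>x. indicator unit_cube x * f x) p s (L * CARD('d))"
proof
  let ?f = "\<lambda>x. indicator unit_cube x * f x"
  let ?S1 = "SUP x\<in>unit_cube. ennreal \<bar>f x\<bar>"
  let ?T = "{(x, y). x \<in> unit_cube \<and> y \<in> unit_cube \<and> x \<noteq> y}"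
  let ?S2 = "SUP (x, y)\<in>?T. ennreal (\<bar>f x - f y\<bar> / norm (x - y) powr s)"
  have pd: "prob_density_on_cube f" and S: "?S1 + (if s = 0 then 0 else ?S2) \<le> ennreal L"
    using f by (auto simp: holder_class_def)
  have fm: "f \<in> borel_measurable cube_measure" and nn: "\<And>x. x \<in> unit_cube \<Longrightarrow> 0 \<le> f x"
    and int: "(\<integral>\<^sup>+x. ennreal (f x) \<partial>cube_measure) = 1"
    using pd by (auto simp: prob_density_on_cube_def)
  show "?f \<in> borel_measurable borel"
    using fm by (subst (asm) borel_measurable_restrict_space_iff) auto
  show "0 \<le> ?f x" for x using nn by (auto split: split_indicator)
  have "(\<integral>\<^sup>+x\<in>unit_cube. ennreal (?f x) \<partial>lborel) = (\<integral>\<^sup>+x\<in>unit_cube. ennreal (f x) \<partial>lborel)"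
    by (intro nn_integral_cong) (auto split: split_indicator)
  also have "\<dots> = 1" using int by (subst (asm) nn_integral_restrict_space) auto
  finally show "(\<integral>\<^sup>+x\<in>unit_cube. ennreal (?f x) \<partial>lborel) = 1" .
  have d: "1 \<le> real CARD('d)" by (simp add: Suc_le_eq)
  have fL: "f x \<le> L" if "x \<in> unit_cube" for x
  proof -
    have "ennreal \<bar>f x\<bar> \<le> ?S1" using that by (rule SUP_upper)
    also have "\<dots> \<le> ennreal L" using S by (rule order_trans[rotated]) simp
    finally show ?thesis using L by (simp add: ennreal_le_iff)
  qed
  fix j :: nat and k :: "'d \<Rightarrow> nat" and x y :: "real ^ 'd"
  assume x: "x \<in> cell j k" and y: "y \<in> cell j k"
  then have xy: "x \<in> unit_cube" "y \<in> unit_cube" by (auto simp: cell_def)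
  have "\<bar>f x - f y\<bar> \<le> L * CARD('d) * (1 / 2 ^ j) powr s"
  proof (cases "s = 0 \<or> x = y")
    case True
    \<comment> \<open>Two values in the interval from 0 to \<open>L\<close>; this is the whole bound
      when \<open>s = 0\<close>.\<close>
    have "\<bar>f x - f y\<bar> \<le> L" using fL[OF xy(1)] fL[OF xy(2)] nn[OF xy(1)] nn[OF xy(2)] by auto
    also have "\<dots> \<le> L * CARD('d)" using L d by simp
    finally show ?thesis using True L by auto
  next
    case False
    have "ennreal (\<bar>f x - f y\<bar> / norm (x - y) powr s) \<le> ?S2"
      using xy False by (intro SUP_upper2[of "(x, y)"]) auto
    also have "\<dots> \<le> ennreal L" using S False by (auto intro: order_trans[rotated])
    finally have "\<bar>f x - f y\<bar> / norm (x - y) powr s \<le> L" using L by (simp add: ennreal_le_iff)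
    then have "\<bar>f x - f y\<bar> \<le> L * norm (x - y) powr s"
      using False by (simp add: pos_divide_le_eq)
    also have "norm (x - y) powr s \<le> (CARD('d) * (1 / 2 ^ j)) powr s"
      using s ccube_diam[of x "corner j k" "1 / 2 ^ j" y] x y cell_subset_ccube[of j k]
      by (intro powr_mono2) auto
    also have "\<dots> = CARD('d) powr s * (1 / 2 ^ j) powr s"
      by (rule powr_mult)
    also have "real CARD('d) powr s \<le> CARD('d) powr 1"
      using s d by (intro powr_mono) auto
    finally show ?thesis using L by (simp add: mult_left_mono mult_right_mono)
  qed
  then show "\<bar>?f x - ?f y\<bar> \<le> L * CARD('d) * (1 / 2 ^ j) powr s" using xy by simp
qed (use L p in auto)

section \<open>Expected cost of the chain\<close>

context holder_density
begin

lemma prob_density: "prob_density_on_cube f"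
  unfolding prob_density_on_cube_def
proof (intro conjI ballI)
  show "f \<in> borel_measurable cube_measure" by (intro measurable_restrict_space1) simp
  show "(\<integral>\<^sup>+x. ennreal (f x) \<partial>cube_measure) = 1"
    using f_int by (subst nn_integral_restrict_space) auto
qed (rule f0)

lemma prob_space_density: "prob_space (density_measure f)"
proof
  have "emeasure (density_measure f) (space (density_measure f)) = (\<integral>\<^sup>+x. ennreal (f x) \<partial>cube_measure)"
    unfolding density_measure_def space_density
    by (subst emeasure_density)
      (auto intro!: nn_integral_cong measurable_restrict_space1 simp: sets_restrict_space_iff space_restrict_space)
  then show "emeasure (density_measure f) (space (density_measure f)) = 1"
    using prob_density by (simp add: prob_density_on_cube_def)
qed

lemma measure_cell: "measure (density_measure f) (cell j k) = F j k"
proof -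
  have "emeasure (density_measure f) (cell j k) = (\<integral>\<^sup>+x. ennreal (f x) * indicator (cell j k) x \<partial>cube_measure)"
    unfolding density_measure_def
    by (subst emeasure_density) (auto intro!: measurable_restrict_space1 cell_in_cube_measure)
  also have "\<dots> = (\<integral>\<^sup>+x. ennreal (f x) * indicator (cell j k) x * indicator unit_cube x \<partial>lborel)"
    by (subst nn_integral_restrict_space) auto
  also have "\<dots> = (\<integral>\<^sup>+x\<in>cell j k. ennreal (f x) \<partial>lborel)"
    using cell_sub[of j k] by (intro nn_integral_cong) (auto split: split_indicator)
  finally show ?thesis by (simp add: measure_def ennreal_F F0)
qed

lemma cell_sets: "cell j k \<in> sets (density_measure f)"
  by (simp add: density_measure_def cell_in_cube_measure)

lemma empirical_measurable' [measurable]: "(\<lambda>X. empirical n X j k) \<in> borel_measurable (sample_measure n f)"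
  by measurable

lemma empirical_variance:
  "0 < n \<Longrightarrow> (\<integral>\<^sup>+X. ennreal ((empirical n X j k - F j k)\<^sup>2) \<partial>sample_measure n f) \<le> ennreal (F j k / n)"
  using prob_space.empirical_second_moment[OF prob_space_density cell_sets[of j k], of n]
  by (simp add: measure_cell sample_measure_def empirical_def)

lemma empirical_expectation:
  "0 < n \<Longrightarrow> (\<integral>\<^sup>+X. ennreal (empirical n X j k) \<partial>sample_measure n f) = ennreal (F j k)"
  using prob_space.empirical_mean[OF prob_space_density cell_sets[of j k], of n]
  by (simp add: measure_cell sample_measure_def empirical_def)

text \<open>A nonnegative frequency with mean 0 vanishes almost surely, and there are only countably
  many cells.\<close>

lemma AE_empirical_null:
  assumes "0 < n"
  shows "AE X in sample_measure n f. \<forall>j. \<forall>k\<in>indices j. F j k = 0 \<longrightarrow> empirical n X j k = 0"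
  unfolding AE_all_countable
proof (intro allI AE_ball_countable' countable_finite finite_indices)
  fix j :: nat and k :: "'d \<Rightarrow> nat"
  show "AE X in sample_measure n f. F j k = 0 \<longrightarrow> empirical n X j k = 0"
  proof (cases "F j k = 0")
    case True
    then have "(\<integral>\<^sup>+X. ennreal (empirical n X j k) \<partial>sample_measure n f) = 0"
      using empirical_expectation[OF assms] by simp
    then have "AE X in sample_measure n f. ennreal (empirical n X j k) = 0"
      by (subst (asm) nn_integral_0_iff_AE) auto
    then show ?thesis using empirical_nonneg by (auto elim!: eventually_mono intro!: antisym)
  qed simp
qed

lemma histogram_chain_empirical:
  assumes n: "0 < n" and X: "X \<in> space (sample_measure n f)"
    and "\<forall>j. \<forall>k\<in>indices j. F j k = 0 \<longrightarrow> empirical n X j k = 0"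
  shows "histogram_chain f p s \<kappa> (empirical n X)"
proof
  show "empirical n X 0 (\<lambda>_. 0) = 1"
    using sum_empirical[of X n 0] X by (simp add: space_sample_measure indices_0)
qed (use assms in \<open>auto simp: empirical_nonneg intro: empirical_Suc\<close>)

text \<open>The counterpart of \<open>sq_dev\<close> as a function of the sample. It is defined
  outside \<open>histogram_chain\<close>, whose assumptions hold only for almost every sample, so
  that it can be integrated over all samples.\<close>

definition sq_err :: "nat \<Rightarrow> nat \<Rightarrow> ('d \<Rightarrow> nat) \<Rightarrow> (nat \<Rightarrow> real ^ 'd) \<Rightarrow> real"
  where "sq_err n j k X = (empirical n X j k - F j k)\<^sup>2 +
    (\<Sum>k'\<in>children k. (empirical n X (Suc j) k' - F (Suc j) k')\<^sup>2)"

definition level_err :: "nat \<Rightarrow> nat \<Rightarrow> (nat \<Rightarrow> real) \<Rightarrow> nat \<Rightarrow> (nat \<Rightarrow> real ^ 'd) \<Rightarrow> real"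
  where "level_err n J t j X = (CARD('d) / 2 ^ j) powr p *
    (if j < J then (\<Sum>k\<in>indices j. t j + coef j (t j) k * sq_err n j k X)
     else \<kappa> * (1 / 2 ^ J) powr s * (\<Sum>k\<in>indices J. empirical n X J k / F J k * (1 / 2 ^ J) ^ CARD('d)))"

lemma sq_err_nonneg: "0 \<le> sq_err n j k X"
  unfolding sq_err_def by (intro add_nonneg_nonneg sum_nonneg) auto

lemma level_err_nonneg: "(\<And>j. 0 < t j) \<Longrightarrow> 0 \<le> level_err n J t j X"
  unfolding level_err_def using empirical_nonneg F0 \<kappa> coef_nonneg sq_err_nonneg
  by (auto intro!: mult_nonneg_nonneg sum_nonneg add_nonneg_nonneg divide_nonneg_nonneg intro: less_imp_le)

lemma sq_err_measurable [measurable]: "sq_err n j k \<in> borel_measurable (sample_measure n f)"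
  unfolding sq_err_def by measurable

lemma level_err_measurable [measurable]: "level_err n J t j \<in> borel_measurable (sample_measure n f)"
  unfolding level_err_def by measurable

text \<open>The masses of the children add up to that of the cell, so the children together
  contribute as much as the cell itself.\<close>

lemma sq_err_expectation:
  assumes "0 < n"
  shows "(\<integral>\<^sup>+X. ennreal (sq_err n j k X) \<partial>sample_measure n f) \<le> ennreal (2 * F j k / n)"
proof -
  have "(\<integral>\<^sup>+X. ennreal (sq_err n j k X) \<partial>sample_measure n f) =
    (\<integral>\<^sup>+X. ennreal ((empirical n X j k - F j k)\<^sup>2) + (\<Sum>k'\<in>children k. ennreal ((empirical n X (Suc j) k' - F (Suc j) k')\<^sup>2)) \<partial>sample_measure n f)"
    unfolding sq_err_def by (intro nn_integral_cong) (simp add: ennreal_plus sum_nonneg)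
  also have "\<dots> = (\<integral>\<^sup>+X. ennreal ((empirical n X j k - F j k)\<^sup>2) \<partial>sample_measure n f) +
     (\<Sum>k'\<in>children k. \<integral>\<^sup>+X. ennreal ((empirical n X (Suc j) k' - F (Suc j) k')\<^sup>2) \<partial>sample_measure n f)"
    by (subst nn_integral_add) (auto simp: nn_integral_sum simp del: sum_ennreal)
  also have "\<dots> \<le> ennreal (F j k / n) + (\<Sum>k'\<in>children k. ennreal (F (Suc j) k' / n))"
    by (intro add_mono sum_mono empirical_variance assms)
  also have "\<dots> = ennreal (F j k / n + (\<Sum>k'\<in>children k. F (Suc j) k' / n))"
    using F0 by (simp add: sum_nonneg)
  also have "F j k / n + (\<Sum>k'\<in>children k. F (Suc j) k' / n) = 2 * F j k / n"
    unfolding sum_divide_distrib[symmetric] F_Suc[of j k, symmetric] by simp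
  finally show ?thesis .
qed

lemma level_err_expectation:
  assumes n: "0 < n" and j: "j < J" and t: "\<And>j. 0 < t j"
  shows "(\<integral>\<^sup>+X. ennreal (level_err n J t j X) \<partial>sample_measure n f) \<le>
    ennreal ((CARD('d) / 2 ^ j) powr p * (\<Sum>k\<in>indices j. t j + coef j (t j) k * (2 * F j k / n)))"
proof -
  interpret S: prob_space "sample_measure n f"
    unfolding sample_measure_def by (intro prob_space_PiM prob_space_density)
  have "(\<integral>\<^sup>+X. ennreal (level_err n J t j X) \<partial>sample_measure n f) =
    (\<integral>\<^sup>+X. ennreal ((CARD('d) / 2 ^ j) powr p) * (\<Sum>k\<in>indices j. ennreal (t j) + ennreal (coef j (t j) k) * ennreal (sq_err n j k X)) \<partial>sample_measure n f)"
  proof (intro nn_integral_cong)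
    fix X
    have nn: "0 \<le> t j + coef j (t j) k * sq_err n j k X" for k
      using coef_nonneg[OF t[of j]] t[of j] sq_err_nonneg by (simp add: add_nonneg_nonneg less_imp_le)
    have "ennreal (\<Sum>k\<in>indices j. t j + coef j (t j) k * sq_err n j k X) = (\<Sum>k\<in>indices j. ennreal (t j + coef j (t j) k * sq_err n j k X))"
      using nn by (intro sum_ennreal[symmetric])
    also have "\<dots> = (\<Sum>k\<in>indices j. ennreal (t j) + ennreal (coef j (t j) k) * ennreal (sq_err n j k X))"
      using coef_nonneg[OF t[of j]] t[of j] sq_err_nonneg
      by (intro sum.cong refl) (simp add: ennreal_plus ennreal_mult less_imp_le)
    finally show "ennreal (level_err n J t j X) = ennreal ((CARD('d) / 2 ^ j) powr p) * (\<Sum>k\<in>indices j. ennreal (t j) + ennreal (coef j (t j) k) * ennreal (sq_err n j k X))"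
      using j by (simp add: level_err_def ennreal_mult')
  qed
  also have "\<dots> = ennreal ((CARD('d) / 2 ^ j) powr p) * (\<Sum>k\<in>indices j. ennreal (t j) + ennreal (coef j (t j) k) * (\<integral>\<^sup>+X. ennreal (sq_err n j k X) \<partial>sample_measure n f))"
    by (simp add: nn_integral_cmult nn_integral_sum nn_integral_add S.emeasure_space_1)
  also have "\<dots> \<le> ennreal ((CARD('d) / 2 ^ j) powr p) * (\<Sum>k\<in>indices j. ennreal (t j) + ennreal (coef j (t j) k) * ennreal (2 * F j k / n))"
    by (intro mult_left_mono sum_mono add_mono sq_err_expectation n) auto
  also have "(\<Sum>k\<in>indices j. ennreal (t j) + ennreal (coef j (t j) k) * ennreal (2 * F j k / n)) =
      (\<Sum>k\<in>indices j. ennreal (t j + coef j (t j) k * (2 * F j k / n)))"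
  proof (intro sum.cong refl)
    fix k
    have "ennreal (t j + coef j (t j) k * (2 * F j k / n)) = ennreal (t j) + ennreal (coef j (t j) k * (2 * F j k / n))"
      using coef_nonneg[OF t[of j]] t[of j] F0 by (intro ennreal_plus mult_nonneg_nonneg divide_nonneg_nonneg) (auto intro: less_imp_le)
    then show "ennreal (t j) + ennreal (coef j (t j) k) * ennreal (2 * F j k / n) = ennreal (t j + coef j (t j) k * (2 * F j k / n))"
      by (simp only: ennreal_mult'[OF coef_nonneg[OF t[of j]]])
  qed
  also have "\<dots> = ennreal (\<Sum>k\<in>indices j. t j + coef j (t j) k * (2 * F j k / n))"
    using coef_nonneg[OF t[of j]] t[of j] F0 by (intro sum_ennreal) (simp add: add_nonneg_nonneg less_imp_le)
  finally show ?thesis by (simp add: ennreal_mult')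
qed

text \<open>The expected frequency cancels \<open>F J k\<close> in the denominator, and the volumes
  that remain add up to at most 1.\<close>

lemma level_err_expectation_last:
  assumes n: "0 < n"
  shows "(\<integral>\<^sup>+X. ennreal (level_err n J t J X) \<partial>sample_measure n f) \<le>
    ennreal ((CARD('d) / 2 ^ J) powr p * (\<kappa> * (1 / 2 ^ J) powr s))"
proof -
  let ?c = "(CARD('d) / 2 ^ J) powr p * (\<kappa> * (1 / 2 ^ J) powr s)" and ?V = "(1 / 2 ^ J :: real) ^ CARD('d)"
  have c: "0 \<le> ?c" using \<kappa> by simp
  have "(\<integral>\<^sup>+X. ennreal (level_err n J t J X) \<partial>sample_measure n f) =
    (\<integral>\<^sup>+X. ennreal ?c * (\<Sum>k\<in>indices J. ennreal (empirical n X J k) * ennreal (?V / F J k)) \<partial>sample_measure n f)"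
  proof (intro nn_integral_cong)
    fix X
    have "level_err n J t J X = ?c * (\<Sum>k\<in>indices J. empirical n X J k * (?V / F J k))"
      by (simp add: level_err_def)
    moreover have "ennreal (\<Sum>k\<in>indices J. empirical n X J k * (?V / F J k)) = (\<Sum>k\<in>indices J. ennreal (empirical n X J k * (?V / F J k)))"
      using empirical_nonneg F0 by (intro sum_ennreal[symmetric] mult_nonneg_nonneg divide_nonneg_nonneg) auto
    moreover have "\<dots> = (\<Sum>k\<in>indices J. ennreal (empirical n X J k) * ennreal (?V / F J k))"
      using empirical_nonneg by (intro sum.cong refl ennreal_mult') auto
    ultimately show "ennreal (level_err n J t J X) = ennreal ?c * (\<Sum>k\<in>indices J. ennreal (empirical n X J k) * ennreal (?V / F J k))"
      using c by (simp only: ennreal_mult')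
  qed
  also have "\<dots> = ennreal ?c * (\<Sum>k\<in>indices J. ennreal (F J k) * ennreal (?V / F J k))"
    by (simp add: nn_integral_cmult nn_integral_sum nn_integral_multc empirical_expectation[OF n])
  also have "\<dots> \<le> ennreal ?c * (\<Sum>k\<in>(indices J :: ('d \<Rightarrow> nat) set). ennreal ?V)"
  proof (intro mult_left_mono sum_mono)
    fix k
    \<comment> \<open>Only an inequality: a cell of mass 0 contributes 0 instead of its
      volume.\<close>
    have "F J k * (?V / F J k) \<le> ?V" by (cases "F J k = 0") auto
    then show "ennreal (F J k) * ennreal (?V / F J k) \<le> ennreal ?V"
      using F0 by (simp only: ennreal_mult'[OF F0, symmetric]) (rule ennreal_leI)
  qed simp
  also have "(\<Sum>k\<in>(indices J :: ('d \<Rightarrow> nat) set). ennreal ?V) = ennreal (\<Sum>k\<in>(indices J :: ('d \<Rightarrow> nat) set). ?V)"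
    by (intro sum_ennreal) simp
  also have "(\<Sum>k\<in>(indices J :: ('d \<Rightarrow> nat) set). ?V) = 1"
    by (simp add: card_indices power_one_over)
  finally show ?thesis by simp
qed

text \<open>The root of \<open>W powr (p - 1) * c\<close> is a weighted geometric mean of
  \<open>W\<close> and \<open>c\<close>, so at most their sum. This makes the bound linear in the
  random costs.\<close>

lemma wasserstein_histogram_le:
  assumes n: "0 < n" and X: "X \<in> space (sample_measure n f)"
    and null: "\<forall>j. \<forall>k\<in>indices j. F j k = 0 \<longrightarrow> empirical n X j k = 0"
    and t: "\<And>j. 0 < t j" and w: "\<And>j. 0 < w j"
  shows "wasserstein p (density_measure f) (density_measure (histogram n J X)) \<le>
    ennreal ((\<Sum>j\<le>J. w j) + (\<Sum>j\<le>J. level_err n J t j X / w j powr (p - 1)))"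
proof -
  interpret histogram_chain f p s \<kappa> "empirical n X"
    by (rule histogram_chain_empirical[OF n X null])
  have h: "hist J = histogram n J X"
    by (simp add: hist_def histogram_def)
  have le: "level_cost J t j = level_err n J t j X" for j
    by (simp add: level_cost_def level_err_def sq_dev_def sq_err_def)
  define W where "W = (\<Sum>j\<le>J. w j)"
  define c where "c = (\<Sum>j\<le>J. level_err n J t j X / w j powr (p - 1))"
  have W: "0 < W" unfolding W_def using w by (intro sum_pos) auto
  have c: "0 \<le> c" unfolding c_def using level_err_nonneg[OF t] by (intro sum_nonneg divide_nonneg_nonneg) auto
  have "transportable p (cube_density f) (cube_density (histogram n J X)) (ennreal (W powr (p - 1) * c))"
    using transportable_histogram[of t w J, OF t w] unfolding h le W_def c_def .
  then have "wasserstein p (density_measure f) (density_measure (histogram n J X)) \<le> ennreal ((W powr (p - 1) * c) powr (1 / p))"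
    using p c X by (intro wasserstein_le prob_density prob_density_histogram) (auto simp: space_sample_measure)
  also have "(W powr (p - 1) * c) powr (1 / p) \<le> W + c"
  proof (cases "c \<le> W")
    case True
    have "W powr (p - 1) * c \<le> W powr (p - 1) * W" using True by (intro mult_left_mono) auto
    also have "\<dots> = W powr p" using W by (simp add: powr_diff)
    finally have "(W powr (p - 1) * c) powr (1 / p) \<le> (W powr p) powr (1 / p)"
      using c p by (intro powr_mono2) auto
    then show ?thesis using W c p by (simp add: powr_powr)
  next
    case False
    have "W powr (p - 1) * c \<le> c powr (p - 1) * c" using False W p c by (intro mult_right_mono powr_mono2) auto
    also have "\<dots> = c powr p" using False W by (simp add: powr_diff)
    finally have "(W powr (p - 1) * c) powr (1 / p) \<le> (c powr p) powr (1 / p)"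
      using c p by (intro powr_mono2) auto
    then show ?thesis using W c p by (simp add: powr_powr)
  qed
  finally show ?thesis unfolding W_def c_def by (simp add: ennreal_leI)
qed

text \<open>Each weight is the \<open>p\<close>-th root of a bound for an expected cost, so a random
  summand divided by \<open>w j powr (p - 1)\<close> has mean at most \<open>w j\<close>. Together
  with the weights themselves this gives the factor 2.\<close>

lemma wasserstein_histogram_expectation:
  assumes n: "0 < n" and t: "\<And>j. 0 < t j" and w: "\<And>j. 0 < w j"
    and e: "\<And>j. j \<le> J \<Longrightarrow> (\<integral>\<^sup>+X. ennreal (level_err n J t j X) \<partial>sample_measure n f) \<le> ennreal (w j powr p)"
  shows "(\<integral>\<^sup>+X. wasserstein p (density_measure f) (density_measure (histogram n J X)) \<partial>sample_measure n f)
    \<le> ennreal (2 * (\<Sum>j\<le>J. w j))"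
proof -
  interpret S: prob_space "sample_measure n f"
    unfolding sample_measure_def by (intro prob_space_PiM prob_space_density)
  let ?W = "\<Sum>j\<le>J. w j"
  have W: "0 \<le> ?W" using w by (intro sum_nonneg) (auto intro: less_imp_le)
  have "(\<integral>\<^sup>+X. wasserstein p (density_measure f) (density_measure (histogram n J X)) \<partial>sample_measure n f)
    \<le> (\<integral>\<^sup>+X. ennreal (?W + (\<Sum>j\<le>J. level_err n J t j X / w j powr (p - 1))) \<partial>sample_measure n f)"
  proof (rule nn_integral_mono_AE)
    show "AE X in sample_measure n f. wasserstein p (density_measure f) (density_measure (histogram n J X))
      \<le> ennreal (?W + (\<Sum>j\<le>J. level_err n J t j X / w j powr (p - 1)))"
      using AE_empirical_null[OF n] AE_space
      by eventually_elim (rule wasserstein_histogram_le[OF n _ _ t w])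
  qed
  also have "\<dots> = (\<integral>\<^sup>+X. ennreal ?W + (\<Sum>j\<le>J. ennreal (1 / w j powr (p - 1)) * ennreal (level_err n J t j X)) \<partial>sample_measure n f)"
  proof (intro nn_integral_cong)
    fix X
    have "ennreal (\<Sum>j\<le>J. level_err n J t j X / w j powr (p - 1)) = (\<Sum>j\<le>J. ennreal (level_err n J t j X / w j powr (p - 1)))"
      using level_err_nonneg[OF t] by (intro sum_ennreal[symmetric] divide_nonneg_nonneg) auto
    also have "\<dots> = (\<Sum>j\<le>J. ennreal (1 / w j powr (p - 1)) * ennreal (level_err n J t j X))"
      by (intro sum.cong refl) (simp flip: ennreal_mult')
    finally show "ennreal (?W + (\<Sum>j\<le>J. level_err n J t j X / w j powr (p - 1))) =
        ennreal ?W + (\<Sum>j\<le>J. ennreal (1 / w j powr (p - 1)) * ennreal (level_err n J t j X))"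
      using W level_err_nonneg[OF t] by (subst ennreal_plus) (auto intro!: sum_nonneg divide_nonneg_nonneg)
  qed
  also have "\<dots> = ennreal ?W + (\<Sum>j\<le>J. ennreal (1 / w j powr (p - 1)) * (\<integral>\<^sup>+X. ennreal (level_err n J t j X) \<partial>sample_measure n f))"
    by (simp add: nn_integral_add nn_integral_sum nn_integral_cmult S.emeasure_space_1)
  also have "\<dots> \<le> ennreal ?W + (\<Sum>j\<le>J. ennreal (1 / w j powr (p - 1)) * ennreal (w j powr p))"
    by (intro add_mono sum_mono mult_left_mono e) auto
  also have "(\<Sum>j\<le>J. ennreal (1 / w j powr (p - 1)) * ennreal (w j powr p)) = (\<Sum>j\<le>J. ennreal (w j))"
  proof (intro sum.cong refl)
    fix j
    have "1 / w j powr (p - 1) * w j powr p = w j" using w[of j] by (simp add: powr_diff)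
    then show "ennreal (1 / w j powr (p - 1)) * ennreal (w j powr p) = ennreal (w j)"
      by (simp flip: ennreal_mult'')
  qed
  also have "\<dots> = ennreal ?W" using w by (intro sum_ennreal) (auto intro: less_imp_le)
  also have "ennreal ?W + ennreal ?W = ennreal (2 * ?W)" using W by (simp flip: ennreal_plus)
  finally show ?thesis .
qed

end

section \<open>Rates\<close>

context holder_density
begin

text \<open>In units of \<open>thr\<close>, the three summands are the threshold itself, the
  contribution of a good cell and that of a bad one.\<close>

definition level_const :: real
  where "level_const = 1 + 4 * (1 + 2 ^ CARD('d)) * (72 * 2 ^ CARD('d))\<^sup>2 + 4 * \<kappa> * (1 + 2 ^ CARD('d))"

text \<open>The power of \<open>CARD('d)\<close> stems from the diameters, the second summand in the
  bracket from the step to the histogram.\<close>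

definition total_const :: real
  where "total_const = CARD('d) powr p * (level_const + \<kappa> * 2 powr ((CARD('d) + s) / 2))"

lemma level_const_pos: "0 < level_const"
  unfolding level_const_def using \<kappa> by (intro add_pos_nonneg mult_nonneg_nonneg) auto

lemma total_const_pos: "0 < total_const"
  unfolding total_const_def using \<kappa> level_const_pos by (intro mult_pos_pos add_pos_pos) auto

text \<open>The order of the standard deviation of the frequency of a bad cell, whose mass is at
  most of order 2^(-j(d+s)). It balances the two terms of
  \<open>t + dev\<^sup>2 / t\<close>.\<close>

definition thr :: "real \<Rightarrow> nat \<Rightarrow> real"
  where "thr N j = sqrt ((2 ^ j) powr - (CARD('d) + s) / N)"

lemma thr_pos: "0 < N \<Longrightarrow> 0 < thr N j"
  by (simp add: thr_def)

lemma thr_sq: "0 < N \<Longrightarrow> N * (thr N j)\<^sup>2 = (1 / 2 ^ j) powr s * (1 / 2 ^ j) ^ CARD('d)"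
proof -
  assume N: "0 < N"
  have "(1 / 2 ^ j) powr s * (1 / 2 ^ j) ^ CARD('d) = (1 / 2 ^ j) powr s * (1 / 2 ^ j :: real) powr CARD('d)"
    by (simp add: powr_realpow)
  also have "\<dots> = (1 / 2 ^ j) powr (CARD('d) + s)"
    by (simp add: powr_add mult.commute)
  also have "\<dots> = 1 / (2 ^ j) powr (CARD('d) + s)"
    by (simp add: powr_divide)
  also have "\<dots> = (2 ^ j) powr - (CARD('d) + s)"
    by (rule powr_minus_divide[symmetric])
  finally show ?thesis using N by (simp add: thr_def)
qed

text \<open>On a good cell the mass cancels and a multiple of \<open>1 / N\<close> is left, which is
  at most the threshold because the level does not exceed the resolution. On a bad cell the mass is
  at most of order \<open>N\<close> times the squared threshold.\<close>

lemma coef_le: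
  assumes N: "0 < N" and le: "(2 ^ j) powr (CARD('d) + s) \<le> N" and k: "k \<in> indices j"
  shows "coef j (thr N j) k * (2 * F j k / N) \<le>
    thr N j * (4 * (1 + 2 ^ CARD('d)) * (72 * 2 ^ CARD('d))\<^sup>2 + 4 * \<kappa> * (1 + 2 ^ CARD('d)))"
proof (cases "good j k")
  case True
  have "1 / N \<le> thr N j"
  proof -
    have "(1 / N)\<^sup>2 = (1 / N) / N" by (simp add: power2_eq_square)
    also have "\<dots> \<le> ((2 ^ j) powr - (CARD('d) + s)) / N"
    proof (rule divide_right_mono)
      have "1 / N \<le> 1 / (2 ^ j) powr (CARD('d) + s)" using le N by (intro divide_left_mono) auto
      then show "1 / N \<le> (2 ^ j) powr - (CARD('d) + s)" unfolding powr_minus_divide .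
    qed (use N in simp)
    finally show ?thesis unfolding thr_def by (rule real_le_rsqrt)
  qed
  have "coef j (thr N j) k * (2 * F j k / N) \<le> (4 * (1 + 2 ^ CARD('d)) * (72 * 2 ^ CARD('d))\<^sup>2) * (1 / N)"
  proof (cases "F j k = 0")
    case False
    then have "a * (2 * R / F j k) * (2 * F j k / N) = (4 * a * R) * (1 / N)" for a R :: real
      using N by (simp add: field_simps)
    then show ?thesis unfolding coef_def using True by (simp only: if_True order_refl)
  qed (use N in simp)
  also have "\<dots> \<le> (4 * (1 + 2 ^ CARD('d)) * (72 * 2 ^ CARD('d))\<^sup>2) * thr N j"
    using \<open>1 / N \<le> thr N j\<close> by (intro mult_left_mono) auto
  also have "\<dots> \<le> (4 * (1 + 2 ^ CARD('d)) * (72 * 2 ^ CARD('d))\<^sup>2 + 4 * \<kappa> * (1 + 2 ^ CARD('d))) * thr N j"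
    using \<kappa> thr_pos[OF N, of j] by (intro mult_right_mono) auto
  finally show ?thesis by (simp only: mult.commute)
next
  case False
  let ?t = "thr N j"
  have t: "0 < ?t" by (rule thr_pos[OF N])
  have "F j k \<le> 2 * \<kappa> * (N * ?t\<^sup>2)"
    using bad_F[OF k False] unfolding thr_sq[OF N] by (simp add: mult.assoc)
  then have "2 * F j k / N \<le> 4 * \<kappa> * ?t\<^sup>2"
    using N by (simp add: pos_divide_le_eq algebra_simps)
  then have "(1 + 2 ^ CARD('d)) * (1 / ?t) * (2 * F j k / N) \<le> (1 + 2 ^ CARD('d)) * (1 / ?t) * (4 * \<kappa> * ?t\<^sup>2)"
    using t by (intro mult_left_mono) auto
  also have "\<dots> = 4 * \<kappa> * (1 + 2 ^ CARD('d)) * ?t"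
    using t by (simp add: power2_eq_square)
  also have "\<dots> \<le> (4 * (1 + 2 ^ CARD('d)) * (72 * 2 ^ CARD('d))\<^sup>2 + 4 * \<kappa> * (1 + 2 ^ CARD('d))) * ?t"
    using t by (intro mult_right_mono) auto
  finally show ?thesis using False by (simp only: coef_def mult.commute if_False)
qed

lemma level_sum_le:
  assumes N: "0 < N" and le: "(2 ^ j) powr (CARD('d) + s) \<le> N"
  shows "(\<Sum>k\<in>indices j. thr N j + coef j (thr N j) k * (2 * F j k / N)) \<le> (2 ^ j) ^ CARD('d) * (thr N j * level_const)"
proof -
  have "(\<Sum>k\<in>indices j. thr N j + coef j (thr N j) k * (2 * F j k / N)) \<le> (\<Sum>k\<in>(indices j :: ('d \<Rightarrow> nat) set). thr N j * level_const)"
  proof (rule sum_mono)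
    fix k :: "'d \<Rightarrow> nat" assume "k \<in> indices j"
    from coef_le[OF N le this] show "thr N j + coef j (thr N j) k * (2 * F j k / N) \<le> thr N j * level_const"
      unfolding level_const_def by (simp only: distrib_left mult_1_right)
  qed
  then show ?thesis by (simp add: card_indices)
qed

text \<open>The 2^(jd) cells, a threshold of order 2^(-j(d+s)/2) and the cost 2^(-jp) multiply to
  this exponent; its sign distinguishes the three regimes.\<close>

definition expo :: real where "expo = (CARD('d) - s) / 2 - p"

text \<open>The \<open>p\<close>-th root of the bound for the expected cost of level
  \<open>j\<close>, which is geometric in \<open>j\<close>.\<close>

definition weight :: "real \<Rightarrow> nat \<Rightarrow> real"
  where "weight N j = (total_const * (2 ^ j) powr expo * N powr (- 1 / 2)) powr (1 / p)"

lemma weight_pos: "0 < N \<Longrightarrow> 0 < weight N j"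
  unfolding weight_def using total_const_pos by simp

lemma weight_powr: "0 < N \<Longrightarrow> weight N j powr p = total_const * (2 ^ j) powr expo * N powr (- 1 / 2)"
  unfolding weight_def using total_const_pos p by (simp add: powr_powr)

lemma weight_eq: "0 < N \<Longrightarrow> weight N j = total_const powr (1 / p) * (N powr (- 1 / (2 * p)) * (2 powr (expo / p)) ^ j)"
proof -
  assume N: "0 < N"
  have "((2 ^ j) powr expo) powr (1 / p) = (2 powr (expo / p)) ^ j"
    by (simp add: powr_powr powr_realpow[symmetric] mult.commute)
  moreover have "(N powr (- 1 / 2)) powr (1 / p) = N powr (- 1 / (2 * p))"
    by (simp add: powr_powr)
  ultimately show ?thesis unfolding weight_def by (simp add: powr_mult)
qed

lemma level_weight:
  assumes N: "0 < N"
  shows "(CARD('d) / 2 ^ j) powr p * ((2 ^ j) ^ CARD('d) * (thr N j * level_const)) \<le> weight N j powr p"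
proof -
  let ?b = "2 ^ j :: real"
  have "thr N j = (?b powr - (CARD('d) + s) / N) powr (1 / 2)"
    using N by (simp add: thr_def powr_half_sqrt)
  also have "\<dots> = ?b powr (- (CARD('d) + s) / 2) * N powr (- 1 / 2)"
    using N by (simp add: powr_divide powr_powr powr_minus_divide)
  finally have thr: "thr N j = ?b powr (- (CARD('d) + s) / 2) * N powr (- 1 / 2)" .
  have b: "?b ^ CARD('d) = ?b powr CARD('d)" by (simp add: powr_realpow)
  have "(CARD('d) / ?b) powr p * (?b ^ CARD('d) * (thr N j * level_const)) =
    CARD('d) powr p * level_const * (?b powr - p * ?b powr CARD('d) * ?b powr (- (CARD('d) + s) / 2)) * N powr (- 1 / 2)"
    unfolding thr b by (simp add: powr_divide powr_minus_divide)
  also have "?b powr - p * ?b powr CARD('d) * ?b powr (- (CARD('d) + s) / 2) = ?b powr expo"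
    unfolding powr_add[symmetric] expo_def by (rule arg_cong[where f="\<lambda>x. ?b powr x"]) (simp add: field_simps)
  also have "CARD('d) powr p * level_const * ?b powr expo * N powr (- 1 / 2) \<le> total_const * ?b powr expo * N powr (- 1 / 2)"
    unfolding total_const_def using \<kappa> by (intro mult_right_mono mult_left_mono) auto
  finally show ?thesis by (simp add: weight_powr[OF N])
qed

text \<open>The next level would exceed the resolution, so n is at most 2^((J+1)(d+s)). This
  converts the bias 2^(-J(p+s)) into the form of the other weights; replacing \<open>Suc J\<close>
  by \<open>J\<close> costs the factor 2^((d+s)/2).\<close>

lemma last_weight:
  assumes N: "0 < N" and le: "N \<le> (2 ^ Suc J) powr (CARD('d) + s)" and s: "0 \<le> s"
  shows "(CARD('d) / 2 ^ J) powr p * (\<kappa> * (1 / 2 ^ J) powr s) \<le> weight N J powr p"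
proof -
  let ?b = "2 ^ J :: real" and ?q = "(CARD('d) + s) / 2"
  have "N powr (1 / 2) \<le> ((2 * ?b) powr (CARD('d) + s)) powr (1 / 2)"
    using N le by (intro powr_mono2) auto
  also have "\<dots> = 2 powr ?q * ?b powr ?q" by (simp add: powr_powr powr_mult)
  finally have "N powr (1 / 2) * N powr (- 1 / 2) \<le> 2 powr ?q * ?b powr ?q * N powr (- 1 / 2)"
    by (rule mult_right_mono) simp
  then have 1: "1 \<le> 2 powr ?q * ?b powr ?q * N powr (- 1 / 2)"
    using N by (simp add: powr_add[symmetric])
  have "(CARD('d) / ?b) powr p * (\<kappa> * (1 / ?b) powr s) = CARD('d) powr p * \<kappa> * (?b powr - p * ?b powr - s) * 1"
    by (simp add: powr_divide powr_minus_divide)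
  also have "\<dots> \<le> CARD('d) powr p * \<kappa> * (?b powr - p * ?b powr - s) * (2 powr ?q * ?b powr ?q * N powr (- 1 / 2))"
    using \<kappa> 1 by (intro mult_left_mono) auto
  also have "\<dots> = CARD('d) powr p * (\<kappa> * 2 powr ?q) * (?b powr - p * ?b powr - s * ?b powr ?q) * N powr (- 1 / 2)"
    by (simp only: ac_simps)
  also have "?b powr - p * ?b powr - s * ?b powr ?q = ?b powr expo"
    unfolding powr_add[symmetric] expo_def by (rule arg_cong[where f="\<lambda>x. ?b powr x"]) (simp add: field_simps)
  also have "CARD('d) powr p * (\<kappa> * 2 powr ?q) * ?b powr expo * N powr (- 1 / 2) \<le> total_const * ?b powr expo * N powr (- 1 / 2)"
    unfolding total_const_def using level_const_pos by (intro mult_right_mono mult_left_mono) auto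
  finally show ?thesis by (simp add: weight_powr[OF N])
qed

lemma wasserstein_histogram_rate:
  assumes n: "0 < n" and s: "0 \<le> s"
    and J: "(2 ^ J) powr (CARD('d) + s) \<le> n" "n \<le> (2 ^ Suc J) powr (CARD('d) + s)"
  shows "(\<integral>\<^sup>+X. wasserstein p (density_measure f) (density_measure (histogram n J X)) \<partial>sample_measure n f)
    \<le> ennreal (2 * total_const powr (1 / p) * (n powr (- 1 / (2 * p)) * (\<Sum>j\<le>J. (2 powr (expo / p)) ^ j)))"
proof -
  have N: "0 < real n" using n by simp
  have "(\<integral>\<^sup>+X. wasserstein p (density_measure f) (density_measure (histogram n J X)) \<partial>sample_measure n f)
    \<le> ennreal (2 * (\<Sum>j\<le>J. weight n j))"
  proof (rule wasserstein_histogram_expectation[where t="thr n"])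
    fix j assume j: "j \<le> J"
    show "(\<integral>\<^sup>+X. ennreal (level_err n J (thr n) j X) \<partial>sample_measure n f) \<le> ennreal (weight n j powr p)"
    proof (cases "j < J")
      case True
      have "(2 ^ j) powr (CARD('d) + s) \<le> (2 ^ J :: real) powr (CARD('d) + s)"
        using j s by (intro powr_mono2) auto
      then have le: "(2 ^ j) powr (CARD('d) + s) \<le> real n" using J by simp
      have "(CARD('d) / 2 ^ j) powr p * (\<Sum>k\<in>indices j. thr n j + coef j (thr n j) k * (2 * F j k / n)) \<le> weight n j powr p"
        by (rule order_trans[OF mult_left_mono[OF level_sum_le[OF N le]] level_weight[OF N]]) simp
      then show ?thesis
        by (rule order_trans[OF level_err_expectation[OF n True thr_pos[OF N]] ennreal_leI])
    next
      case False
      then have "j = J" using j by simp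
      then show ?thesis
        using order_trans[OF level_err_expectation_last[OF n] ennreal_leI[OF last_weight[OF N J(2) s]]] by simp
    qed
  qed (use n N thr_pos weight_pos in auto)
  also have "2 * (\<Sum>j\<le>J. weight n j) = 2 * total_const powr (1 / p) * (n powr (- 1 / (2 * p)) * (\<Sum>j\<le>J. (2 powr (expo / p)) ^ j))"
    unfolding weight_eq[OF N] by (simp add: sum_distrib_left mult.assoc)
  finally show ?thesis .
qed

end

text \<open>The sum is of the order of its last term, of the number of its terms, or of its first
  term, according to the sign of the exponent. The last term is at most a power of \<open>n\<close>
  and the number of terms at most logarithmic, by the bound on \<open>J\<close>.\<close>

lemma geometric_rate:
  fixes d s p :: real
  assumes ds: "1 \<le> d + s" and p: "0 < p"
  shows "\<exists>C>0. \<forall>n\<ge>2. \<forall>J. (2 ^ J) powr (d + s) \<le> real n \<longrightarrow>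
    real n powr (- 1 / (2 * p)) * (\<Sum>j\<le>J. (2 powr (((d - s) / 2 - p) / p)) ^ j) \<le> C * rate d s p n"
proof -
  define e where "e = ((d - s) / 2 - p) / p"
  define r :: real where "r = 2 powr e"
  have r: "0 < r" by (simp add: r_def)
  consider "d - s > 2 * p" | "d - s = 2 * p" | "d - s < 2 * p" by linarith
  then show ?thesis unfolding e_def[symmetric] r_def[symmetric]
  proof cases
    case 1
    then have e: "0 < e" using p by (simp add: e_def field_simps)
    then have r1: "1 < r" by (simp add: r_def)
    have "real n powr (- 1 / (2 * p)) * (\<Sum>j\<le>J. r ^ j) \<le> r / (r - 1) * rate d s p n"
      if n: "2 \<le> n" and J: "(2 ^ J) powr (d + s) \<le> real n" for n J
    proof -
      have "(\<Sum>j\<le>J. r ^ j) = (r ^ Suc J - 1) / (r - 1)"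
        using r1 by (simp add: lessThan_Suc_atMost[symmetric] geometric_sum del: sum.lessThan_Suc)
      also have "\<dots> \<le> r ^ Suc J / (r - 1)" using r1 by (intro divide_right_mono) auto
      also have "\<dots> = r / (r - 1) * r ^ J" by simp
      finally have "(\<Sum>j\<le>J. r ^ j) \<le> r / (r - 1) * r ^ J" .
      moreover have "r ^ J \<le> real n powr (e / (d + s))"
      proof -
        have "r ^ J = ((2 ^ J) powr (d + s)) powr (e / (d + s))"
          using ds by (simp add: r_def powr_powr powr_realpow[symmetric] mult.commute)
        also have "\<dots> \<le> real n powr (e / (d + s))"
          using J e ds by (intro powr_mono2) auto
        finally show ?thesis .
      qed
      ultimately have "(\<Sum>j\<le>J. r ^ j) \<le> r / (r - 1) * real n powr (e / (d + s))"
        using r1 by (elim order_trans) (intro mult_left_mono, auto)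
      then have "real n powr (- 1 / (2 * p)) * (\<Sum>j\<le>J. r ^ j) \<le> real n powr (- 1 / (2 * p)) * (r / (r - 1) * real n powr (e / (d + s)))"
        by (rule mult_left_mono) simp
      also have "\<dots> = r / (r - 1) * real n powr (- 1 / (2 * p) + e / (d + s))"
        by (simp only: powr_add mult.left_commute)
      also have "- 1 / (2 * p) + e / (d + s) = - ((1 + s / p) / (d + s))"
      proof -
        have "(- 1 / (2 * p) + e / q) * q = - (q / (2 * p)) + e" if "q \<noteq> 0" for q
          using that by (simp add: left_diff_distrib)
        then have "(- 1 / (2 * p) + e / (d + s)) * (d + s) = - ((d + s) / (2 * p)) + e"
          using ds by simp
        also have "\<dots> = - (1 + s / p)" using p by (simp add: e_def field_simps)
        finally have "- 1 / (2 * p) + e / (d + s) = - (1 + s / p) / (d + s)"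
          using ds by (intro eq_divide_imp) auto
        then show ?thesis unfolding minus_divide_left .
      qed
      finally show ?thesis using 1 by (simp add: rate_def)
    qed
    moreover have "0 < r / (r - 1)" using r1 by simp
    ultimately show "\<exists>C>0. \<forall>n\<ge>2. \<forall>J. (2 ^ J) powr (d + s) \<le> real n \<longrightarrow>
      real n powr (- 1 / (2 * p)) * (\<Sum>j\<le>J. r ^ j) \<le> C * rate d s p n" by blast
  next
    case 2
    then have r1: "r = 1" using p by (simp add: r_def e_def field_simps)
    have "real n powr (- 1 / (2 * p)) * (\<Sum>j\<le>J. r ^ j) \<le> 2 / ln 2 * rate d s p n"
      if n: "2 \<le> n" and J: "(2 ^ J) powr (d + s) \<le> real n" for n J
    proof -
      \<comment> \<open>As \<open>d + s\<close> is at least 1, the number of levels is at most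
        logarithmic in \<open>n\<close>.\<close>
      have "(2::real) ^ J \<le> (2 ^ J) powr (d + s)"
        using ds powr_mono[of 1 "d + s" "2 ^ J :: real"] by simp
      then have "(2::real) ^ J \<le> real n" using J by (rule order_trans)
      then have "ln (2 ^ J) \<le> ln (real n)" using n by (subst ln_le_cancel_iff) auto
      then have "J * ln 2 \<le> ln (real n)" by (simp add: ln_realpow)
      \<comment> \<open>Since \<open>n \<ge> 2\<close>, a second \<open>ln n\<close> absorbs the
        extra term of a sum that starts at level 0.\<close>
      moreover have "ln 2 \<le> ln (real n)" using n by simp
      ultimately have "(real J + 1) * ln 2 \<le> 2 * ln (real n)" by (simp add: algebra_simps)
      then have "real J + 1 \<le> 2 / ln 2 * ln (real n)" by (simp add: field_simps)
      then have "real n powr (- 1 / (2 * p)) * (real J + 1) \<le> real n powr (- 1 / (2 * p)) * (2 / ln 2 * ln (real n))"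
        by (rule mult_left_mono) simp
      then show ?thesis using 2 r1 by (simp add: rate_def mult_ac add.commute)
    qed
    moreover have "0 < 2 / ln (2 :: real)" by simp
    ultimately show "\<exists>C>0. \<forall>n\<ge>2. \<forall>J. (2 ^ J) powr (d + s) \<le> real n \<longrightarrow>
      real n powr (- 1 / (2 * p)) * (\<Sum>j\<le>J. r ^ j) \<le> C * rate d s p n" by blast
  next
    case 3
    then have e: "e < 0" using p by (simp add: e_def field_simps)
    then have r1: "r < 1" using powr_less_mono[of e 0 2] by (simp add: r_def)
    have "real n powr (- 1 / (2 * p)) * (\<Sum>j\<le>J. r ^ j) \<le> 1 / (1 - r) * rate d s p n" for n J
    proof -
      have "(\<Sum>j\<le>J. r ^ j) = (1 - r ^ Suc J) / (1 - r)"
        using r1 by (simp add: sum_gp0)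
      also have "\<dots> \<le> 1 / (1 - r)" using r r1 by (intro divide_right_mono) auto
      finally have "real n powr (- 1 / (2 * p)) * (\<Sum>j\<le>J. r ^ j) \<le> real n powr (- 1 / (2 * p)) * (1 / (1 - r))"
        by (rule mult_left_mono) simp
      then show ?thesis using 3 by (simp add: rate_def)
    qed
    moreover have "0 < 1 / (1 - r)" using r1 by simp
    ultimately show "\<exists>C>0. \<forall>n\<ge>2. \<forall>J. (2 ^ J) powr (d + s) \<le> real n \<longrightarrow>
      real n powr (- 1 / (2 * p)) * (\<Sum>j\<le>J. r ^ j) \<le> C * rate d s p n" by blast
  qed
qed

text \<open>For positive \<open>n\<close> and \<open>D\<close> this is the largest \<open>J\<close>
  with \<open>(2 ^ J) powr D \<le> n\<close>.\<close>

definition resolution :: "real \<Rightarrow> nat \<Rightarrow> nat"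
  where "resolution D n = nat \<lfloor>log 2 (real n) / D\<rfloor>"

lemma resolution_bounds:
  assumes "0 < D" "0 < n"
  shows "(2 ^ resolution D n) powr D \<le> real n" "real n \<le> (2 ^ Suc (resolution D n)) powr D"
proof -
  let ?x = "log 2 (real n) / D"
  \<comment> \<open>The logarithm is nonnegative for \<open>n \<ge> 1\<close>, so \<open>nat\<close>
    truncates nothing.\<close>
  have "0 \<le> ?x" using assms by (simp add: Suc_le_eq)
  then have "0 \<le> \<lfloor>?x\<rfloor>" by simp
  then have J: "real (resolution D n) = real_of_int \<lfloor>?x\<rfloor>" by (simp add: resolution_def)
  then have x: "real (resolution D n) \<le> ?x" "?x \<le> real (Suc (resolution D n))" by (simp_all, linarith+)
  have e: "(2 ^ k) powr D = 2 powr (k * D)" for k :: nat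
    by (simp add: powr_powr powr_realpow[symmetric])
  have n: "real n = 2 powr (?x * D)" using assms by simp
  show "(2 ^ resolution D n) powr D \<le> real n" "real n \<le> (2 ^ Suc (resolution D n)) powr D"
    unfolding e by (subst n, use x assms in \<open>intro powr_mono mult_right_mono; simp\<close>)+
qed

lemma density_measure_indicator:
  assumes "prob_density_on_cube f" "(\<lambda>x. indicator unit_cube x * f x) \<in> borel_measurable borel"
  shows "density_measure (\<lambda>x. indicator unit_cube x * f x) = density_measure f"
  unfolding density_measure_def
proof (rule density_cong)
  show "(\<lambda>x. ennreal (f x)) \<in> borel_measurable cube_measure"
    using assms(1) unfolding prob_density_on_cube_def by (intro measurable_compose_rev[OF measurable_ennreal]) simp
  show "(\<lambda>x. ennreal (indicator unit_cube x * f x)) \<in> borel_measurable cube_measure"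
    using assms(2) by (intro measurable_restrict_space1) simp
  show "AE x in cube_measure. ennreal (indicator unit_cube x * f x) = ennreal (f x)"
    by (rule AE_I2) (simp add: space_restrict_space)
qed

theorem theorem6:
  fixes p L s :: real
  assumes "2 \<le> p" and "0 < L" and "0 \<le> s" and "s < 1"
  shows "\<exists>(fhat :: nat \<Rightarrow> (nat \<Rightarrow> real ^ 'd) \<Rightarrow> real ^ 'd \<Rightarrow> real) (C :: real).
    0 < C \<and>
    (\<forall>n. histogram_estimator n (fhat n)) \<and>
    (\<forall>n\<ge>2.
      (\<forall>f\<in>holder_class s L.
        (\<lambda>X. wasserstein p (density_measure f) (density_measure (fhat n X)))
          \<in> borel_measurable (sample_measure n f)) \<and>
      (SUP f\<in>holder_class s L.
        \<integral>\<^sup>+X. wasserstein p (density_measure f) (density_measure (fhat n X)) \<partial>sample_measure n f)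
      \<le> ennreal (C * rate (real CARD('d)) s p n))"
proof -
  let ?D = "real CARD('d) + s"
  have d1: "1 \<le> real CARD('d)" by (simp add: Suc_le_eq)
  have D: "1 \<le> ?D" "0 < ?D" using assms d1 by linarith+
  obtain C3 where C3: "0 < C3" and C3_rate: "\<And>n J. 2 \<le> n \<Longrightarrow> (2 ^ J) powr ?D \<le> real n \<Longrightarrow>
    real n powr (- 1 / (2 * p)) * (\<Sum>j\<le>J. (2 powr (((real CARD('d) - s) / 2 - p) / p)) ^ j) \<le> C3 * rate (real CARD('d)) s p n"
    using geometric_rate[OF D(1), of p] assms by auto
  \<comment> \<open>\<open>level_const\<close> and \<open>total_const\<close> for
    \<open>\<kappa> = L * CARD('d)\<close>, spelled out because the constant has to be fixed before
    the density.\<close>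
  define B where "B = 1 + 4 * (1 + 2 ^ CARD('d)) * (72 * 2 ^ CARD('d))\<^sup>2 + 4 * (L * CARD('d)) * (1 + 2 ^ CARD('d))"
  define C2 where "C2 = CARD('d) powr p * (B + L * CARD('d) * 2 powr ((CARD('d) + s) / 2))"
  define C where "C = 2 * C2 powr (1 / p) * C3"
  define fhat :: "nat \<Rightarrow> (nat \<Rightarrow> real ^ 'd) \<Rightarrow> real ^ 'd \<Rightarrow> real"
    where "fhat n = histogram n (resolution ?D n)" for n
  have B: "0 < B" unfolding B_def using assms(2) by (intro add_pos_nonneg mult_nonneg_nonneg) auto
  have "0 < C2" unfolding C2_def using B assms(2) by (intro mult_pos_pos add_pos_pos) auto
  then have C: "0 < C" using C3 by (simp add: C_def)
  have bound: "(\<integral>\<^sup>+X. wasserstein p (density_measure f) (density_measure (fhat n X)) \<partial>sample_measure n f)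
    \<le> ennreal (C * rate (real CARD('d)) s p n)" if n: "2 \<le> n" and cls: "f \<in> holder_class s L" for n and f :: "real ^ 'd \<Rightarrow> real"
  proof -
    \<comment> \<open>Extending the density by 0 changes neither its measure on the cube nor the law
      of the sample.\<close>
    let ?f = "\<lambda>x. indicator unit_cube x * f x"
    interpret holder_density ?f p s "L * CARD('d)"
      by (rule holder_density_of_class[OF cls assms(2,3,4,1)])
    have pd: "prob_density_on_cube f" using cls unfolding holder_class_def by blast
    have dm: "density_measure ?f = density_measure f"
      by (rule density_measure_indicator[OF pd holder_density.f[OF holder_density_axioms]])
    then have sm: "sample_measure n ?f = sample_measure n f" by (simp add: sample_measure_def)
    have C2: "total_const = C2" by (simp add: total_const_def level_const_def C2_def B_def)
    let ?J = "resolution ?D n"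
    have J: "(2 ^ ?J) powr ?D \<le> real n" "real n \<le> (2 ^ Suc ?J) powr ?D"
      using resolution_bounds[OF D(2), of n] n by auto
    have "(\<integral>\<^sup>+X. wasserstein p (density_measure f) (density_measure (fhat n X)) \<partial>sample_measure n f)
      \<le> ennreal (2 * C2 powr (1 / p) * (real n powr (- 1 / (2 * p)) * (\<Sum>j\<le>?J. (2 powr (((real CARD('d) - s) / 2 - p) / p)) ^ j)))"
      using wasserstein_histogram_rate[of n ?J] n assms(3) J unfolding dm sm C2 fhat_def expo_def by simp
    also have "\<dots> \<le> ennreal (2 * C2 powr (1 / p) * (C3 * rate (real CARD('d)) s p n))"
      using C3_rate[OF n J(1)] by (intro ennreal_leI mult_left_mono) auto
    finally show ?thesis by (simp add: C_def mult.assoc)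
  qed
  show ?thesis
  proof (intro exI[of _ fhat] exI[of _ C] conjI allI impI ballI SUP_least bound C)
    show "histogram_estimator n (fhat n)" for n
      unfolding fhat_def by (rule histogram_estimator_histogram)
    show "(\<lambda>X. wasserstein p (density_measure f) (density_measure (fhat n X))) \<in> borel_measurable (sample_measure n f)"
      for n and f :: "real ^ 'd \<Rightarrow> real"
      unfolding fhat_def by (rule wasserstein_histogram_measurable)
  qed
qed

end
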